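(* Let $\mathcal{V}$ be a non-distributive variety of lattices, let $F$ be any free (resp., free bounded) lattice with at least $\aleph_2$ generators in $\mathcal{V}$, and put $D=\mathrm{Con}\,F$, which is a distributive algebraic lattice with at least $\aleph_2$ compact elements. Then there is no module $M$ (over any ring) such that $\mathrm{Sub}\,M\cong D$, no group $G$ such that $\mathrm{NSub}\,G\cong D$, and no $\ell$-group $G$ such that $\mathrm{Id}^{\ell}\,G\cong D$.
   Context: $\mathrm{Con}\,F$ denotes the congruence lattice of $F$; $\mathrm{Sub}\,M$ denotes the lattice of all submodules of a module $M$; $\mathrm{NSub}\,G$ denotes the lattice of all normal subgroups of a group $G$. An $\ell$-group is a lattice-ordered group (not necessarily commutative), and $\mathrm{Id}^{\ell}\,G$ denotes the lattice of all $\ell$-ideals, that is, convex normal $\ell$-subgroups (kernels of $\ell$-group homomorphisms), of the $\ell$-group $G$. A variety of lattices is non-distributive if it contains a non-distributive lattice. *)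

theory Defs
  imports "HOL-Algebra.Complete_Lattice" "HOL-Algebra.Coset" "HOL-Algebra.Module"
begin

section \<open>Lattices\<close>

definition lattice_hom :: "('a, 'c) gorder_scheme \<Rightarrow> ('b, 'd) gorder_scheme \<Rightarrow> ('a \<Rightarrow> 'b) set"
  where "lattice_hom L K = {h \<in> carrier L \<rightarrow> carrier K. join_pres L K h \<and> meet_pres L K h}"

definition bounded_lattice_hom ::
    "('a, 'c) gorder_scheme \<Rightarrow> ('b, 'd) gorder_scheme \<Rightarrow> ('a \<Rightarrow> 'b) set"
  where "bounded_lattice_hom L K =
    {h \<in> lattice_hom L K. h \<bottom>\<^bsub>L\<^esub> = \<bottom>\<^bsub>K\<^esub> \<and> h \<top>\<^bsub>L\<^esub> = \<top>\<^bsub>K\<^esub>}"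

definition lattice_iso :: "('a, 'c) gorder_scheme \<Rightarrow> ('b, 'd) gorder_scheme \<Rightarrow> bool"
    (infix \<open>\<cong>\<^sub>l\<close> 50)
  where "L \<cong>\<^sub>l K \<longleftrightarrow> (\<exists>h \<in> lattice_hom L K. bij_betw h (carrier L) (carrier K))"

definition distributive_lattice :: "('a, 'c) gorder_scheme \<Rightarrow> bool"
  where "distributive_lattice L \<longleftrightarrow> lattice L \<and>
    (\<forall>x\<in>carrier L. \<forall>y\<in>carrier L. \<forall>z\<in>carrier L.
       x \<sqinter>\<^bsub>L\<^esub> (y \<squnion>\<^bsub>L\<^esub> z) = (x \<sqinter>\<^bsub>L\<^esub> y) \<squnion>\<^bsub>L\<^esub> (x \<sqinter>\<^bsub>L\<^esub> z))"

definition compact_elements :: "('a, 'c) gorder_scheme \<Rightarrow> 'a set"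
  where "compact_elements L = {c \<in> carrier L.
    \<forall>A \<subseteq> carrier L. c \<sqsubseteq>\<^bsub>L\<^esub> \<Squnion>\<^bsub>L\<^esub>A \<longrightarrow> (\<exists>B \<subseteq> A. finite B \<and> c \<sqsubseteq>\<^bsub>L\<^esub> \<Squnion>\<^bsub>L\<^esub>B)}"

definition algebraic_lattice :: "('a, 'c) gorder_scheme \<Rightarrow> bool"
  where "algebraic_lattice L \<longleftrightarrow> complete_lattice L \<and>
    (\<forall>x\<in>carrier L. \<exists>C \<subseteq> compact_elements L. x = \<Squnion>\<^bsub>L\<^esub>C)"

definition inclusion_order :: "'a set set \<Rightarrow> 'a set gorder"
  where "inclusion_order \<S> = \<lparr>carrier = \<S>, eq = (=), le = (\<subseteq>)\<rparr>"

definition lattice_congruence :: "('a, 'c) gorder_scheme \<Rightarrow> ('a \<times> 'a) set \<Rightarrow> bool"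
  where "lattice_congruence L \<theta> \<longleftrightarrow> equiv (carrier L) \<theta> \<and>
    (\<forall>(x, x') \<in> \<theta>. \<forall>(y, y') \<in> \<theta>.
       (x \<squnion>\<^bsub>L\<^esub> y, x' \<squnion>\<^bsub>L\<^esub> y') \<in> \<theta> \<and> (x \<sqinter>\<^bsub>L\<^esub> y, x' \<sqinter>\<^bsub>L\<^esub> y') \<in> \<theta>)"

definition Con :: "('a, 'c) gorder_scheme \<Rightarrow> ('a \<times> 'a) set gorder"
  where "Con L = inclusion_order {\<theta>. lattice_congruence L \<theta>}"


section \<open>Varieties and free lattices\<close>

datatype lat_term = Var nat | Join lat_term lat_term | Meet lat_term lat_term

primrec lat_eval :: "('a, 'c) gorder_scheme \<Rightarrow> (nat \<Rightarrow> 'a) \<Rightarrow> lat_term \<Rightarrow> 'a" where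
  "lat_eval L \<nu> (Var n) = \<nu> n"
| "lat_eval L \<nu> (Join s t) = lat_eval L \<nu> s \<squnion>\<^bsub>L\<^esub> lat_eval L \<nu> t"
| "lat_eval L \<nu> (Meet s t) = lat_eval L \<nu> s \<sqinter>\<^bsub>L\<^esub> lat_eval L \<nu> t"

text \<open>A variety is an equational class. As it contains lattices over every type, it is represented
  by a set \<open>\<Sigma>\<close> of defining identities, and membership is a polymorphic predicate.\<close>

definition in_variety :: "(lat_term \<times> lat_term) set \<Rightarrow> ('a, 'c) gorder_scheme \<Rightarrow> bool"
  where "in_variety \<Sigma> L \<longleftrightarrow> lattice L \<and>
    (\<forall>(s, t) \<in> \<Sigma>. \<forall>\<nu> \<in> UNIV \<rightarrow> carrier L. lat_eval L \<nu> s = lat_eval L \<nu> t)"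

text \<open>The universal property of the free lattice on \<open>S\<close>. The test lattices \<open>L\<close> have their
  carriers in the type \<open>'a\<close> of the elements of \<open>F\<close>, since no quantification over
  types is possible. For infinite \<open>S\<close> this is no restriction: in a lattice over any type, the
  image of a map on \<open>S\<close> generates a (bounded) sublattice that has at most \<open>|S|\<close> elements, hence
  has an isomorphic copy with carrier in \<open>'a\<close>. Functions in \<open>\<rightarrow>\<^sub>E\<close> are pinned to
  \<open>undefined\<close> outside the carrier, so \<open>\<exists>!\<close> means uniqueness on the carrier.\<close>

definition free_lattice_in :: "(lat_term \<times> lat_term) set \<Rightarrow> 'a gorder \<Rightarrow> 'a set \<Rightarrow> bool"
  where "free_lattice_in \<Sigma> F S \<longleftrightarrow> in_variety \<Sigma> F \<and> S \<subseteq> carrier F \<and>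
    (\<forall>L :: 'a gorder. in_variety \<Sigma> L \<longrightarrow>
      (\<forall>g \<in> S \<rightarrow> carrier L. \<exists>!h. h \<in> carrier F \<rightarrow>\<^sub>E carrier L \<and>
         h \<in> lattice_hom F L \<and> (\<forall>x\<in>S. h x = g x)))"

definition free_bounded_lattice_in :: "(lat_term \<times> lat_term) set \<Rightarrow> 'a gorder \<Rightarrow> 'a set \<Rightarrow> bool"
  where "free_bounded_lattice_in \<Sigma> F S \<longleftrightarrow>
    in_variety \<Sigma> F \<and> bounded_lattice F \<and> S \<subseteq> carrier F \<and>
    (\<forall>L :: 'a gorder. in_variety \<Sigma> L \<and> bounded_lattice L \<longrightarrow>
      (\<forall>g \<in> S \<rightarrow> carrier L. \<exists>!h. h \<in> carrier F \<rightarrow>\<^sub>E carrier L \<and>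
         h \<in> bounded_lattice_hom F L \<and> (\<forall>x\<in>S. h x = g x)))"

definition at_least_aleph2 :: "'a set \<Rightarrow> bool"
  where "at_least_aleph2 S \<longleftrightarrow> (cardSuc (cardSuc natLeq), card_of S) \<in> ordLeq"


section \<open>Modules, groups, and lattice-ordered groups\<close>

text \<open>The library's \<^locale>\<open>module\<close> requires a commutative ring of scalars.\<close>

locale left_module = R?: ring + M?: abelian_group M for M (structure) +
  assumes smult_closed:
      "\<lbrakk>a \<in> carrier R; x \<in> carrier M\<rbrakk> \<Longrightarrow> a \<odot>\<^bsub>M\<^esub> x \<in> carrier M"
    and smult_l_distr:
      "\<lbrakk>a \<in> carrier R; b \<in> carrier R; x \<in> carrier M\<rbrakk> \<Longrightarrow>
      (a \<oplus> b) \<odot>\<^bsub>M\<^esub> x = a \<odot>\<^bsub>M\<^esub> x \<oplus>\<^bsub>M\<^esub> b \<odot>\<^bsub>M\<^esub> x"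
    and smult_r_distr:
      "\<lbrakk>a \<in> carrier R; x \<in> carrier M; y \<in> carrier M\<rbrakk> \<Longrightarrow>
      a \<odot>\<^bsub>M\<^esub> (x \<oplus>\<^bsub>M\<^esub> y) = a \<odot>\<^bsub>M\<^esub> x \<oplus>\<^bsub>M\<^esub> a \<odot>\<^bsub>M\<^esub> y"
    and smult_assoc:
      "\<lbrakk>a \<in> carrier R; b \<in> carrier R; x \<in> carrier M\<rbrakk> \<Longrightarrow>
      (a \<otimes> b) \<odot>\<^bsub>M\<^esub> x = a \<odot>\<^bsub>M\<^esub> (b \<odot>\<^bsub>M\<^esub> x)"
    and smult_one: "x \<in> carrier M \<Longrightarrow> \<one> \<odot>\<^bsub>M\<^esub> x = x"

definition Sub :: "('r, 'c) ring_scheme \<Rightarrow> ('r, 'm, 'd) module_scheme \<Rightarrow> 'm set gorder"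
  where "Sub R M = inclusion_order {N. submodule N R M}"

definition NSub :: "('g, 'c) monoid_scheme \<Rightarrow> 'g set gorder"
  where "NSub G = inclusion_order {N. N \<lhd> G}"

record 'a l_group = "'a monoid" +
  lle :: "'a \<Rightarrow> 'a \<Rightarrow> bool"

definition lg_order :: "('a, 'c) l_group_scheme \<Rightarrow> 'a gorder"
  where "lg_order G = \<lparr>carrier = carrier G, eq = (=), le = lle G\<rparr>"

locale lattice_ordered_group = group G + lg?: lattice "lg_order G" for G (structure) +
  assumes mult_left_mono:
      "\<lbrakk>x \<in> carrier G; y \<in> carrier G; z \<in> carrier G; lle G x y\<rbrakk> \<Longrightarrow> lle G (z \<otimes> x) (z \<otimes> y)"
    and mult_right_mono:
      "\<lbrakk>x \<in> carrier G; y \<in> carrier G; z \<in> carrier G; lle G x y\<rbrakk> \<Longrightarrow> lle G (x \<otimes> z) (y \<otimes> z)"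

definition l_ideal :: "'a set \<Rightarrow> ('a, 'c) l_group_scheme \<Rightarrow> bool"
  where "l_ideal N G \<longleftrightarrow> N \<lhd> G \<and>
    (\<forall>x\<in>N. \<forall>y\<in>N. x \<squnion>\<^bsub>lg_order G\<^esub> y \<in> N \<and> x \<sqinter>\<^bsub>lg_order G\<^esub> y \<in> N) \<and>
    (\<forall>x\<in>N. \<forall>y\<in>N. \<forall>z\<in>carrier G. lle G x z \<and> lle G z y \<longrightarrow> z \<in> N)"

definition l_Id :: "('a, 'c) l_group_scheme \<Rightarrow> 'a set gorder"
  where "l_Id G = inclusion_order {N. l_ideal N G}"


text \<open>Since \<open>lattice_hom\<close> (through \<^const>\<open>join_pres\<close>) entails that source and target are lattices,
  \<open>\<cong>\<^sub>l\<close> would fail vacuously if one of the following were not a lattice.\<close>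

lemma complete_lattice_inclusion_order:
  assumes "T \<in> \<S>" and "\<And>A. A \<in> \<S> \<Longrightarrow> A \<subseteq> T"
    and Inter: "\<And>\<A>. \<A> \<subseteq> \<S> \<Longrightarrow> \<A> \<noteq> {} \<Longrightarrow> \<Inter>\<A> \<in> \<S>"
  shows "complete_lattice (inclusion_order \<S>)"
proof -
  let ?L = "inclusion_order \<S>"
  interpret partial_order ?L
    by unfold_locales (auto simp: inclusion_order_def)
  show ?thesis
  proof (rule complete_lattice_criterion1)
    have "greatest ?L T (carrier ?L)"
      using assms by (auto simp: greatest_def inclusion_order_def)
    then show "\<exists>g. greatest ?L g (carrier ?L)" ..
  next
    fix \<A> assume "\<A> \<subseteq> carrier ?L" "\<A> \<noteq> {}"
    then have "greatest ?L (\<Inter>\<A>) (Lower ?L \<A>)"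
      using Inter[of \<A>] by (auto simp: greatest_def Lower_def inclusion_order_def)
    then show "\<exists>i. greatest ?L i (Lower ?L \<A>)" ..
  qed
qed

lemma complete_lattice_Sub:
  assumes "left_module R M"
  shows "complete_lattice (Sub R M)"
proof -
  interpret left_module R M by fact
  have grp: "group (add_monoid M)"
    using M.a_group .
  show ?thesis unfolding Sub_def
  proof (rule complete_lattice_inclusion_order)
    show "carrier M \<in> {N. submodule N R M}"
      using group.subgroup_self[OF grp]
      by (auto simp: submodule_def submodule_axioms_def smult_closed)
    show "A \<subseteq> carrier M" if "A \<in> {N. submodule N R M}" for A
      using that subgroup.subset[of A "add_monoid M"] by (auto simp: submodule_def)
    show "\<Inter>\<A> \<in> {N. submodule N R M}" if "\<A> \<subseteq> {N. submodule N R M}" "\<A> \<noteq> {}" for \<A>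
      using that group.subgroups_Inter[OF grp, of \<A>]
      by (auto simp: submodule_def submodule_axioms_def subset_iff)
  qed
qed

lemma (in group) normal_Inter:
  assumes "\<A> \<subseteq> {N. N \<lhd> G}" "\<A> \<noteq> {}"
  shows "\<Inter>\<A> \<lhd> G"
  using assms subgroups_Inter[of \<A>] by (auto simp: normal_inv_iff subset_iff)

lemma (in group) normal_carrier: "carrier G \<lhd> G"
  by (auto simp: normal_inv_iff subgroup_self)

lemma complete_lattice_NSub:
  assumes "group G"
  shows "complete_lattice (NSub G)"
proof -
  interpret group G by fact
  show ?thesis unfolding NSub_def
    by (rule complete_lattice_inclusion_order[of "carrier G"])
      (auto simp: normal_carrier dest: normal_imp_subgroup subgroup.subset intro: normal_Inter)
qed

lemma complete_lattice_l_Id: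
  assumes "lattice_ordered_group G"
  shows "complete_lattice (l_Id G)"
proof -
  interpret lattice_ordered_group G by fact
  have carr: "carrier (lg_order G) = carrier G" by (simp add: lg_order_def)
  show ?thesis unfolding l_Id_def
  proof (rule complete_lattice_inclusion_order)
    show "carrier G \<in> {N. l_ideal N G}"
      using lg.weak.join_closed lg.weak.meet_closed by (simp add: l_ideal_def normal_carrier carr)
    show "A \<subseteq> carrier G" if "A \<in> {N. l_ideal N G}" for A
      using that by (auto simp: l_ideal_def dest: normal_imp_subgroup subgroup.subset)
    show "\<Inter>\<A> \<in> {N. l_ideal N G}" if "\<A> \<subseteq> {N. l_ideal N G}" "\<A> \<noteq> {}" for \<A>
    proof -
      have "\<Inter>\<A> \<lhd> G"
        using that by (intro normal_Inter) (auto simp: l_ideal_def)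
      then show ?thesis
        using that unfolding l_ideal_def by blast
    qed
  qed
qed

end

theory Submission
  imports Defs "HOL.Hull" "HOL-Algebra.SndIsomorphismGrp" "HOL-Library.Countable_Set"
begin

text \<open>The lattice \<open>Con F\<close> is separated from the other three kinds of lattices by a property that is invariant
under isomorphism, here called weak uniform refinement. It concerns the covers \<open>e \<le> a\<^sub>i \<or> b\<^sub>i\<close> of a
compact element \<open>e\<close> and asks for compact elements \<open>c\<^sub>i\<^sub>j\<close> below \<open>a\<^sub>i \<or> a\<^sub>j\<close> and \<open>b\<^sub>i \<or> b\<^sub>j\<close> with
\<open>e \<le> a\<^sub>i \<or> b\<^sub>j \<or> c\<^sub>i\<^sub>j\<close> and \<open>c\<^sub>i\<^sub>k \<le> c\<^sub>i\<^sub>j \<or> c\<^sub>j\<^sub>k\<close>.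

Submodules, normal subgroups and l-ideals are normal subgroups whose joins are products. Therefore
each of the finitely many generators \<open>w\<close> of \<open>e\<close> factors as an element \<open>z\<^sub>i\<close> of \<open>a\<^sub>i\<close> times an
element of \<open>b\<^sub>i\<close>, and the members generated by the quotients \<open>z\<^sub>i\<^sup>-\<^sup>1z\<^sub>j\<close> serve as \<open>c\<^sub>i\<^sub>j\<close>
(locale \<open>permuting_normal_subgroups\<close>). For l-ideals, what has to be shown is that the product of two
of them is convex (\<open>l_ideal_set_mult\<close>).

In \<open>Con F\<close> the property fails (\<open>no_weak_uniform_refinement\<close>). Let \<open>e = \<Theta>(u, v)\<close>, where \<open>u\<close> and \<open>v\<close> are
the bounds of \<open>F\<close>, or two generators if \<open>F\<close> is not the free bounded lattice. Every other generator \<open>x\<close>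
gives the cover \<open>e \<le> \<Theta>(u, x) \<or> \<Theta>(x, v)\<close> and its mirror image. A compact congruence is generated by
pairs of words in finitely many generators. With \<open>\<aleph>\<^sub>2\<close> generators, Kuratowski's free set theorem
(\<open>three_element_free_set\<close>) provides generators \<open>x\<close>, \<open>y\<close>, \<open>z\<close> such that the \<open>c\<^sub>i\<^sub>j\<close> between covers
belonging to two of them do not involve the third. A non-distributive variety contains a bounded lattice
in which some \<open>q\<close> has two complements \<open>p\<close> and \<open>r\<close> with \<open>r\<close> not below \<open>p\<close>
(\<open>nondistributive_variety_witness\<close>). Sending \<open>x\<close>, \<open>y\<close>, \<open>z\<close> to \<open>p\<close>, \<open>q\<close>, \<open>r\<close> contradicts the triangle
inequality: the pairs \<open>p\<close>, \<open>q\<close> and \<open>q\<close>, \<open>r\<close> span sublattices in which \<open>c\<close> vanishes, while the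
distributive sublattice spanned by \<open>p\<close> and \<open>r\<close> does not allow \<open>c\<close> to vanish.

As for the remaining claims, congruences form an algebraic closure system, \<open>Con F\<close> is distributive by
the median term of lattices (\<open>distributive_lattice_Con\<close>), and the compact congruences \<open>\<Theta>(u, x)\<close> are
pairwise distinct (\<open>inj_on_cg\<close>).\<close>

section \<open>Free sets of three elements\<close>

text \<open>Kuratowski's free set theorem for pairs, with three-element free sets. A set \<open>Y \<subseteq> S\<close> of
cardinality \<open>\<aleph>\<^sub>1\<close> has only \<open>\<aleph>\<^sub>1\<close> pairs, so some \<open>z \<in> S\<close> lies outside all sets attached to them. Once
\<open>z\<close> is fixed, the argument repeats one cardinal lower with the finite sets \<open>\<Phi> x z\<close>: for a countably
infinite \<open>Z \<subseteq> Y\<close> some \<open>y \<in> Y\<close> lies outside all \<open>\<Phi> x z\<close> with \<open>x \<in> Z\<close>. Finally the finite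
set \<open>\<Phi> y z\<close> cannot cover \<open>Z\<close>.\<close>

context
  includes cardinal_syntax
begin

lemma three_element_free_set:
  fixes \<Phi> :: "'a \<Rightarrow> 'a \<Rightarrow> 'a set"
  assumes S: "at_least_aleph2 S"
    and fin: "\<And>x y. x \<in> S \<Longrightarrow> y \<in> S \<Longrightarrow> finite (\<Phi> x y)"
  obtains x y z where "x \<in> S" "y \<in> S" "z \<in> S" "x \<noteq> y" "x \<noteq> z" "y \<noteq> z"
    "z \<notin> \<Phi> x y" "y \<notin> \<Phi> x z" "x \<notin> \<Phi> y z"
proof -
  define \<kappa> where "\<kappa> = cardSuc natLeq"
  have c1: "Card_order \<kappa>"
    unfolding \<kappa>_def by (rule cardSuc_Card_order[OF natLeq_Card_order])
  have "(\<kappa>, |S| ) \<in> ordLeq"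
    using S cardSuc_ordLeq[OF c1] ordLeq_transitive
    unfolding at_least_aleph2_def \<kappa>_def by blast
  then have "|Field \<kappa>| \<le>o |S|"
    using card_of_Field_ordIso[OF c1] ordIso_ordLeq_trans by blast
  then obtain f where f: "inj_on f (Field \<kappa>)" "f ` Field \<kappa> \<subseteq> S"
    using card_of_ordLeq[of "Field \<kappa>" S] by blast
  define Y where "Y = f ` Field \<kappa>"
  have YS: "Y \<subseteq> S" using f Y_def by simp
  have Y: "|Y| =o \<kappa>"
    unfolding Y_def
    by (rule ordIso_transitive[OF ordIso_symmetric[OF card_of_ordIsoI[where f = f]] card_of_Field_ordIso[OF c1]])
      (simp add: bij_betw_def f(1))
  have infY: "infinite Y"
    using cardSuc_finite[OF natLeq_Card_order] f(1)
    unfolding Y_def \<kappa>_def by (simp add: Field_natLeq finite_image_iff)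
  define A where "A = Y \<union> (\<Union>(x, y) \<in> Y \<times> Y. \<Phi> x y)"
  have "|Y \<times> Y| \<le>o |Y|"
    using card_of_Times_same_infinite[OF infY] ordIso_iff_ordLeq by blast
  moreover have "|\<Phi> x y| \<le>o |Y|" if "x \<in> Y" "y \<in> Y" for x y
    using fin[of x y] that YS infY by (intro ordLess_imp_ordLeq finite_ordLess_infinite) (auto simp: Field_card_of card_of_well_order_on)
  ultimately have "|\<Union>(x, y) \<in> Y \<times> Y. \<Phi> x y| \<le>o |Y|"
    by (intro card_of_UNION_ordLeq_infinite infY) auto
  then have A: "|A| \<le>o |Y|"
    unfolding A_def 
    by (intro card_of_Un_ordLeq_infinite_Field) (simp_all add: Field_card_of infY card_of_mono1 card_of_card_order_on)
  have "\<not> S \<subseteq> A"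
  proof
    assume "S \<subseteq> A"
    then have "|S| \<le>o |Y|" using A card_of_mono1 ordLeq_transitive by blast
    then have "(cardSuc \<kappa>, \<kappa>) \<in> ordLeq"
      using S ordLeq_transitive[OF _ ordLeq_ordIso_trans[OF _ Y]]
      unfolding at_least_aleph2_def \<kappa>_def by blast
    then show False
      using cardSuc_greater[OF c1] not_ordLess_ordLeq by blast
  qed
  then obtain z where z: "z \<in> S" "z \<notin> A" by blast
  obtain g :: "nat \<Rightarrow> 'a" where g: "inj g" "range g \<subseteq> Y"
    using infinite_countable_subset[OF infY] by blast
  define Z where "Z = range g"
  have infZ: "infinite Z" unfolding Z_def using g(1) finite_imageD infinite_UNIV_nat by blast
  define B where "B = Z \<union> (\<Union>x \<in> Z. \<Phi> x z)"
  have ZS: "Z \<subseteq> S" using g(2) YS Z_def by blast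
  have "|\<Phi> x z| \<le>o |Z|" if "x \<in> Z" for x
    using fin[of x z] that ZS z(1) infZ by (intro ordLess_imp_ordLeq finite_ordLess_infinite) (auto simp: Field_card_of card_of_well_order_on)
  then have "|\<Union>x \<in> Z. \<Phi> x z| \<le>o |Z|"
    by (intro card_of_UNION_ordLeq_infinite infZ) (auto simp: card_of_mono1)
  then have "|B| \<le>o |Z|"
    unfolding B_def 
    by (intro card_of_Un_ordLeq_infinite_Field) (simp_all add: Field_card_of infZ card_of_mono1 card_of_card_order_on)
  moreover have "|Z| \<le>o natLeq"
    unfolding Z_def using card_of_image card_of_nat ordLeq_ordIso_trans by blast
  ultimately have B: "|B| \<le>o natLeq" using ordLeq_transitive by blast
  have "\<not> Y \<subseteq> B"
  proof
    assume "Y \<subseteq> B"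
    then have "|Y| \<le>o natLeq" using B card_of_mono1 ordLeq_transitive by blast
    then have "(cardSuc natLeq, natLeq) \<in> ordLeq"
      using ordIso_ordLeq_trans[OF ordIso_symmetric[OF Y]] unfolding \<kappa>_def by blast
    then show False
      using cardSuc_greater[OF natLeq_Card_order] not_ordLess_ordLeq by blast
  qed
  then obtain y where y: "y \<in> Y" "y \<notin> B" by blast
  have "\<not> Z \<subseteq> \<Phi> y z"
    using infZ fin[of y z] y(1) YS z(1) finite_subset by blast
  then obtain x where x: "x \<in> Z" "x \<notin> \<Phi> y z" by blast
  have "x \<in> Y" using x(1) g(2) Z_def by blast
  show thesis
  proof
    show "x \<in> S" "y \<in> S" "z \<in> S" using \<open>x \<in> Y\<close> y(1) YS z(1) by auto
    show "x \<noteq> y" "y \<notin> \<Phi> x z" using x(1) y(2) unfolding B_def by auto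
    show "x \<noteq> z" "y \<noteq> z" "z \<notin> \<Phi> x y" using z(2) \<open>x \<in> Y\<close> y(1) unfolding A_def by auto
    show "x \<notin> \<Phi> y z" by fact
  qed
qed

end

section \<open>Algebraic closure systems\<close>

lemma carrier_inclusion_order [simp]: "carrier (inclusion_order \<S>) = \<S>"
  and le_inclusion_order [simp]: "le (inclusion_order \<S>) = (\<subseteq>)"
  by (simp_all add: inclusion_order_def)

text \<open>The lattices of congruences, submodules, normal subgroups and l-ideals all arise in this way, so
the description of their joins and compact elements is needed only once.\<close>

locale algebraic_closure_system =
  fixes \<S> :: "'a set set" and T :: "'a set"
  assumes top_mem: "T \<in> \<S>"
    and subset_top: "A \<in> \<S> \<Longrightarrow> A \<subseteq> T"
    and Inter_mem: "\<lbrakk>\<A> \<subseteq> \<S>; \<A> \<noteq> {}\<rbrakk> \<Longrightarrow> \<Inter>\<A> \<in> \<S>"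
    and directed_Union_mem: "\<lbrakk>\<A> \<subseteq> \<S>; \<A> \<noteq> {}; \<And>A B. A \<in> \<A> \<Longrightarrow> B \<in> \<A> \<Longrightarrow> \<exists>C\<in>\<A>. A \<union> B \<subseteq> C\<rbrakk>
      \<Longrightarrow> \<Union>\<A> \<in> \<S>"
begin

abbreviation L :: "'a set gorder" where "L \<equiv> inclusion_order \<S>"
abbreviation cl :: "'a set \<Rightarrow> 'a set" where "cl X \<equiv> (\<lambda>N. N \<in> \<S>) hull X"

lemma complete: "complete_lattice L"
  using complete_lattice_inclusion_order top_mem subset_top Inter_mem by blast

lemma cl_mem: "X \<subseteq> T \<Longrightarrow> cl X \<in> \<S>"
  unfolding hull_def using top_mem Inter_mem[of "{t \<in> \<S>. X \<subseteq> t}"] by auto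

lemma sup_eq: 
  assumes "\<A> \<subseteq> \<S>" shows "\<Squnion>\<^bsub>L\<^esub>\<A> = cl (\<Union>\<A>)"
proof -
  interpret complete_lattice L by (rule complete)
  have "cl (\<Union>\<A>) \<in> \<S>" using assms subset_top by (intro cl_mem) blast
  moreover have upper: "A \<subseteq> cl (\<Union>\<A>)" if "A \<in> \<A>" for A
    using that hull_subset[of "\<Union>\<A>" "\<lambda>N. N \<in> \<S>"] by blast
  moreover have "cl (\<Union>\<A>) \<subseteq> B" if "B \<in> Upper L \<A>" for B
    using that assms by (intro hull_minimal) (auto simp: Upper_def)
  ultimately have "least L (cl (\<Union>\<A>)) (Upper L \<A>)"
    unfolding least_def by (auto simp: Upper_def)
  then show ?thesis
    using least_unique unfolding Lattice.sup_def by (intro some_equality) auto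
qed

lemma join_eq: "\<lbrakk>A \<in> \<S>; B \<in> \<S>\<rbrakk> \<Longrightarrow> A \<squnion>\<^bsub>L\<^esub> B = cl (A \<union> B)"
  unfolding Lattice.join_def by (subst sup_eq) auto

lemma meet_eq:
  assumes "A \<in> \<S>" "B \<in> \<S>" shows "A \<sqinter>\<^bsub>L\<^esub> B = A \<inter> B"
proof -
  interpret complete_lattice L by (rule complete)
  have "A \<inter> B \<in> \<S>" using assms Inter_mem[of "{A, B}"] by simp
  then have "greatest L (A \<inter> B) (Lower L {A, B})"
    using assms unfolding greatest_def Lower_def by auto
  then show ?thesis
    using greatest_unique unfolding Lattice.meet_def Lattice.inf_def by (intro some_equality) auto
qed

text \<open>The closures of the finite unions of members of \<open>\<A>\<close> form a directed family, so their union is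
again closed and contains \<open>\<Squnion>\<A>\<close>. Hence each element of \<open>W\<close> is reached by a finite subfamily.\<close>

lemma compact_cl:
  assumes W: "finite W" "W \<subseteq> T"
  shows "cl W \<in> compact_elements L"
proof -
  have "\<exists>\<B>\<subseteq>\<A>. finite \<B> \<and> cl W \<subseteq> \<Squnion>\<^bsub>L\<^esub>\<B>" if \<A>: "\<A> \<subseteq> \<S>" "cl W \<subseteq> \<Squnion>\<^bsub>L\<^esub>\<A>" for \<A>
  proof -
    define \<U> where "\<U> = (\<lambda>\<B>. cl (\<Union>\<B>)) ` {\<B>. \<B> \<subseteq> \<A> \<and> finite \<B>}"
    have cm: "cl (\<Union>\<B>) \<in> \<S>" if "\<B> \<subseteq> \<A>" for \<B>
      using that \<A>(1) subset_top by (intro cl_mem) blast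
    have "\<Union>\<U> \<in> \<S>"
    proof (rule directed_Union_mem)
      show "\<U> \<subseteq> \<S>" unfolding \<U>_def using cm by auto
      show "\<U> \<noteq> {}" unfolding \<U>_def by auto
      fix A B assume "A \<in> \<U>" "B \<in> \<U>"
      then obtain \<B> \<C> where "A = cl (\<Union>\<B>)" "B = cl (\<Union>\<C>)" "\<B> \<subseteq> \<A>" "\<C> \<subseteq> \<A>" "finite \<B>" "finite \<C>"
        unfolding \<U>_def by auto
      then have "A \<union> B \<subseteq> cl (\<Union>(\<B> \<union> \<C>))" "\<B> \<union> \<C> \<in> {\<B>. \<B> \<subseteq> \<A> \<and> finite \<B>}"
        using hull_mono[of "\<Union>\<B>" "\<Union>(\<B> \<union> \<C>)"] hull_mono[of "\<Union>\<C>" "\<Union>(\<B> \<union> \<C>)"] by auto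
      then have "A \<union> B \<subseteq> cl (\<Union>(\<B> \<union> \<C>))" "cl (\<Union>(\<B> \<union> \<C>)) \<in> \<U>"
        unfolding \<U>_def by (blast, blast)
      then show "\<exists>C\<in>\<U>. A \<union> B \<subseteq> C" by blast
    qed
    moreover have "A \<subseteq> \<Union>\<U>" if "A \<in> \<A>" for A
    proof -
      have "cl (\<Union>{A}) \<in> \<U>" unfolding \<U>_def using that by blast
      then show ?thesis using hull_subset[of A "\<lambda>N. N \<in> \<S>"] by auto
    qed
    ultimately have "cl (\<Union>\<A>) \<subseteq> \<Union>\<U>" by (intro hull_minimal) auto
    then have "W \<subseteq> \<Union>\<U>" using \<A> sup_eq hull_subset[of W "\<lambda>N. N \<in> \<S>"] by auto
    then have "\<forall>w\<in>W. \<exists>\<B>. \<B> \<subseteq> \<A> \<and> finite \<B> \<and> w \<in> cl (\<Union>\<B>)" unfolding \<U>_def by auto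
    then obtain \<beta> where \<beta>: "\<And>w. w \<in> W \<Longrightarrow> \<beta> w \<subseteq> \<A> \<and> finite (\<beta> w) \<and> w \<in> cl (\<Union>(\<beta> w))"
      by metis
    define \<B> where "\<B> = (\<Union>w\<in>W. \<beta> w)"
    have "\<B> \<subseteq> \<A>" "finite \<B>" using \<beta> W(1) unfolding \<B>_def by auto
    moreover have "W \<subseteq> cl (\<Union>\<B>)"
    proof
      fix w assume "w \<in> W"
      then have "cl (\<Union>(\<beta> w)) \<subseteq> cl (\<Union>\<B>)" unfolding \<B>_def by (intro hull_mono) blast
      then show "w \<in> cl (\<Union>\<B>)" using \<beta> \<open>w \<in> W\<close> by auto
    qed
    ultimately have "cl W \<subseteq> \<Squnion>\<^bsub>L\<^esub>\<B>"
      using cm sup_eq[of \<B>] \<A>(1) by (simp add: hull_minimal)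
    then show ?thesis using \<open>\<B> \<subseteq> \<A>\<close> \<open>finite \<B>\<close> by blast
  qed
  then show ?thesis
    unfolding compact_elements_def using cl_mem[OF W(2)] by simp
qed

lemma Squnion_cl_singletons:
  assumes "A \<in> \<S>" "B \<subseteq> A"
  shows "\<Squnion>\<^bsub>L\<^esub>((\<lambda>w. cl {w}) ` B) = cl B"
proof -
  have sub: "B \<subseteq> T" using assms subset_top by blast
  have "\<Squnion>\<^bsub>L\<^esub>((\<lambda>w. cl {w}) ` B) = cl (\<Union>w\<in>B. cl {w})"
    using sub by (subst sup_eq) (auto intro!: cl_mem)
  also have "\<dots> = cl B"
  proof
    have "cl {w} \<subseteq> cl B" if "w \<in> B" for w using that by (intro hull_mono) auto
    then show "cl (\<Union>w\<in>B. cl {w}) \<subseteq> cl B"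
      using cl_mem[OF sub] by (intro hull_minimal) auto
    show "cl B \<subseteq> cl (\<Union>w\<in>B. cl {w})"
      by (intro hull_mono) (auto intro: hull_inc)
  qed
  finally show ?thesis .
qed

lemma compact_elements_eq: "compact_elements L = {cl W | W. finite W \<and> W \<subseteq> T}"
proof
  show "{cl W | W. finite W \<and> W \<subseteq> T} \<subseteq> compact_elements L" using compact_cl by blast
  show "compact_elements L \<subseteq> {cl W | W. finite W \<and> W \<subseteq> T}"
  proof
    fix c assume c: "c \<in> compact_elements L"
    then have cS: "c \<in> \<S>" by (simp add: compact_elements_def)
    have eq: "\<Squnion>\<^bsub>L\<^esub>((\<lambda>w. cl {w}) ` c) = c"
      using Squnion_cl_singletons[OF cS, of c] hull_same[of "\<lambda>N. N \<in> \<S>" c] cS by simp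
    have "(\<lambda>w. cl {w}) ` c \<subseteq> \<S>" using subset_top[OF cS] by (auto intro!: cl_mem)
    moreover have "\<forall>\<A>\<subseteq>\<S>. c \<subseteq> \<Squnion>\<^bsub>L\<^esub>\<A> \<longrightarrow> (\<exists>\<B>\<subseteq>\<A>. finite \<B> \<and> c \<subseteq> \<Squnion>\<^bsub>L\<^esub>\<B>)"
      using c by (simp add: compact_elements_def)
    ultimately obtain \<B> where "\<B> \<subseteq> (\<lambda>w. cl {w}) ` c" "finite \<B>" "c \<subseteq> \<Squnion>\<^bsub>L\<^esub>\<B>"
      using eq by (metis subset_refl)
    then obtain W where W: "W \<subseteq> c" "finite W" "c \<subseteq> cl W"
      using finite_subset_image[of \<B> "\<lambda>w. cl {w}" c] Squnion_cl_singletons[OF cS] by metis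
    then have "c = cl W" using cS by (simp add: hull_minimal subset_antisym)
    then show "c \<in> {cl W | W. finite W \<and> W \<subseteq> T}" using W subset_top[OF cS] by blast
  qed
qed

lemma algebraic: "algebraic_lattice L"
  unfolding algebraic_lattice_def
proof (intro conjI complete ballI)
  fix A assume "A \<in> carrier L"
  then have A: "A \<in> \<S>" by simp
  have "(\<lambda>w. cl {w}) ` A \<subseteq> compact_elements L"
    using subset_top[OF A] by (auto intro!: compact_cl)
  moreover have "A = \<Squnion>\<^bsub>L\<^esub>((\<lambda>w. cl {w}) ` A)"
    using Squnion_cl_singletons[OF A, of A] hull_same[of "\<lambda>N. N \<in> \<S>" A] A by simp
  ultimately show "\<exists>C\<subseteq>compact_elements L. A = \<Squnion>\<^bsub>L\<^esub>C" by blast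
qed

end

section \<open>Weak uniform refinement\<close>

definition covers :: "('a, 'c) gorder_scheme \<Rightarrow> 'a \<Rightarrow> ('a \<times> 'a) set"
  where "covers L e = {(a, b) \<in> carrier L \<times> carrier L. e \<sqsubseteq>\<^bsub>L\<^esub> a \<squnion>\<^bsub>L\<^esub> b}"

text \<open>A variant of Wehrung's uniform refinement properties. If the covers of \<open>e\<close> are read as the
points of a space, then \<open>c\<close> behaves like a distance: it satisfies the triangle inequality, is small
where the left or the right parts of the covers are small, and is large enough to repair the
exchange of \<open>j\<close> for \<open>i\<close> in the right part of a cover. Indexing \<open>c\<close> by the covers themselves
instead of by an index set avoids a quantification over types.\<close>

definition weak_uniform_refinement :: "('a, 'c) gorder_scheme \<Rightarrow> bool"
  where "weak_uniform_refinement L \<longleftrightarrow> (\<forall>e \<in> compact_elements L. \<exists>c.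
    \<forall>i \<in> covers L e. \<forall>j \<in> covers L e. c i j \<in> compact_elements L
      \<and> c i j \<sqsubseteq>\<^bsub>L\<^esub> fst i \<squnion>\<^bsub>L\<^esub> fst j \<and> c i j \<sqsubseteq>\<^bsub>L\<^esub> snd i \<squnion>\<^bsub>L\<^esub> snd j
      \<and> e \<sqsubseteq>\<^bsub>L\<^esub> fst i \<squnion>\<^bsub>L\<^esub> (snd j \<squnion>\<^bsub>L\<^esub> c i j)
      \<and> (\<forall>k \<in> covers L e. c i k \<sqsubseteq>\<^bsub>L\<^esub> c i j \<squnion>\<^bsub>L\<^esub> c j k))"

lemma lattice_homD:
  assumes "h \<in> lattice_hom L K"
  shows "lattice L" "lattice K" "x \<in> carrier L \<Longrightarrow> h x \<in> carrier K"
    "\<lbrakk>x \<in> carrier L; y \<in> carrier L\<rbrakk> \<Longrightarrow> h (x \<squnion>\<^bsub>L\<^esub> y) = h x \<squnion>\<^bsub>K\<^esub> h y"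
    "\<lbrakk>x \<in> carrier L; y \<in> carrier L\<rbrakk> \<Longrightarrow> h (x \<sqinter>\<^bsub>L\<^esub> y) = h x \<sqinter>\<^bsub>K\<^esub> h y"
  using assms unfolding lattice_hom_def join_pres_def meet_pres_def by auto

lemma lattice_homI:
  assumes "lattice L" "lattice K" "\<And>x. x \<in> carrier L \<Longrightarrow> h x \<in> carrier K"
    "\<And>x y. \<lbrakk>x \<in> carrier L; y \<in> carrier L\<rbrakk> \<Longrightarrow> h (x \<squnion>\<^bsub>L\<^esub> y) = h x \<squnion>\<^bsub>K\<^esub> h y"
    "\<And>x y. \<lbrakk>x \<in> carrier L; y \<in> carrier L\<rbrakk> \<Longrightarrow> h (x \<sqinter>\<^bsub>L\<^esub> y) = h x \<sqinter>\<^bsub>K\<^esub> h y"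
  shows "h \<in> lattice_hom L K"
  using assms unfolding lattice_hom_def join_pres_def meet_pres_def by auto

lemma inv_into_lattice_hom:
  assumes h: "h \<in> lattice_hom L K" and bij: "bij_betw h (carrier L) (carrier K)"
  shows "inv_into (carrier L) h \<in> lattice_hom K L"
proof -
  define g where "g = inv_into (carrier L) h"
  note hD = lattice_homD[OF h]
  interpret L: lattice L by (rule hD)
  interpret K: lattice K by (rule hD)
  have g: "g y \<in> carrier L" "h (g y) = y" if "y \<in> carrier K" for y
    using that bij bij_betw_inv_into_right[OF bij] bij_betw_inv_into[OF bij]
    unfolding g_def by (auto dest: bij_betwE)
  have gh: "g (h x) = x" if "x \<in> carrier L" for x
    using that bij_betw_inv_into_left[OF bij] unfolding g_def by blast
  show ?thesis
    unfolding g_def[symmetric]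
  proof (rule lattice_homI)
    fix x y assume xy: "x \<in> carrier K" "y \<in> carrier K"
    show "g (x \<squnion>\<^bsub>K\<^esub> y) = g x \<squnion>\<^bsub>L\<^esub> g y"
      using xy g gh[of "g x \<squnion>\<^bsub>L\<^esub> g y"] hD(4)[of "g x" "g y"] by simp
    show "g (x \<sqinter>\<^bsub>K\<^esub> y) = g x \<sqinter>\<^bsub>L\<^esub> g y"
      using xy g gh[of "g x \<sqinter>\<^bsub>L\<^esub> g y"] hD(5)[of "g x" "g y"] by simp
  qed (use hD g in auto)
qed

lemma lattice_hom_mono:
  assumes h: "h \<in> lattice_hom L K" and x: "x \<in> carrier L" "y \<in> carrier L" "x \<sqsubseteq>\<^bsub>L\<^esub> y"
  shows "h x \<sqsubseteq>\<^bsub>K\<^esub> h y"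
proof -
  interpret L: lattice L by (rule lattice_homD[OF h])
  interpret K: lattice K by (rule lattice_homD[OF h])
  have "h x \<squnion>\<^bsub>K\<^esub> h y = h y"
    using L.le_iff_meet[OF x(1,2)] x lattice_homD(4)[OF h x(1,2)] by simp
  then show ?thesis using K.le_iff_meet lattice_homD(3)[OF h] x by simp
qed

text \<open>A bijective lattice homomorphism and its inverse are both monotone. Monotonicity of the one bounds
\<open>\<Squnion>A\<close> by the image of a join in \<open>L\<close>, and monotonicity of the other carries a finite subfamily back.\<close>

lemma compact_elements_lattice_iso:
  assumes h: "h \<in> lattice_hom L K" and bij: "bij_betw h (carrier L) (carrier K)"
    and "complete_lattice L" "complete_lattice K" and c: "c \<in> compact_elements L"
  shows "h c \<in> compact_elements K"
proof -
  interpret L: complete_lattice L by fact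
  interpret K: complete_lattice K by fact
  define g where "g = inv_into (carrier L) h"
  have g: "g \<in> lattice_hom K L"
    unfolding g_def by (rule inv_into_lattice_hom[OF h bij])
  note hD = lattice_homD[OF h] and gD = lattice_homD[OF g]
  have hg: "h (g y) = y" if "y \<in> carrier K" for y
    using that bij_betw_inv_into_right[OF bij] unfolding g_def by blast
  have gh: "g (h x) = x" if "x \<in> carrier L" for x
    using that bij_betw_inv_into_left[OF bij] unfolding g_def by blast
  have cL: "c \<in> carrier L" using c by (simp add: compact_elements_def)
  have "\<exists>B\<subseteq>A. finite B \<and> h c \<sqsubseteq>\<^bsub>K\<^esub> \<Squnion>\<^bsub>K\<^esub>B" if A: "A \<subseteq> carrier K" "h c \<sqsubseteq>\<^bsub>K\<^esub> \<Squnion>\<^bsub>K\<^esub>A" for A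
  proof -
    have gA: "g ` A \<subseteq> carrier L" using A(1) gD(3) by auto
    have "a \<sqsubseteq>\<^bsub>K\<^esub> h (\<Squnion>\<^bsub>L\<^esub>(g ` A))" if "a \<in> A" for a
      using lattice_hom_mono[OF h, of "g a" "\<Squnion>\<^bsub>L\<^esub>(g ` A)"] that A(1) gA L.sup_upper[OF gA, of "g a"]
        gD(3)[of a] hg[of a] by auto
    then have "\<Squnion>\<^bsub>K\<^esub>A \<sqsubseteq>\<^bsub>K\<^esub> h (\<Squnion>\<^bsub>L\<^esub>(g ` A))"
      using A(1) gA hD(3) by (intro K.sup_least) auto
    then have "h c \<sqsubseteq>\<^bsub>K\<^esub> h (\<Squnion>\<^bsub>L\<^esub>(g ` A))"
      using K.le_trans[OF A(2)] A(1) gA hD(3) cL by simp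
    then have "c \<sqsubseteq>\<^bsub>L\<^esub> \<Squnion>\<^bsub>L\<^esub>(g ` A)"
      using lattice_hom_mono[OF g, of "h c" "h (\<Squnion>\<^bsub>L\<^esub>(g ` A))"] hD(3) cL gA gh by simp
    then obtain B' where "B' \<subseteq> g ` A" "finite B'" "c \<sqsubseteq>\<^bsub>L\<^esub> \<Squnion>\<^bsub>L\<^esub>B'"
      using c gA unfolding compact_elements_def by blast
    then obtain B where B: "B \<subseteq> A" "finite B" "c \<sqsubseteq>\<^bsub>L\<^esub> \<Squnion>\<^bsub>L\<^esub>(g ` B)"
      using finite_subset_image by metis
    have BK: "B \<subseteq> carrier K" and gB: "g ` B \<subseteq> carrier L" using B(1) A(1) gA by blast+
    have "\<Squnion>\<^bsub>L\<^esub>(g ` B) \<sqsubseteq>\<^bsub>L\<^esub> g (\<Squnion>\<^bsub>K\<^esub>B)"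
      using gB BK gD(3) K.sup_upper[OF BK] by (intro L.sup_least) (auto intro!: lattice_hom_mono[OF g])
    then have "c \<sqsubseteq>\<^bsub>L\<^esub> g (\<Squnion>\<^bsub>K\<^esub>B)"
      using L.le_trans[OF B(3)] cL gB BK gD(3) by simp
    then have "h c \<sqsubseteq>\<^bsub>K\<^esub> \<Squnion>\<^bsub>K\<^esub>B"
      using lattice_hom_mono[OF h, of c "g (\<Squnion>\<^bsub>K\<^esub>B)"] cL BK gD(3) hg by simp
    then show ?thesis using B by blast
  qed
  then show ?thesis using hD(3)[OF cL] unfolding compact_elements_def by blast
qed

lemma weak_uniform_refinement_lattice_iso:
  assumes iso: "L \<cong>\<^sub>l K" and L: "complete_lattice L" and K: "complete_lattice K"
    and wur: "weak_uniform_refinement L"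
  shows "weak_uniform_refinement K"
  unfolding weak_uniform_refinement_def
proof
  fix e assume e: "e \<in> compact_elements K"
  obtain h where h: "h \<in> lattice_hom L K" and bij: "bij_betw h (carrier L) (carrier K)"
    using iso unfolding lattice_iso_def by blast
  interpret L: complete_lattice L by fact
  interpret K: complete_lattice K by fact
  define g where "g = inv_into (carrier L) h"
  have g: "g \<in> lattice_hom K L"
    unfolding g_def by (rule inv_into_lattice_hom[OF h bij])
  have gbij: "bij_betw g (carrier K) (carrier L)"
    unfolding g_def by (rule bij_betw_inv_into[OF bij])
  note hD = lattice_homD[OF h] and gD = lattice_homD[OF g]
  have hg: "h (g y) = y" if "y \<in> carrier K" for y
    using that bij_betw_inv_into_right[OF bij] unfolding g_def by blast
  have eK: "e \<in> carrier K" using e by (simp add: compact_elements_def)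
  have ge: "g e \<in> compact_elements L"
    by (rule compact_elements_lattice_iso[OF g gbij K L e])
  define p where "p = map_prod g g"
  obtain c where c: "\<And>i j. \<lbrakk>i \<in> covers L (g e); j \<in> covers L (g e)\<rbrakk> \<Longrightarrow> c i j \<in> compact_elements L
      \<and> c i j \<sqsubseteq>\<^bsub>L\<^esub> fst i \<squnion>\<^bsub>L\<^esub> fst j \<and> c i j \<sqsubseteq>\<^bsub>L\<^esub> snd i \<squnion>\<^bsub>L\<^esub> snd j
      \<and> g e \<sqsubseteq>\<^bsub>L\<^esub> fst i \<squnion>\<^bsub>L\<^esub> (snd j \<squnion>\<^bsub>L\<^esub> c i j)
      \<and> (\<forall>k \<in> covers L (g e). c i k \<sqsubseteq>\<^bsub>L\<^esub> c i j \<squnion>\<^bsub>L\<^esub> c j k)"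
    using wur ge unfolding weak_uniform_refinement_def by metis
  have p: "p i \<in> covers L (g e)" if "i \<in> covers K e" for i
    using that gD(3) gD(4)[of "fst i" "snd i"] lattice_hom_mono[OF g eK, of "fst i \<squnion>\<^bsub>K\<^esub> snd i"]
    unfolding covers_def p_def by auto
  have fs: "fst i \<in> carrier K" "snd i \<in> carrier K" "fst (p i) = g (fst i)" "snd (p i) = g (snd i)"
    if "i \<in> covers K e" for i
    using that unfolding covers_def p_def by auto
  have le: "h x \<sqsubseteq>\<^bsub>K\<^esub> y \<squnion>\<^bsub>K\<^esub> z" if "x \<sqsubseteq>\<^bsub>L\<^esub> g y \<squnion>\<^bsub>L\<^esub> g z" "x \<in> carrier L" "y \<in> carrier K" "z \<in> carrier K"
    for x y z
    using lattice_hom_mono[OF h, of x "g y \<squnion>\<^bsub>L\<^esub> g z"] that gD(3) hD(4)[of "g y" "g z"] hg by simp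
  define c' where "c' i j = h (c (p i) (p j))" for i j
  have cL: "c (p i) (p j) \<in> carrier L" if "i \<in> covers K e" "j \<in> covers K e" for i j
    using c[OF p[OF that(1)] p[OF that(2)]] by (simp add: compact_elements_def)
  have cK: "c' i j \<in> carrier K" "g (c' i j) = c (p i) (p j)" if "i \<in> covers K e" "j \<in> covers K e" for i j
    using cL[OF that] hD(3) bij_betw_inv_into_left[OF bij] unfolding c'_def g_def by auto
  show "\<exists>c. \<forall>i \<in> covers K e. \<forall>j \<in> covers K e. c i j \<in> compact_elements K
      \<and> c i j \<sqsubseteq>\<^bsub>K\<^esub> fst i \<squnion>\<^bsub>K\<^esub> fst j \<and> c i j \<sqsubseteq>\<^bsub>K\<^esub> snd i \<squnion>\<^bsub>K\<^esub> snd j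
      \<and> e \<sqsubseteq>\<^bsub>K\<^esub> fst i \<squnion>\<^bsub>K\<^esub> (snd j \<squnion>\<^bsub>K\<^esub> c i j)
      \<and> (\<forall>k \<in> covers K e. c i k \<sqsubseteq>\<^bsub>K\<^esub> c i j \<squnion>\<^bsub>K\<^esub> c j k)"
  proof (intro exI[of _ c'] ballI conjI)
    fix i j assume ij: "i \<in> covers K e" "j \<in> covers K e"
    note c_ij = c[OF p[OF ij(1)] p[OF ij(2)]]
    show "c' i j \<in> compact_elements K"
      unfolding c'_def using compact_elements_lattice_iso[OF h bij L K] c_ij by blast
    show "c' i j \<sqsubseteq>\<^bsub>K\<^esub> fst i \<squnion>\<^bsub>K\<^esub> fst j" "c' i j \<sqsubseteq>\<^bsub>K\<^esub> snd i \<squnion>\<^bsub>K\<^esub> snd j"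
      unfolding c'_def using c_ij fs[OF ij(1)] fs[OF ij(2)] cL[OF ij] by (auto intro!: le)
    have "g (snd j \<squnion>\<^bsub>K\<^esub> c' i j) = g (snd j) \<squnion>\<^bsub>L\<^esub> c (p i) (p j)"
      using gD(4)[of "snd j" "c' i j"] fs[OF ij(2)] cK[OF ij] by simp
    then have "h (g e) \<sqsubseteq>\<^bsub>K\<^esub> fst i \<squnion>\<^bsub>K\<^esub> (snd j \<squnion>\<^bsub>K\<^esub> c' i j)"
      using c_ij fs[OF ij(1)] fs[OF ij(2)] cK[OF ij] gD(3)[OF eK] by (intro le) auto
    then show "e \<sqsubseteq>\<^bsub>K\<^esub> fst i \<squnion>\<^bsub>K\<^esub> (snd j \<squnion>\<^bsub>K\<^esub> c' i j)" using hg[OF eK] by simp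
    fix k assume k: "k \<in> covers K e"
    have "h (c (p i) (p k)) \<sqsubseteq>\<^bsub>K\<^esub> c' i j \<squnion>\<^bsub>K\<^esub> c' j k"
      using c_ij p[OF k] cK[OF ij] cK[OF ij(2) k] cL[OF ij(1) k] by (intro le) auto
    then show "c' i k \<sqsubseteq>\<^bsub>K\<^esub> c' i j \<squnion>\<^bsub>K\<^esub> c' j k" unfolding c'_def[of i k] .
  qed
qed

section \<open>Closure systems of permuting normal subgroups\<close>

text \<open>Closure under products says that the join of two members is their product, in other words that
the congruences belonging to \<open>\<S>\<close> permute.\<close>

locale permuting_normal_subgroups = group G + algebraic_closure_system \<S> "carrier G"
  for G (structure) and \<S> +
  assumes normal: "N \<in> \<S> \<Longrightarrow> N \<lhd> G"
    and set_mult_mem: "\<lbrakk>A \<in> \<S>; B \<in> \<S>\<rbrakk> \<Longrightarrow> A <#> B \<in> \<S>"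
begin

lemma subgroup: "N \<in> \<S> \<Longrightarrow> subgroup N G"
  using normal normal_imp_subgroup by blast

lemma mult_inv_mult_cancel: "\<lbrakk>x \<in> carrier G; y \<in> carrier G\<rbrakk> \<Longrightarrow> x \<otimes> (inv x \<otimes> y) = y"
  by (simp add: m_assoc[symmetric])

lemma join_subset_set_mult:
  assumes "A \<in> \<S>" "B \<in> \<S>"
  shows "A \<squnion>\<^bsub>L\<^esub> B \<subseteq> A <#> B"
proof -
  have "A \<union> B \<subseteq> A <#> B"
  proof
    fix x assume x: "x \<in> A \<union> B"
    then have "x \<in> carrier G" using assms subset_top by blast
    moreover have "\<one> \<in> A" "\<one> \<in> B" using assms subgroup subgroup.one_closed by blast+
    ultimately show "x \<in> A <#> B"
      using x unfolding set_mult_def by (force intro: bexI[of _ "\<one>"])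
  qed
  then show ?thesis
    using join_eq[OF assms] set_mult_mem[OF assms] by (simp add: hull_minimal)
qed

lemma subset_join: 
  assumes "A \<in> \<S>" "B \<in> \<S>"
  shows "A \<squnion>\<^bsub>L\<^esub> B \<in> \<S>" "A \<subseteq> A \<squnion>\<^bsub>L\<^esub> B" "B \<subseteq> A \<squnion>\<^bsub>L\<^esub> B"
proof -
  show "A \<squnion>\<^bsub>L\<^esub> B \<in> \<S>" using assms subset_top join_eq cl_mem by simp
  show "A \<subseteq> A \<squnion>\<^bsub>L\<^esub> B" "B \<subseteq> A \<squnion>\<^bsub>L\<^esub> B"
    using join_eq[OF assms] hull_subset[of "A \<union> B" "\<lambda>N. N \<in> \<S>"] by auto
qed

text \<open>Let \<open>e\<close> be generated by the finite set \<open>W\<close>. If \<open>e \<le> a \<or> b\<close>, then each \<open>w \<in> W\<close> is a product of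
some \<open>z \<in> a\<close> and some \<open>z\<^sup>-\<^sup>1w \<in> b\<close>. Choosing such a \<open>z\<close> for each cover, the element \<open>c i j\<close>
generated by the quotients \<open>z\<^sub>i\<^sup>-\<^sup>1z\<^sub>j\<close> is compact because \<open>W\<close> is finite. All its properties are
identities in the group, such as \<open>w = z\<^sub>i \<cdot> z\<^sub>i\<^sup>-\<^sup>1z\<^sub>j \<cdot> z\<^sub>j\<^sup>-\<^sup>1w\<close>.\<close>

lemma weak_uniform_refinement: "weak_uniform_refinement L"
  unfolding weak_uniform_refinement_def
proof
  fix e assume e: "e \<in> compact_elements L"
  then obtain W where W: "finite W" "W \<subseteq> carrier G" and eW: "e = cl W"
    using compact_elements_eq by blast
  have "\<exists>x. x \<in> fst i \<and> inv x \<otimes> w \<in> snd i" if i: "i \<in> covers L e" and w: "w \<in> W" for i w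
  proof -
    have S: "fst i \<in> \<S>" "snd i \<in> \<S>" and "e \<subseteq> fst i \<squnion>\<^bsub>L\<^esub> snd i"
      using i unfolding covers_def by auto
    then have "w \<in> fst i <#> snd i"
      using join_subset_set_mult[OF S] w hull_subset[of W "\<lambda>N. N \<in> \<S>"] eW by blast
    then obtain x y where xy: "x \<in> fst i" "y \<in> snd i" "w = x \<otimes> y" unfolding set_mult_def by blast
    moreover have "x \<in> carrier G" "y \<in> carrier G" using xy S subset_top by blast+
    ultimately have "inv x \<otimes> w = y" by (simp add: inv_solve_left')
    then show ?thesis using xy by blast
  qed
  then obtain z where z: "\<And>i w. \<lbrakk>i \<in> covers L e; w \<in> W\<rbrakk> \<Longrightarrow> z i w \<in> fst i \<and> inv (z i w) \<otimes> w \<in> snd i"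
    by metis
  have S: "fst i \<in> \<S>" "snd i \<in> \<S>" if "i \<in> covers L e" for i
    using that unfolding covers_def by auto
  have zG: "z i w \<in> carrier G" if "i \<in> covers L e" "w \<in> W" for i w
    using z[OF that] S[OF that(1)] subset_top by blast
  \<comment> \<open>The finitely many quotients that generate the distance of two covers.\<close>
  define X where "X i j = (\<lambda>w. inv (z i w) \<otimes> z j w) ` W" for i j
  define c where "c i j = cl (X i j)" for i j
  have X: "finite (X i j)" "X i j \<subseteq> carrier G" if "i \<in> covers L e" "j \<in> covers L e" for i j
    using W(1) zG[OF that(1)] zG[OF that(2)] unfolding X_def
    by (simp_all add: image_subset_iff)
  have cS: "c i j \<in> \<S>" if "i \<in> covers L e" "j \<in> covers L e" for i j
    unfolding c_def using cl_mem X(2)[OF that] by blast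
  have c_mem: "inv (z i w) \<otimes> z j w \<in> c i j" if "w \<in> W" for i j w
    unfolding c_def X_def using that by (intro hull_inc) auto
  show "\<exists>c. \<forall>i \<in> covers L e. \<forall>j \<in> covers L e. c i j \<in> compact_elements L
      \<and> c i j \<sqsubseteq>\<^bsub>L\<^esub> fst i \<squnion>\<^bsub>L\<^esub> fst j \<and> c i j \<sqsubseteq>\<^bsub>L\<^esub> snd i \<squnion>\<^bsub>L\<^esub> snd j
      \<and> e \<sqsubseteq>\<^bsub>L\<^esub> fst i \<squnion>\<^bsub>L\<^esub> (snd j \<squnion>\<^bsub>L\<^esub> c i j)
      \<and> (\<forall>k \<in> covers L e. c i k \<sqsubseteq>\<^bsub>L\<^esub> c i j \<squnion>\<^bsub>L\<^esub> c j k)"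
    unfolding le_inclusion_order
  proof (intro exI[of _ c] ballI conjI)
    fix i j assume i: "i \<in> covers L e" and j: "j \<in> covers L e"
    note Si = S[OF i] and Sj = S[OF j]
    show "c i j \<in> compact_elements L" unfolding c_def using compact_cl X[OF i j] by blast
    have zz: "z i w \<in> fst i" "inv (z i w) \<otimes> w \<in> snd i" "z j w \<in> fst j" "inv (z j w) \<otimes> w \<in> snd j"
      "z i w \<in> carrier G" "z j w \<in> carrier G" "w \<in> carrier G" if "w \<in> W" for w
      using z[OF i that] z[OF j that] zG[OF i that] zG[OF j that] W(2) that by auto
    have "inv (z i w) \<otimes> z j w \<in> fst i \<squnion>\<^bsub>L\<^esub> fst j" if w: "w \<in> W" for w
    proof -
      note sub = subgroup[OF subset_join(1)[OF Si(1) Sj(1)]]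
      have "z i w \<in> fst i \<squnion>\<^bsub>L\<^esub> fst j" "z j w \<in> fst i \<squnion>\<^bsub>L\<^esub> fst j"
        using zz[OF w] subset_join[OF Si(1) Sj(1)] by blast+
      then show ?thesis using subgroup.m_closed[OF sub] subgroup.m_inv_closed[OF sub] by blast
    qed
    then show "c i j \<subseteq> fst i \<squnion>\<^bsub>L\<^esub> fst j"
      unfolding c_def X_def using subset_join(1)[OF Si(1) Sj(1)] by (intro hull_minimal) auto
    have "inv (z i w) \<otimes> z j w \<in> snd i \<squnion>\<^bsub>L\<^esub> snd j" if w: "w \<in> W" for w
    proof -
      note sub = subgroup[OF subset_join(1)[OF Si(2) Sj(2)]]
      have "inv (z i w) \<otimes> w \<in> snd i \<squnion>\<^bsub>L\<^esub> snd j" "inv (z j w) \<otimes> w \<in> snd i \<squnion>\<^bsub>L\<^esub> snd j"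
        using zz[OF w] subset_join[OF Si(2) Sj(2)] by blast+
      then have "(inv (z i w) \<otimes> w) \<otimes> inv (inv (z j w) \<otimes> w) \<in> snd i \<squnion>\<^bsub>L\<^esub> snd j"
        using subgroup.m_closed[OF sub] subgroup.m_inv_closed[OF sub] by blast
      moreover have "(inv (z i w) \<otimes> w) \<otimes> inv (inv (z j w) \<otimes> w) = inv (z i w) \<otimes> z j w"
        using zz(5,6,7)[OF w] by (simp add: inv_mult_group m_assoc mult_inv_mult_cancel)
      ultimately show ?thesis by simp
    qed
    then show "c i j \<subseteq> snd i \<squnion>\<^bsub>L\<^esub> snd j"
      unfolding c_def X_def using subset_join(1)[OF Si(2) Sj(2)] by (intro hull_minimal) auto
    note J = subset_join[OF Sj(2) cS[OF i j]]
    note J' = subset_join[OF Si(1) J(1)]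
    have "w \<in> fst i \<squnion>\<^bsub>L\<^esub> (snd j \<squnion>\<^bsub>L\<^esub> c i j)" if w: "w \<in> W" for w
    proof -
      note sub = subgroup[OF J'(1)]
      have "z i w \<in> fst i \<squnion>\<^bsub>L\<^esub> (snd j \<squnion>\<^bsub>L\<^esub> c i j)"
        "inv (z i w) \<otimes> z j w \<in> fst i \<squnion>\<^bsub>L\<^esub> (snd j \<squnion>\<^bsub>L\<^esub> c i j)"
        "inv (z j w) \<otimes> w \<in> fst i \<squnion>\<^bsub>L\<^esub> (snd j \<squnion>\<^bsub>L\<^esub> c i j)"
        using zz[OF w] c_mem[OF w, of i j] J J' by blast+
      then have "z i w \<otimes> ((inv (z i w) \<otimes> z j w) \<otimes> (inv (z j w) \<otimes> w)) \<in> fst i \<squnion>\<^bsub>L\<^esub> (snd j \<squnion>\<^bsub>L\<^esub> c i j)"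
        using subgroup.m_closed[OF sub] by blast
      moreover have "z i w \<otimes> ((inv (z i w) \<otimes> z j w) \<otimes> (inv (z j w) \<otimes> w)) = w"
        using zz(5,6,7)[OF w] by (simp add: m_assoc mult_inv_mult_cancel)
      ultimately show ?thesis by simp
    qed
    then show "e \<subseteq> fst i \<squnion>\<^bsub>L\<^esub> (snd j \<squnion>\<^bsub>L\<^esub> c i j)"
      unfolding eW using J'(1) by (intro hull_minimal) auto
    fix k assume k: "k \<in> covers L e"
    note J = subset_join[OF cS[OF i j] cS[OF j k]]
    have "inv (z i w) \<otimes> z k w \<in> c i j \<squnion>\<^bsub>L\<^esub> c j k" if w: "w \<in> W" for w
    proof -
      note sub = subgroup[OF J(1)]
      have "(inv (z i w) \<otimes> z j w) \<otimes> (inv (z j w) \<otimes> z k w) \<in> c i j \<squnion>\<^bsub>L\<^esub> c j k"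
        using c_mem[OF w, of i j] c_mem[OF w, of j k] J subgroup.m_closed[OF sub] by blast
      moreover have "(inv (z i w) \<otimes> z j w) \<otimes> (inv (z j w) \<otimes> z k w) = inv (z i w) \<otimes> z k w"
        using zz(5,6)[OF w] zG[OF k w] by (simp add: m_assoc mult_inv_mult_cancel)
      ultimately show ?thesis by simp
    qed
    then show "c i k \<subseteq> c i j \<squnion>\<^bsub>L\<^esub> c j k"
      unfolding c_def[of i k] X_def using J(1) by (intro hull_minimal) auto
  qed
qed

end

section \<open>Submodules, normal subgroups and l-ideals\<close>

lemma (in group) directed_Union_subgroup:
  assumes sub: "\<And>A. A \<in> \<A> \<Longrightarrow> subgroup A G" and ne: "\<A> \<noteq> {}"
    and dir: "\<And>A B. A \<in> \<A> \<Longrightarrow> B \<in> \<A> \<Longrightarrow> \<exists>C\<in>\<A>. A \<union> B \<subseteq> C"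
  shows "subgroup (\<Union>\<A>) G"
proof (rule subgroupI)
  show "\<Union>\<A> \<subseteq> carrier G" using sub subgroup.subset by blast
  obtain A where "A \<in> \<A>" using ne by blast
  then have "\<one> \<in> \<Union>\<A>" using subgroup.one_closed[OF sub[OF \<open>A \<in> \<A>\<close>]] by (rule UnionI)
  then show "\<Union>\<A> \<noteq> {}" by auto
  show "inv x \<in> \<Union>\<A>" if "x \<in> \<Union>\<A>" for x
    using that subgroup.m_inv_closed[OF sub] by auto
  fix x y assume "x \<in> \<Union>\<A>" "y \<in> \<Union>\<A>"
  then obtain C where "C \<in> \<A>" "x \<in> C" "y \<in> C" using dir by blast
  then show "x \<otimes> y \<in> \<Union>\<A>" using subgroup.m_closed[OF sub] by blast
qed

lemma (in group) directed_Union_normal: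
  assumes nor: "\<And>A. A \<in> \<A> \<Longrightarrow> A \<lhd> G" and "\<A> \<noteq> {}"
    and "\<And>A B. A \<in> \<A> \<Longrightarrow> B \<in> \<A> \<Longrightarrow> \<exists>C\<in>\<A>. A \<union> B \<subseteq> C"
  shows "\<Union>\<A> \<lhd> G"
proof -
  have "subgroup (\<Union>\<A>) G"
    using assms by (intro directed_Union_subgroup) (auto dest: normal_imp_subgroup)
  then show ?thesis using nor by (auto simp: normal_inv_iff)
qed

lemma weak_uniform_refinement_NSub:
  assumes "group G"
  shows "weak_uniform_refinement (NSub G)"
proof -
  interpret group G by fact
  interpret permuting_normal_subgroups G "{N. N \<lhd> G}"
  proof (intro permuting_normal_subgroups.intro permuting_normal_subgroups_axioms.intro
      algebraic_closure_system.intro)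
    show "carrier G \<in> {N. N \<lhd> G}" by (simp add: normal_carrier)
    show "A \<in> {N. N \<lhd> G} \<Longrightarrow> A \<subseteq> carrier G" for A
      by (auto dest: normal_imp_subgroup subgroup.subset)
    show "\<lbrakk>\<A> \<subseteq> {N. N \<lhd> G}; \<A> \<noteq> {}\<rbrakk> \<Longrightarrow> \<Inter>\<A> \<in> {N. N \<lhd> G}" for \<A>
      using normal_Inter by simp
    show "\<Union>\<A> \<in> {N. N \<lhd> G}" if "\<A> \<subseteq> {N. N \<lhd> G}" "\<A> \<noteq> {}"
      "\<And>A B. A \<in> \<A> \<Longrightarrow> B \<in> \<A> \<Longrightarrow> \<exists>C\<in>\<A>. A \<union> B \<subseteq> C" for \<A>
      using that directed_Union_normal[of \<A>] by blast
  qed (simp_all add: normal_subgroup_set_mult_closed is_group)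
  show ?thesis unfolding NSub_def by (rule weak_uniform_refinement)
qed

lemma weak_uniform_refinement_Sub:
  assumes "left_module R M"
  shows "weak_uniform_refinement (Sub R M)"
proof -
  interpret left_module R M by fact
  interpret add: comm_group "add_monoid M" by (rule M.a_comm_group)
  have submod: "submodule N R M \<longleftrightarrow>
      subgroup N (add_monoid M) \<and> (\<forall>a\<in>carrier R. \<forall>x\<in>N. a \<odot>\<^bsub>M\<^esub> x \<in> N)" for N
    unfolding submodule_def submodule_axioms_def by blast
  have nor: "N \<lhd> add_monoid M" if "submodule N R M" for N
    using that add.subgroup_imp_normal submod by blast
  interpret permuting_normal_subgroups "add_monoid M" "{N. submodule N R M}"
  proof (intro permuting_normal_subgroups.intro permuting_normal_subgroups_axioms.intro
      algebraic_closure_system.intro)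
    show "carrier (add_monoid M) \<in> {N. submodule N R M}"
      using add.subgroup_self smult_closed by (auto simp: submod)
    show "A \<in> {N. submodule N R M} \<Longrightarrow> A \<subseteq> carrier (add_monoid M)" for A
      using subgroup.subset[of A "add_monoid M"] by (simp add: submod)
    show "\<Inter>\<A> \<in> {N. submodule N R M}" if "\<A> \<subseteq> {N. submodule N R M}" "\<A> \<noteq> {}" for \<A>
      using that add.subgroups_Inter[of \<A>] by (auto simp: submod subset_iff)
    show "\<Union>\<A> \<in> {N. submodule N R M}" if "\<A> \<subseteq> {N. submodule N R M}" "\<A> \<noteq> {}"
      "\<And>A B. A \<in> \<A> \<Longrightarrow> B \<in> \<A> \<Longrightarrow> \<exists>C\<in>\<A>. A \<union> B \<subseteq> C" for \<A>
    proof -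
      have "subgroup (\<Union>\<A>) (add_monoid M)"
        using that by (intro add.directed_Union_subgroup) (auto simp: submod)
      then show ?thesis using that(1) by (auto simp: submod)
    qed
    show "N \<in> {N. submodule N R M} \<Longrightarrow> N \<lhd> add_monoid M" for N using nor by simp
    show "group (add_monoid M)" by (rule add.is_group)
    show "A <#>\<^bsub>add_monoid M\<^esub> B \<in> {N. submodule N R M}"
      if A: "A \<in> {N. submodule N R M}" and B: "B \<in> {N. submodule N R M}" for A B
    proof -
      have "subgroup (A <#>\<^bsub>add_monoid M\<^esub> B) (add_monoid M)"
        using A B nor add.normal_subgroup_set_mult_closed normal_imp_subgroup by blast
      moreover have "r \<odot>\<^bsub>M\<^esub> x \<in> A <#>\<^bsub>add_monoid M\<^esub> B"
        if r: "r \<in> carrier R" and x: "x \<in> A <#>\<^bsub>add_monoid M\<^esub> B" for r x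
      proof -
        obtain a b where ab: "a \<in> A" "b \<in> B" "x = a \<oplus>\<^bsub>M\<^esub> b"
          using x unfolding set_mult_def by auto
        then have "a \<in> carrier M" "b \<in> carrier M"
          using A B subgroup.subset[of _ "add_monoid M"] by (auto simp: submod)
        then have "r \<odot>\<^bsub>M\<^esub> x = r \<odot>\<^bsub>M\<^esub> a \<oplus>\<^bsub>M\<^esub> r \<odot>\<^bsub>M\<^esub> b"
          using smult_r_distr[OF r] ab(3) by simp
        moreover have "r \<odot>\<^bsub>M\<^esub> a \<in> A" "r \<odot>\<^bsub>M\<^esub> b \<in> B"
          using A B r ab by (auto simp: submod)
        ultimately show ?thesis unfolding set_mult_def by auto
      qed
      ultimately show ?thesis by (simp add: submod)
    qed
  qed
  show ?thesis unfolding Sub_def by (rule weak_uniform_refinement)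
qed

context lattice_ordered_group
begin

abbreviation join_lg (infixl \<open>\<or>\<or>\<close> 65) where "x \<or>\<or> y \<equiv> x \<squnion>\<^bsub>lg_order G\<^esub> y"
abbreviation meet_lg (infixl \<open>\<and>\<and>\<close> 70) where "x \<and>\<and> y \<equiv> x \<sqinter>\<^bsub>lg_order G\<^esub> y"
abbreviation le_lg (infix \<open>\<preceq>\<close> 50) where "x \<preceq> y \<equiv> lle G x y"

lemma carrier_lg_order [simp]: "carrier (lg_order G) = carrier G"
  and le_lg_order [simp]: "le (lg_order G) = lle G"
  by (simp_all add: lg_order_def)

lemma lle_refl: "x \<in> carrier G \<Longrightarrow> x \<preceq> x"
  using lg.le_refl[of x] by simp

lemma lle_trans: "\<lbrakk>x \<preceq> y; y \<preceq> z; x \<in> carrier G; y \<in> carrier G; z \<in> carrier G\<rbrakk> \<Longrightarrow> x \<preceq> z"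
  using lg.le_trans[of x y z] by simp

lemma lle_antisym: "\<lbrakk>x \<preceq> y; y \<preceq> x; x \<in> carrier G; y \<in> carrier G\<rbrakk> \<Longrightarrow> x = y"
  using lg.le_antisym[of x y] by simp

lemma join_meet_closed:
  "\<lbrakk>x \<in> carrier G; y \<in> carrier G\<rbrakk> \<Longrightarrow> x \<or>\<or> y \<in> carrier G"
  "\<lbrakk>x \<in> carrier G; y \<in> carrier G\<rbrakk> \<Longrightarrow> x \<and>\<and> y \<in> carrier G"
  using lg.weak.join_closed[of x y] lg.weak.meet_closed[of x y] by simp_all

lemma join_meet_bounds:
  assumes "x \<in> carrier G" "y \<in> carrier G"
  shows "x \<preceq> x \<or>\<or> y" "y \<preceq> x \<or>\<or> y" "x \<and>\<and> y \<preceq> x" "x \<and>\<and> y \<preceq> y"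
  using lg.weak.join_left[of x y] lg.weak.join_right[of x y] lg.weak.meet_left[of x y]
    lg.weak.meet_right[of x y] assms by simp_all

lemma join_lle: "\<lbrakk>x \<preceq> z; y \<preceq> z; x \<in> carrier G; y \<in> carrier G; z \<in> carrier G\<rbrakk> \<Longrightarrow> x \<or>\<or> y \<preceq> z"
  using lg.weak.join_le[of x z y] by simp

lemma lle_meet: "\<lbrakk>z \<preceq> x; z \<preceq> y; x \<in> carrier G; y \<in> carrier G; z \<in> carrier G\<rbrakk> \<Longrightarrow> z \<preceq> x \<and>\<and> y"
  using lg.weak.meet_le[of z x y] by simp

lemma lle_mult_inv_iff:
  assumes "x \<in> carrier G" "y \<in> carrier G" "u \<in> carrier G"
  shows "x \<otimes> u \<preceq> y \<longleftrightarrow> x \<preceq> y \<otimes> inv u"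
proof
  assume "x \<otimes> u \<preceq> y"
  then have "(x \<otimes> u) \<otimes> inv u \<preceq> y \<otimes> inv u" using assms by (intro mult_right_mono) auto
  then show "x \<preceq> y \<otimes> inv u" using assms by (simp add: m_assoc)
next
  assume "x \<preceq> y \<otimes> inv u"
  then have "x \<otimes> u \<preceq> (y \<otimes> inv u) \<otimes> u" using assms by (intro mult_right_mono) auto
  then show "x \<otimes> u \<preceq> y" using assms by (simp add: m_assoc)
qed

lemma lle_inv_mult_iff:
  assumes "x \<in> carrier G" "y \<in> carrier G" "u \<in> carrier G"
  shows "u \<otimes> x \<preceq> y \<longleftrightarrow> x \<preceq> inv u \<otimes> y" "y \<preceq> u \<otimes> x \<longleftrightarrow> inv u \<otimes> y \<preceq> x"
proof -
  have *: "x \<preceq> inv u \<otimes> y" if "u \<otimes> x \<preceq> y" "x \<in> carrier G" "y \<in> carrier G" "u \<in> carrier G" for x y u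
    using mult_left_mono[of "u \<otimes> x" y "inv u"] that by (simp add: m_assoc[symmetric])
  have **: "inv u \<otimes> y \<preceq> x" if "y \<preceq> u \<otimes> x" "x \<in> carrier G" "y \<in> carrier G" "u \<in> carrier G" for x y u
    using mult_left_mono[of y "u \<otimes> x" "inv u"] that by (simp add: m_assoc[symmetric])
  show "u \<otimes> x \<preceq> y \<longleftrightarrow> x \<preceq> inv u \<otimes> y"
    using *[of u x y] **[of x "inv u" y] assms by auto
  show "y \<preceq> u \<otimes> x \<longleftrightarrow> inv u \<otimes> y \<preceq> x"
    using **[of y u x] *[of "inv u" y x] assms by auto
qed

lemma l_idealD:
  assumes "l_ideal N G"
  shows "N \<lhd> G" "subgroup N G" "N \<subseteq> carrier G"
    "\<lbrakk>x \<in> N; y \<in> N\<rbrakk> \<Longrightarrow> x \<or>\<or> y \<in> N" "\<lbrakk>x \<in> N; y \<in> N\<rbrakk> \<Longrightarrow> x \<and>\<and> y \<in> N"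
    "\<lbrakk>x \<in> N; y \<in> N; z \<in> carrier G; x \<preceq> z; z \<preceq> y\<rbrakk> \<Longrightarrow> z \<in> N"
  using assms normal_imp_subgroup[of N] subgroup.subset[of N G] unfolding l_ideal_def by blast+

text \<open>Congruence modulo an l-ideal is compatible with the lattice operations. Bounding the quotient
\<open>a\<close> of \<open>x\<close> and \<open>x'\<close> by \<open>v = a \<and> 1\<close> and \<open>u = a \<or> 1\<close>, which lie in \<open>N\<close>, gives
\<open>xv \<le> x' \<le> xu\<close>. As \<open>v \<le> 1 \<le> u\<close>, such bounds survive joins and meets with \<open>z\<close>, and convexity
puts the new quotient into \<open>N\<close>.\<close>

lemma l_ideal_cong:
  assumes N: "l_ideal N G" and G: "x \<in> carrier G" "x' \<in> carrier G" "z \<in> carrier G"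
    and a: "inv x \<otimes> x' \<in> N"
  shows "inv (x \<or>\<or> z) \<otimes> (x' \<or>\<or> z) \<in> N" "inv (x \<and>\<and> z) \<otimes> (x' \<and>\<and> z) \<in> N"
proof -
  note ND = l_idealD[OF N]
  define a where "a = inv x \<otimes> x'"
  define u where "u = a \<or>\<or> \<one>"
  define v where "v = a \<and>\<and> \<one>"
  have aG: "a \<in> carrier G" using G a_def by simp
  have "\<one> \<in> N" by (rule subgroup.one_closed[OF ND(2)])
  then have uv: "u \<in> N" "v \<in> N" unfolding u_def v_def using ND(4,5) a a_def by auto
  then have uvG: "u \<in> carrier G" "v \<in> carrier G" using ND(3) by auto
  have x': "x' = x \<otimes> a" unfolding a_def using G by (simp add: m_assoc[symmetric])
  have b: "v \<preceq> a" "v \<preceq> \<one>" "a \<preceq> u" "\<one> \<preceq> u"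
    unfolding u_def v_def using aG join_meet_bounds by auto
  have xv: "x \<otimes> v \<preceq> x'" and xu: "x' \<preceq> x \<otimes> u" and zv: "z \<otimes> v \<preceq> z" and zu: "z \<preceq> z \<otimes> u"
    using mult_left_mono[OF uvG(2) aG G(1) b(1)] mult_left_mono[OF aG uvG(1) G(1) b(3)]
      mult_left_mono[OF uvG(2) one_closed G(3) b(2)] mult_left_mono[OF one_closed uvG(1) G(3) b(4)]
      x' G by simp_all
  have conv: "inv y \<otimes> y' \<in> N" if "y \<otimes> v \<preceq> y'" "y' \<preceq> y \<otimes> u" "y \<in> carrier G" "y' \<in> carrier G" for y y'
    using ND(6)[OF uv(2,1), of "inv y \<otimes> y'"] lle_inv_mult_iff(1)[OF uvG(2) that(4,3)]
      lle_inv_mult_iff(2)[OF uvG(1) that(4,3)] that by blast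
  note cl = join_meet_closed[OF G(1,3)] join_meet_closed[OF G(2,3)]
  note bd = join_meet_bounds[OF G(1,3)] join_meet_bounds[OF G(2,3)]
  show "inv (x \<or>\<or> z) \<otimes> (x' \<or>\<or> z) \<in> N"
  proof (rule conv[OF _ _ cl(1,3)])
    have "x \<otimes> v \<preceq> x' \<or>\<or> z" "z \<otimes> v \<preceq> x' \<or>\<or> z"
      using lle_trans[OF xv bd(5)] lle_trans[OF zv bd(6)] G uvG cl by auto
    then have "x \<or>\<or> z \<preceq> (x' \<or>\<or> z) \<otimes> inv v"
      using lle_mult_inv_iff G uvG cl by (intro join_lle) auto
    then show "(x \<or>\<or> z) \<otimes> v \<preceq> x' \<or>\<or> z" using lle_mult_inv_iff uvG cl by simp
    have "x \<otimes> u \<preceq> (x \<or>\<or> z) \<otimes> u" "z \<otimes> u \<preceq> (x \<or>\<or> z) \<otimes> u"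
      using bd uvG cl G by (auto intro!: mult_right_mono)
    then show "x' \<or>\<or> z \<preceq> (x \<or>\<or> z) \<otimes> u"
      using lle_trans[OF xu] lle_trans[OF zu] G uvG cl by (intro join_lle) auto
  qed
  show "inv (x \<and>\<and> z) \<otimes> (x' \<and>\<and> z) \<in> N"
  proof (rule conv[OF _ _ cl(2,4)])
    have "(x \<and>\<and> z) \<otimes> v \<preceq> x \<otimes> v" "(x \<and>\<and> z) \<otimes> v \<preceq> z \<otimes> v"
      using bd uvG cl G by (auto intro!: mult_right_mono)
    then show "(x \<and>\<and> z) \<otimes> v \<preceq> x' \<and>\<and> z"
      using lle_trans[OF _ xv] lle_trans[OF _ zv] G uvG cl by (intro lle_meet) auto
    have "x' \<and>\<and> z \<preceq> x \<otimes> u" "x' \<and>\<and> z \<preceq> z \<otimes> u"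
      using lle_trans[OF bd(7) xu] lle_trans[OF bd(8) zu] G uvG cl by auto
    then have "(x' \<and>\<and> z) \<otimes> inv u \<preceq> x \<and>\<and> z"
      using lle_mult_inv_iff[of "x' \<and>\<and> z" _ "inv u"] G uvG cl by (intro lle_meet) auto
    then show "x' \<and>\<and> z \<preceq> (x \<and>\<and> z) \<otimes> u"
      using lle_mult_inv_iff[of "x' \<and>\<and> z" _ "inv u"] uvG cl by simp
  qed
qed

text \<open>Membership in the product means congruence modulo \<open>A\<close> to an element of \<open>B\<close>. In this form
compatibility with the lattice operations can be applied.\<close>

lemma mem_set_mult_iff:
  assumes A: "A \<lhd> G" and B: "subgroup B G" 
  shows "g \<in> A <#> B \<longleftrightarrow> g \<in> carrier G \<and> (\<exists>b\<in>B. inv b \<otimes> g \<in> A)"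
proof
  interpret A: normal A G by fact
  interpret B: subgroup B G by fact
  assume "g \<in> A <#> B"
  then obtain a b where ab: "a \<in> A" "b \<in> B" "g = a \<otimes> b" unfolding set_mult_def by blast
  then have "inv b \<otimes> a \<otimes> b \<in> A" using A.inv_op_closed1 by simp
  then show "g \<in> carrier G \<and> (\<exists>b\<in>B. inv b \<otimes> g \<in> A)"
    using ab by (auto simp: m_assoc intro!: bexI[of _ b])
next
  interpret A: normal A G by fact
  interpret B: subgroup B G by fact
  assume "g \<in> carrier G \<and> (\<exists>b\<in>B. inv b \<otimes> g \<in> A)"
  then obtain b where b: "g \<in> carrier G" "b \<in> B" "inv b \<otimes> g \<in> A" by blast
  then have bG: "b \<in> carrier G" by simp
  have "b \<otimes> (inv b \<otimes> g) \<otimes> inv b \<in> A" using A.inv_op_closed2[OF bG b(3)] .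
  moreover have "b \<otimes> (inv b \<otimes> g) = g" using b(1) bG by (simp add: m_assoc[symmetric])
  ultimately have "g \<otimes> inv b \<in> A" by simp
  then have "g \<otimes> inv b \<otimes> b \<in> A <#> B" using b(2) unfolding set_mult_def by blast
  moreover have "g \<otimes> inv b \<otimes> b = g" using b(1) bG by (simp add: m_assoc)
  ultimately show "g \<in> A <#> B" by simp
qed

text \<open>The product is closed under the lattice operations because congruence modulo \<open>A\<close> is
compatible with them. For convexity, let \<open>x \<le> z \<le> y\<close> with \<open>x\<close>, \<open>y\<close> congruent to \<open>a\<close>, \<open>b \<in> B\<close>
modulo \<open>A\<close>. Then \<open>z = (z \<or> x) \<and> y\<close> is congruent to \<open>(z \<or> a) \<and> b\<close>, which lies between
\<open>a \<and> b\<close> and \<open>b\<close> and hence in \<open>B\<close>.\<close>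

lemma l_ideal_set_mult:
  assumes A: "l_ideal A G" and B: "l_ideal B G"
  shows "l_ideal (A <#> B) G"
proof -
  note AD = l_idealD[OF A] and BD = l_idealD[OF B]
  note mem = mem_set_mult_iff[OF AD(1) BD(2)]
  have trans: "inv x \<otimes> z \<in> A" if "inv x \<otimes> y \<in> A" "inv y \<otimes> z \<in> A" "x \<in> carrier G" "y \<in> carrier G" "z \<in> carrier G" for x y z
  proof -
    have "(inv x \<otimes> y) \<otimes> (inv y \<otimes> z) \<in> A" using subgroup.m_closed[OF AD(2)] that by blast
    moreover have "(inv x \<otimes> y) \<otimes> (inv y \<otimes> z) = inv x \<otimes> (y \<otimes> inv y \<otimes> z)"
      using that by (simp only: m_assoc inv_closed m_closed)
    ultimately show ?thesis using that by simp
  qed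
  have join: "inv (x \<or>\<or> y) \<otimes> (x' \<or>\<or> y') \<in> A" and meet: "inv (x \<and>\<and> y) \<otimes> (x' \<and>\<and> y') \<in> A"
    if "inv x \<otimes> x' \<in> A" "inv y \<otimes> y' \<in> A" "x \<in> carrier G" "y \<in> carrier G" "x' \<in> carrier G" "y' \<in> carrier G"
    for x y x' y'
  proof -
    note cong = l_ideal_cong[OF A that(3,5,4,1)] l_ideal_cong[OF A that(4,6,5,2)]
    note cong' = cong(1,2) cong(3)[unfolded join_comm[of "lg_order G" _ x']]
      cong(4)[unfolded meet_comm[of "lg_order G" _ x']]
    show "inv (x \<or>\<or> y) \<otimes> (x' \<or>\<or> y') \<in> A"
      by (rule trans[OF cong'(1,3)]) (use that join_meet_closed in auto)
    show "inv (x \<and>\<and> y) \<otimes> (x' \<and>\<and> y') \<in> A"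
      by (rule trans[OF cong'(2,4)]) (use that join_meet_closed in auto)
  qed
  have refl: "inv x \<otimes> x \<in> A" if "x \<in> carrier G" for x
    using that subgroup.one_closed[OF AD(2)] by simp
  show ?thesis
    unfolding l_ideal_def
  proof (intro conjI ballI impI)
    show "A <#> B \<lhd> G" using AD(1) BD(1) by (rule normal_subgroup_set_mult_closed)
    fix x y assume xy: "x \<in> A <#> B" "y \<in> A <#> B"
    obtain a b where ab: "a \<in> B" "b \<in> B" "inv a \<otimes> x \<in> A" "inv b \<otimes> y \<in> A"
      and G: "x \<in> carrier G" "y \<in> carrier G"
      using xy mem by blast
    have abG: "a \<in> carrier G" "b \<in> carrier G" using ab BD(3) by auto
    show "x \<or>\<or> y \<in> A <#> B" "x \<and>\<and> y \<in> A <#> B"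
      unfolding mem using join[OF ab(3,4) abG G] meet[OF ab(3,4) abG G] BD(4,5)[OF ab(1,2)]
        join_meet_closed[OF G] by blast+
    fix z assume z: "z \<in> carrier G" and le: "x \<preceq> z \<and> z \<preceq> y"
    define w where "w = (z \<or>\<or> a) \<and>\<and> b"
    have "z = (z \<or>\<or> x) \<and>\<and> y"
    proof -
      have "z \<or>\<or> x = z" using le z G join_meet_bounds[of z x] join_meet_closed[of z x] lle_refl
        by (intro lle_antisym join_lle) auto
      moreover have "z \<and>\<and> y = z" using le z G join_meet_bounds[of z y] join_meet_closed[of z y] lle_refl
        by (intro lle_antisym lle_meet) auto
      ultimately show ?thesis by simp
    qed
    then have "inv w \<otimes> z \<in> A"
      using meet[OF join[OF refl[OF z] ab(3)] ab(4)] z G abG join_meet_closed unfolding w_def by metis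
    moreover have "w \<in> B"
    proof (rule BD(6)[OF _ ab(2)])
      show "a \<and>\<and> b \<in> B" using BD(5) ab by blast
      show "w \<in> carrier G" "w \<preceq> b"
        unfolding w_def using z abG join_meet_closed join_meet_bounds by auto
      have "a \<and>\<and> b \<preceq> z \<or>\<or> a"
        using z abG join_meet_closed join_meet_bounds lle_trans[of "a \<and>\<and> b" a "z \<or>\<or> a"] by auto
      then show "a \<and>\<and> b \<preceq> w"
        unfolding w_def using z abG join_meet_closed join_meet_bounds by (intro lle_meet) auto
    qed
    ultimately show "z \<in> A <#> B" unfolding mem using z by blast
  qed
qed

end

lemma weak_uniform_refinement_l_Id:
  assumes "lattice_ordered_group G"
  shows "weak_uniform_refinement (l_Id G)"
proof -
  interpret lattice_ordered_group G by fact
  interpret permuting_normal_subgroups G "{N. l_ideal N G}"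
  proof (intro permuting_normal_subgroups.intro permuting_normal_subgroups_axioms.intro
      algebraic_closure_system.intro)
    show "carrier G \<in> {N. l_ideal N G}"
      by (simp add: l_ideal_def normal_carrier join_meet_closed)
    show "A \<in> {N. l_ideal N G} \<Longrightarrow> A \<subseteq> carrier G" for A
      using l_idealD(3) by blast
    show "\<Inter>\<A> \<in> {N. l_ideal N G}" if \<A>: "\<A> \<subseteq> {N. l_ideal N G}" "\<A> \<noteq> {}" for \<A>
    proof -
      have "\<Inter>\<A> \<lhd> G" using \<A> by (intro normal_Inter) (auto simp: l_ideal_def)
      then show ?thesis using \<A>(1) unfolding l_ideal_def by blast
    qed
    show "\<Union>\<A> \<in> {N. l_ideal N G}" if \<A>: "\<A> \<subseteq> {N. l_ideal N G}" "\<A> \<noteq> {}"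
      and dir: "\<And>A B. A \<in> \<A> \<Longrightarrow> B \<in> \<A> \<Longrightarrow> \<exists>C\<in>\<A>. A \<union> B \<subseteq> C" for \<A>
    proof -
      have "\<Union>\<A> \<lhd> G" using \<A> dir by (intro directed_Union_normal) (auto simp: l_ideal_def)
      moreover have common: "\<exists>C. C \<subseteq> \<Union>\<A> \<and> l_ideal C G \<and> x \<in> C \<and> y \<in> C"
        if xy: "x \<in> \<Union>\<A>" "y \<in> \<Union>\<A>" for x y
      proof -
        obtain A B where "A \<in> \<A>" "B \<in> \<A>" "x \<in> A" "y \<in> B" using xy by blast
        then obtain C where "C \<in> \<A>" "A \<union> B \<subseteq> C" using dir by meson
        then show ?thesis using \<A>(1) \<open>x \<in> A\<close> \<open>y \<in> B\<close> by (intro exI[of _ C]) auto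
      qed
      moreover have "x \<or>\<or> y \<in> \<Union>\<A> \<and> x \<and>\<and> y \<in> \<Union>\<A>
          \<and> (\<forall>z\<in>carrier G. x \<preceq> z \<and> z \<preceq> y \<longrightarrow> z \<in> \<Union>\<A>)"
        if xy: "x \<in> \<Union>\<A>" "y \<in> \<Union>\<A>" for x y
      proof -
        obtain C where C: "C \<subseteq> \<Union>\<A>" "l_ideal C G" "x \<in> C" "y \<in> C" using common[OF xy] by blast
        then show ?thesis
          using l_idealD(4,5)[OF C(2-4)] l_idealD(6)[OF C(2-4)] by blast
      qed
      ultimately show ?thesis unfolding l_ideal_def mem_Collect_eq by blast
    qed
  qed (auto dest: l_idealD(1) l_ideal_set_mult simp: is_group)
  show ?thesis unfolding l_Id_def by (rule weak_uniform_refinement)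
qed

section \<open>Congruences of lattices\<close>

lemma lattice_congruenceI:
  assumes "\<theta> \<subseteq> carrier L \<times> carrier L" "\<And>x. x \<in> carrier L \<Longrightarrow> (x, x) \<in> \<theta>"
    and "\<And>x y. (x, y) \<in> \<theta> \<Longrightarrow> (y, x) \<in> \<theta>"
    and "\<And>x y z. \<lbrakk>(x, y) \<in> \<theta>; (y, z) \<in> \<theta>\<rbrakk> \<Longrightarrow> (x, z) \<in> \<theta>"
    and "\<And>x x' y y'. \<lbrakk>(x, x') \<in> \<theta>; (y, y') \<in> \<theta>\<rbrakk> \<Longrightarrow> (x \<squnion>\<^bsub>L\<^esub> y, x' \<squnion>\<^bsub>L\<^esub> y') \<in> \<theta>"
    and "\<And>x x' y y'. \<lbrakk>(x, x') \<in> \<theta>; (y, y') \<in> \<theta>\<rbrakk> \<Longrightarrow> (x \<sqinter>\<^bsub>L\<^esub> y, x' \<sqinter>\<^bsub>L\<^esub> y') \<in> \<theta>"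
  shows "lattice_congruence L \<theta>"
  unfolding lattice_congruence_def
proof
  show "equiv (carrier L) \<theta>"
    using assms(1-4) by (intro equivI refl_onI symI transI) blast+
  show "\<forall>(x, x')\<in>\<theta>. \<forall>(y, y')\<in>\<theta>. (x \<squnion>\<^bsub>L\<^esub> y, x' \<squnion>\<^bsub>L\<^esub> y') \<in> \<theta> \<and> (x \<sqinter>\<^bsub>L\<^esub> y, x' \<sqinter>\<^bsub>L\<^esub> y') \<in> \<theta>"
    using assms(5,6) by blast
qed

lemma lattice_congruenceD:
  assumes "lattice_congruence L \<theta>"
  shows "\<theta> \<subseteq> carrier L \<times> carrier L" "x \<in> carrier L \<Longrightarrow> (x, x) \<in> \<theta>"
    "(x, y) \<in> \<theta> \<Longrightarrow> (y, x) \<in> \<theta>" "\<lbrakk>(x, y) \<in> \<theta>; (y, z) \<in> \<theta>\<rbrakk> \<Longrightarrow> (x, z) \<in> \<theta>"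
    "\<lbrakk>(x, x') \<in> \<theta>; (y, y') \<in> \<theta>\<rbrakk> \<Longrightarrow> (x \<squnion>\<^bsub>L\<^esub> y, x' \<squnion>\<^bsub>L\<^esub> y') \<in> \<theta>"
    "\<lbrakk>(x, x') \<in> \<theta>; (y, y') \<in> \<theta>\<rbrakk> \<Longrightarrow> (x \<sqinter>\<^bsub>L\<^esub> y, x' \<sqinter>\<^bsub>L\<^esub> y') \<in> \<theta>"
proof -
  have "equiv (carrier L) \<theta>" using assms by (simp add: lattice_congruence_def)
  then show "\<theta> \<subseteq> carrier L \<times> carrier L" "x \<in> carrier L \<Longrightarrow> (x, x) \<in> \<theta>"
    "(x, y) \<in> \<theta> \<Longrightarrow> (y, x) \<in> \<theta>" "\<lbrakk>(x, y) \<in> \<theta>; (y, z) \<in> \<theta>\<rbrakk> \<Longrightarrow> (x, z) \<in> \<theta>"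
    by (auto elim!: equivE dest: refl_onD symD transD)
  show "\<lbrakk>(x, x') \<in> \<theta>; (y, y') \<in> \<theta>\<rbrakk> \<Longrightarrow> (x \<squnion>\<^bsub>L\<^esub> y, x' \<squnion>\<^bsub>L\<^esub> y') \<in> \<theta>"
    "\<lbrakk>(x, x') \<in> \<theta>; (y, y') \<in> \<theta>\<rbrakk> \<Longrightarrow> (x \<sqinter>\<^bsub>L\<^esub> y, x' \<sqinter>\<^bsub>L\<^esub> y') \<in> \<theta>"
    using assms by (auto simp: lattice_congruence_def)
qed

lemma lattice_congruence_kernel:
  assumes h: "h \<in> lattice_hom L K"
  shows "lattice_congruence L {(x, y) \<in> carrier L \<times> carrier L. h x = h y}"
proof -
  note hD = lattice_homD[OF h]
  interpret L: lattice L by (rule hD)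
  show ?thesis by (rule lattice_congruenceI) (auto simp: hD(4,5))
qed

lemma closure_system_Con:
  fixes L (structure)
  assumes "lattice L"
  shows "algebraic_closure_system {\<theta>. lattice_congruence L \<theta>} (carrier L \<times> carrier L)"
proof -
  interpret lattice L by fact
  show ?thesis
  proof
    show "carrier L \<times> carrier L \<in> {\<theta>. lattice_congruence L \<theta>}"
      by (auto intro: lattice_congruenceI)
    show "A \<in> {\<theta>. lattice_congruence L \<theta>} \<Longrightarrow> A \<subseteq> carrier L \<times> carrier L" for A
      using lattice_congruenceD(1)[of L A] by simp
    show "\<Inter>\<A> \<in> {\<theta>. lattice_congruence L \<theta>}"
      if \<A>: "\<A> \<subseteq> {\<theta>. lattice_congruence L \<theta>}" "\<A> \<noteq> {}" for \<A>
    proof -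
      have D: "lattice_congruence L A" if "A \<in> \<A>" for A using that \<A>(1) by blast
      have "lattice_congruence L (\<Inter>\<A>)"
      proof (rule lattice_congruenceI)
        show "\<Inter>\<A> \<subseteq> carrier L \<times> carrier L" using \<A>(2) lattice_congruenceD(1)[OF D] by blast
        show "(x, x) \<in> \<Inter>\<A>" if "x \<in> carrier L" for x using that lattice_congruenceD(2)[OF D] by blast
        show "(y, x) \<in> \<Inter>\<A>" if "(x, y) \<in> \<Inter>\<A>" for x y using that lattice_congruenceD(3)[OF D] by blast
        show "(x, z) \<in> \<Inter>\<A>" if "(x, y) \<in> \<Inter>\<A>" "(y, z) \<in> \<Inter>\<A>" for x y z
          using that lattice_congruenceD(4)[OF D] by blast
        show "(x \<squnion> y, x' \<squnion> y') \<in> \<Inter>\<A>" "(x \<sqinter> y, x' \<sqinter> y') \<in> \<Inter>\<A>"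
          if "(x, x') \<in> \<Inter>\<A>" "(y, y') \<in> \<Inter>\<A>" for x x' y y'
          using that lattice_congruenceD(5)[OF D] lattice_congruenceD(6)[OF D] by blast+
      qed
      then show ?thesis by simp
    qed
    show "\<Union>\<A> \<in> {\<theta>. lattice_congruence L \<theta>}"
      if \<A>: "\<A> \<subseteq> {\<theta>. lattice_congruence L \<theta>}" "\<A> \<noteq> {}"
        and dir: "\<And>A B. A \<in> \<A> \<Longrightarrow> B \<in> \<A> \<Longrightarrow> \<exists>C\<in>\<A>. A \<union> B \<subseteq> C" for \<A>
    proof -
      have D: "lattice_congruence L A" if "A \<in> \<A>" for A using that \<A>(1) by blast
      have common: "\<exists>C\<in>\<A>. p \<in> C \<and> q \<in> C" if "p \<in> \<Union>\<A>" "q \<in> \<Union>\<A>" for p q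
      proof -
        obtain A B where "A \<in> \<A>" "B \<in> \<A>" "p \<in> A" "q \<in> B" using \<open>p \<in> \<Union>\<A>\<close> \<open>q \<in> \<Union>\<A>\<close> by auto
        moreover then obtain C where "C \<in> \<A>" "A \<union> B \<subseteq> C" using dir[of A B] by auto
        ultimately show ?thesis by auto
      qed
      have "lattice_congruence L (\<Union>\<A>)"
      proof (rule lattice_congruenceI)
        show "\<Union>\<A> \<subseteq> carrier L \<times> carrier L" using lattice_congruenceD(1)[OF D] by (rule Union_least)
        obtain A where "A \<in> \<A>" using \<A>(2) by auto
        then show "(x, x) \<in> \<Union>\<A>" if "x \<in> carrier L" for x
          using lattice_congruenceD(2)[OF D that] by (intro UnionI)
        show "(y, x) \<in> \<Union>\<A>" if "(x, y) \<in> \<Union>\<A>" for x y using that lattice_congruenceD(3)[OF D] by auto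
        show "(x, z) \<in> \<Union>\<A>" if "(x, y) \<in> \<Union>\<A>" "(y, z) \<in> \<Union>\<A>" for x y z
          using common[OF that] lattice_congruenceD(4)[OF D, of _ x y z] by auto
        show "(x \<squnion> y, x' \<squnion> y') \<in> \<Union>\<A>" "(x \<sqinter> y, x' \<sqinter> y') \<in> \<Union>\<A>"
          if "(x, x') \<in> \<Union>\<A>" "(y, y') \<in> \<Union>\<A>" for x x' y y'
          using common[OF that] lattice_congruenceD(5)[OF D, of _ x x' y y']
            lattice_congruenceD(6)[OF D, of _ x x' y y'] by auto
      qed
      then show ?thesis by simp
    qed
  qed
qed

text \<open>This is the join of \<open>\<alpha>\<close> and \<open>\<beta>\<close>, described by chains. Compatibility can be checked for
one argument and one step of the chain at a time.\<close>

lemma lattice_congruence_trancl: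
  fixes L (structure)
  assumes "lattice L" and A: "lattice_congruence L \<alpha>" and B: "lattice_congruence L \<beta>"
  shows "lattice_congruence L ((\<alpha> \<union> \<beta>)\<^sup>+)"
proof -
  interpret lattice L by fact
  note AD = lattice_congruenceD[OF A] and BD = lattice_congruenceD[OF B]
  have sub: "(\<alpha> \<union> \<beta>)\<^sup>+ \<subseteq> carrier L \<times> carrier L"
    using AD(1) BD(1) by (intro trancl_subset_Sigma) blast
  have step: "(f x, f x') \<in> (\<alpha> \<union> \<beta>)\<^sup>+"
    if f: "\<And>x x'. (x, x') \<in> \<alpha> \<Longrightarrow> (f x, f x') \<in> \<alpha>" "\<And>x x'. (x, x') \<in> \<beta> \<Longrightarrow> (f x, f x') \<in> \<beta>"
      and x: "(x, x') \<in> (\<alpha> \<union> \<beta>)\<^sup>+" for f x x'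
    using x
  proof induction
    case (base y) then show ?case using f by (auto intro!: r_into_trancl)
  next
    case (step y z)
    then have "(f y, f z) \<in> (\<alpha> \<union> \<beta>)\<^sup>+" using f by (auto intro!: r_into_trancl)
    then show ?case using step.IH by (rule trancl_trans[rotated])
  qed
  have compat: "(f x y, f x' y') \<in> (\<alpha> \<union> \<beta>)\<^sup>+"
    if f: "\<And>x x' y y'. \<lbrakk>(x, x') \<in> \<alpha>; (y, y') \<in> \<alpha>\<rbrakk> \<Longrightarrow> (f x y, f x' y') \<in> \<alpha>"
        "\<And>x x' y y'. \<lbrakk>(x, x') \<in> \<beta>; (y, y') \<in> \<beta>\<rbrakk> \<Longrightarrow> (f x y, f x' y') \<in> \<beta>"
      and xy: "(x, x') \<in> (\<alpha> \<union> \<beta>)\<^sup>+" "(y, y') \<in> (\<alpha> \<union> \<beta>)\<^sup>+" for f x x' y y'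
  proof -
    have "y \<in> carrier L" "x' \<in> carrier L" using xy sub by auto
    then have "(f x y, f x' y) \<in> (\<alpha> \<union> \<beta>)\<^sup>+" "(f x' y, f x' y') \<in> (\<alpha> \<union> \<beta>)\<^sup>+"
      using step[of "\<lambda>x. f x y", OF _ _ xy(1)] step[of "f x'", OF _ _ xy(2)] f AD(2) BD(2) by auto
    then show ?thesis by (rule trancl_trans)
  qed
  show ?thesis
  proof (rule lattice_congruenceI[OF sub])
    show "(x, x) \<in> (\<alpha> \<union> \<beta>)\<^sup>+" if "x \<in> carrier L" for x using AD(2)[OF that] by (intro r_into_trancl) simp
    have "sym (\<alpha> \<union> \<beta>)" using AD(3) BD(3) by (auto intro: symI)
    then show "(y, x) \<in> (\<alpha> \<union> \<beta>)\<^sup>+" if "(x, y) \<in> (\<alpha> \<union> \<beta>)\<^sup>+" for x y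
      using that by (meson sym_trancl symD)
    show "(x, z) \<in> (\<alpha> \<union> \<beta>)\<^sup>+" if "(x, y) \<in> (\<alpha> \<union> \<beta>)\<^sup>+" "(y, z) \<in> (\<alpha> \<union> \<beta>)\<^sup>+" for x y z
      using that by (rule trancl_trans)
    show "(x \<squnion> y, x' \<squnion> y') \<in> (\<alpha> \<union> \<beta>)\<^sup>+" if "(x, x') \<in> (\<alpha> \<union> \<beta>)\<^sup>+" "(y, y') \<in> (\<alpha> \<union> \<beta>)\<^sup>+" for x x' y y'
      by (rule compat[OF AD(5) BD(5) that])
    show "(x \<sqinter> y, x' \<sqinter> y') \<in> (\<alpha> \<union> \<beta>)\<^sup>+" if "(x, x') \<in> (\<alpha> \<union> \<beta>)\<^sup>+" "(y, y') \<in> (\<alpha> \<union> \<beta>)\<^sup>+" for x x' y y'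
      by (rule compat[OF AD(6) BD(6) that])
  qed
qed

lemma (in lattice) median_eqs:
  assumes "x \<in> carrier L" "z \<in> carrier L"
  shows "(x \<sqinter> x) \<squnion> ((x \<sqinter> z) \<squnion> (x \<sqinter> z)) = x" "(x \<sqinter> z) \<squnion> ((z \<sqinter> x) \<squnion> (x \<sqinter> x)) = x"
    "(x \<sqinter> z) \<squnion> ((z \<sqinter> z) \<squnion> (x \<sqinter> z)) = z"
proof -
  have idem: "x \<sqinter> x = x" "y \<squnion> y = y" if "x \<in> carrier L" "y \<in> carrier L" for x y
    using that le_iff_join[of x x] le_iff_meet[of y y] by simp_all
  have absorb: "u \<squnion> v = v" "v \<squnion> u = v" if "u \<sqsubseteq> v" "u \<in> carrier L" "v \<in> carrier L" for u v
    using that le_iff_meet[of u v] join_comm[of L v u] by simp_all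
  have cl: "x \<sqinter> z \<in> carrier L" "z \<sqinter> x \<in> carrier L" using assms by simp_all
  note le = meet_left[OF assms] meet_right[OF assms] meet_left[OF assms(2,1)] meet_right[OF assms(2,1)]
  show "(x \<sqinter> x) \<squnion> ((x \<sqinter> z) \<squnion> (x \<sqinter> z)) = x"
    using idem[OF assms(1) cl(1)] absorb(2)[OF le(1) cl(1) assms(1)] by simp
  show "(x \<sqinter> z) \<squnion> ((z \<sqinter> x) \<squnion> (x \<sqinter> x)) = x"
    using idem(1)[OF assms(1,1)] absorb(1)[OF le(1) cl(1) assms(1)] absorb(1)[OF le(4) cl(2) assms(1)] by simp
  show "(x \<sqinter> z) \<squnion> ((z \<sqinter> z) \<squnion> (x \<sqinter> z)) = z"
    using idem(1)[OF assms(2,2)] absorb[OF le(2) cl(1) assms(2)] by simp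
qed

text \<open>The theorem of Funayama and Nakayama. Let \<open>x\<close> and \<open>y\<close> be congruent modulo \<open>\<theta>\<close> and joined by a
chain of steps in \<open>\<alpha>\<close> and \<open>\<beta>\<close>. Replacing each member \<open>z\<close> of the chain by the median of \<open>x\<close>, \<open>z\<close>
and \<open>y\<close> keeps the steps in \<open>\<alpha>\<close> or \<open>\<beta>\<close> and the end points, and moves the whole chain into a single
class of \<open>\<theta>\<close>.\<close>

lemma distributive_lattice_Con:
  assumes "lattice L"
  shows "distributive_lattice (Con L)"
proof -
  interpret L: lattice L by fact
  interpret C: algebraic_closure_system "{\<theta>. lattice_congruence L \<theta>}" "carrier L \<times> carrier L"
    by (rule closure_system_Con[OF assms])
  have Con: "Con L = C.L" by (simp add: Con_def)
  interpret CL: complete_lattice C.L by (rule C.complete)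
  show ?thesis
    unfolding distributive_lattice_def Con
  proof (intro conjI ballI)
    show "lattice C.L" by (rule CL.lattice_axioms)
    fix \<theta> \<alpha> \<beta> assume "\<theta> \<in> carrier C.L" "\<alpha> \<in> carrier C.L" "\<beta> \<in> carrier C.L"
    then have con: "lattice_congruence L \<theta>" "lattice_congruence L \<alpha>" "lattice_congruence L \<beta>" by simp_all
    note T = lattice_congruenceD[OF con(1)] and A = lattice_congruenceD[OF con(2)]
      and B = lattice_congruenceD[OF con(3)]
    have int: "lattice_congruence L (\<theta> \<inter> \<alpha>)" "lattice_congruence L (\<theta> \<inter> \<beta>)"
      using C.Inter_mem[of "{\<theta>, \<alpha>}"] C.Inter_mem[of "{\<theta>, \<beta>}"] con by simp_all
    define \<delta> where "\<delta> = C.cl (\<alpha> \<union> \<beta>)"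
    define \<gamma> where "\<gamma> = C.cl ((\<theta> \<inter> \<alpha>) \<union> (\<theta> \<inter> \<beta>))"
    have \<delta>: "lattice_congruence L \<delta>" "\<alpha> \<union> \<beta> \<subseteq> \<delta>"
      using C.cl_mem[of "\<alpha> \<union> \<beta>"] A(1) B(1) hull_subset[of "\<alpha> \<union> \<beta>"] unfolding \<delta>_def by simp_all
    have \<gamma>: "lattice_congruence L \<gamma>" "(\<theta> \<inter> \<alpha>) \<union> (\<theta> \<inter> \<beta>) \<subseteq> \<gamma>"
      using C.cl_mem[of "(\<theta> \<inter> \<alpha>) \<union> (\<theta> \<inter> \<beta>)"] A(1) B(1) hull_subset[of "(\<theta> \<inter> \<alpha>) \<union> (\<theta> \<inter> \<beta>)"]
      unfolding \<gamma>_def by blast+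
    note G = lattice_congruenceD[OF \<gamma>(1)]
    have "\<theta> \<inter> \<delta> \<subseteq> \<gamma>"
    proof clarify
      fix x y assume xy: "(x, y) \<in> \<theta>" "(x, y) \<in> \<delta>"
      then have xyL: "x \<in> carrier L" "y \<in> carrier L" using T(1) by auto
      define m where "m z = (x \<sqinter>\<^bsub>L\<^esub> z) \<squnion>\<^bsub>L\<^esub> ((z \<sqinter>\<^bsub>L\<^esub> y) \<squnion>\<^bsub>L\<^esub> (x \<sqinter>\<^bsub>L\<^esub> y))" for z
      have m_cong: "(m z, m z') \<in> \<phi>" if "lattice_congruence L \<phi>" "(z, z') \<in> \<phi>" for \<phi> z z'
      proof -
        note D = lattice_congruenceD[OF that(1)]
        show ?thesis unfolding m_def
          using D(5)[OF D(6)[OF D(2)[OF xyL(1)] that(2)]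
              D(5)[OF D(6)[OF that(2) D(2)[OF xyL(2)]] D(6)[OF D(2)[OF xyL(1)] D(2)[OF xyL(2)]]]] .
      qed
      \<comment> \<open>Modulo \<open>\<theta>\<close> the median has two arguments equal to \<open>x\<close>.\<close>
      have m_x: "(m z, x) \<in> \<theta>" if z: "z \<in> carrier L" for z
      proof -
        have "(m z, (x \<sqinter>\<^bsub>L\<^esub> z) \<squnion>\<^bsub>L\<^esub> ((z \<sqinter>\<^bsub>L\<^esub> x) \<squnion>\<^bsub>L\<^esub> (x \<sqinter>\<^bsub>L\<^esub> x))) \<in> \<theta>"
          unfolding m_def using T(5)[OF T(6)[OF T(2)[OF xyL(1)] T(2)[OF z]]
              T(5)[OF T(6)[OF T(2)[OF z] T(3)[OF xy(1)]] T(6)[OF T(2)[OF xyL(1)] T(3)[OF xy(1)]]]] .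
        then show ?thesis using L.median_eqs(2)[OF xyL(1) z] by simp
      qed
      have step: "(m z, m z') \<in> \<gamma>" if z: "(z, z') \<in> \<alpha> \<union> \<beta>" for z z'
      proof -
        have "z \<in> carrier L" "z' \<in> carrier L" using z A(1) B(1) by auto
        then have "(m z, m z') \<in> \<theta>" using T(4)[OF m_x T(3)[OF m_x]] by simp
        moreover have "(m z, m z') \<in> \<alpha> \<union> \<beta>" using z m_cong[OF con(2)] m_cong[OF con(3)] by auto
        ultimately show ?thesis using \<gamma>(2) by auto
      qed
      have "\<delta> \<subseteq> (\<alpha> \<union> \<beta>)\<^sup>+"
        unfolding \<delta>_def using lattice_congruence_trancl[OF assms con(2,3)]
        by (intro hull_minimal) auto
      then have "(x, y) \<in> (\<alpha> \<union> \<beta>)\<^sup>+" using xy(2) by auto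
      then have "(m x, m y) \<in> \<gamma>"
      proof induction
        case (base z) then show ?case by (rule step)
      next
        case (step z z') then show ?case using G(4)[OF step.IH] \<open>\<And>z z'. (z, z') \<in> \<alpha> \<union> \<beta> \<Longrightarrow> (m z, m z') \<in> \<gamma>\<close> by blast
      qed
      moreover have "m x = x" "m y = y" unfolding m_def using L.median_eqs(1,3)[OF xyL] by simp_all
      ultimately show "(x, y) \<in> \<gamma>" by simp
    qed
    moreover have "\<gamma> \<subseteq> \<theta> \<inter> \<delta>"
    proof -
      have "lattice_congruence L (\<theta> \<inter> \<delta>)" using C.Inter_mem[of "{\<theta>, \<delta>}"] con(1) \<delta>(1) by simp
      then show ?thesis unfolding \<gamma>_def using \<delta>(2) by (intro hull_minimal) auto
    qed
    ultimately have "\<theta> \<inter> \<delta> = \<gamma>" by blast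
    then show "\<theta> \<sqinter>\<^bsub>C.L\<^esub> (\<alpha> \<squnion>\<^bsub>C.L\<^esub> \<beta>) = (\<theta> \<sqinter>\<^bsub>C.L\<^esub> \<alpha>) \<squnion>\<^bsub>C.L\<^esub> (\<theta> \<sqinter>\<^bsub>C.L\<^esub> \<beta>)"
      using con \<delta>(1) int by (simp add: C.join_eq C.meet_eq \<delta>_def \<gamma>_def)
  qed
qed

section \<open>Generation and transport of lattices\<close>

inductive_set lat_gen :: "('a, 'c) gorder_scheme \<Rightarrow> 'a set \<Rightarrow> 'a set" for L and A where
  base: "x \<in> A \<Longrightarrow> x \<in> lat_gen L A"
| join: "\<lbrakk>x \<in> lat_gen L A; y \<in> lat_gen L A\<rbrakk> \<Longrightarrow> x \<squnion>\<^bsub>L\<^esub> y \<in> lat_gen L A"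
| meet: "\<lbrakk>x \<in> lat_gen L A; y \<in> lat_gen L A\<rbrakk> \<Longrightarrow> x \<sqinter>\<^bsub>L\<^esub> y \<in> lat_gen L A"

lemma lat_gen_subset_carrier:
  assumes "lattice L" "A \<subseteq> carrier L"
  shows "lat_gen L A \<subseteq> carrier L"
proof
  interpret lattice L by fact
  fix x assume "x \<in> lat_gen L A"
  then show "x \<in> carrier L" by induction (use assms(2) in auto)
qed

lemma lat_gen_mono:
  assumes "A \<subseteq> B" shows "lat_gen L A \<subseteq> lat_gen L B"
proof
  fix x assume "x \<in> lat_gen L A"
  then show "x \<in> lat_gen L B" by induction (use assms in \<open>auto intro: lat_gen.intros\<close>)
qed

lemma lat_gen_finite_support:
  assumes "x \<in> lat_gen L (A \<union> C)"
  obtains X where "X \<subseteq> A" "finite X" "x \<in> lat_gen L (X \<union> C)"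
proof -
  have "\<exists>X\<subseteq>A. finite X \<and> x \<in> lat_gen L (X \<union> C)"
    using assms
  proof induction
    case (base x)
    then show ?case
    proof
      assume "x \<in> A"
      then show ?thesis by (intro exI[of _ "{x}"]) (simp add: lat_gen.base)
    next
      assume "x \<in> C"
      then show ?thesis by (intro exI[of _ "{}"]) (simp add: lat_gen.base)
    qed
  next
    case (join x y)
    then obtain X Y where XY: "X \<subseteq> A" "finite X" "x \<in> lat_gen L (X \<union> C)"
      "Y \<subseteq> A" "finite Y" "y \<in> lat_gen L (Y \<union> C)" by auto
    then have "x \<in> lat_gen L (X \<union> Y \<union> C)" "y \<in> lat_gen L (X \<union> Y \<union> C)"
      using lat_gen_mono[of "X \<union> C" "X \<union> Y \<union> C" L] lat_gen_mono[of "Y \<union> C" "X \<union> Y \<union> C" L] by auto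
    then show ?case using XY by (intro exI[of _ "X \<union> Y"]) (auto intro: lat_gen.join)
  next
    case (meet x y)
    then obtain X Y where XY: "X \<subseteq> A" "finite X" "x \<in> lat_gen L (X \<union> C)"
      "Y \<subseteq> A" "finite Y" "y \<in> lat_gen L (Y \<union> C)" by auto
    then have "x \<in> lat_gen L (X \<union> Y \<union> C)" "y \<in> lat_gen L (X \<union> Y \<union> C)"
      using lat_gen_mono[of "X \<union> C" "X \<union> Y \<union> C" L] lat_gen_mono[of "Y \<union> C" "X \<union> Y \<union> C" L] by auto
    then show ?case using XY by (intro exI[of _ "X \<union> Y"]) (auto intro: lat_gen.meet)
  qed
  then show thesis using that by blast
qed

lemma lattice_hom_eq_on_lat_gen:
  assumes h: "h \<in> lattice_hom L K" and h': "h' \<in> lattice_hom L K" and A: "A \<subseteq> carrier L"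
    and eq: "\<And>x. x \<in> A \<Longrightarrow> h x = h' x" and x: "x \<in> lat_gen L A"
  shows "h x = h' x"
  using x
proof induction
  case (base x)
  then show ?case by (rule eq)
next
  case (join x y)
  then have "x \<in> carrier L" "y \<in> carrier L"
    using lat_gen_subset_carrier[OF lattice_homD(1)[OF h] A] by auto
  then show ?case using join lattice_homD(4)[OF h, of x y] lattice_homD(4)[OF h', of x y] by simp
next
  case (meet x y)
  then have "x \<in> carrier L" "y \<in> carrier L"
    using lat_gen_subset_carrier[OF lattice_homD(1)[OF h] A] by auto
  then show ?case using meet lattice_homD(5)[OF h, of x y] lattice_homD(5)[OF h', of x y] by simp
qed

instance lat_term :: countable by countable_datatype

lemma countable_lat_gen:
  assumes "countable A"
  shows "countable (lat_gen L A)"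
proof (cases "A = {}")
  case True
  have "x \<in> lat_gen L {} \<Longrightarrow> False" for x by (induction rule: lat_gen.induct) auto
  then have "lat_gen L A = {}" using True by blast
  then show ?thesis by simp
next
  case False
  then obtain \<nu> :: "nat \<Rightarrow> 'a" where \<nu>: "range \<nu> = A" using assms uncountable_def by metis
  have "x \<in> range (lat_eval L \<nu>)" if "x \<in> lat_gen L A" for x
    using that
  proof induction
    case (base x)
    then obtain n where "x = \<nu> n" using \<nu> by auto
    then show ?case by (intro range_eqI[of _ _ "Var n"]) simp
  next
    case (join x y)
    then obtain s t where "x = lat_eval L \<nu> s" "y = lat_eval L \<nu> t" by auto
    then show ?case by (intro range_eqI[of _ _ "Join s t"]) simp
  next
    case (meet x y)
    then obtain s t where "x = lat_eval L \<nu> s" "y = lat_eval L \<nu> t" by auto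
    then show ?case by (intro range_eqI[of _ _ "Meet s t"]) simp
  qed
  then have "lat_gen L A \<subseteq> range (lat_eval L \<nu>)" by blast
  then show ?thesis by (rule countable_subset) (simp add: countable_image)
qed

text \<open>With the identity as \<open>\<kappa>\<close> this is a sublattice of \<open>K\<close>. With an arbitrary injection \<open>\<kappa>\<close> it is a copy
of a sublattice over another type.\<close>

definition pullback_order :: "('b, 'd) gorder_scheme \<Rightarrow> 'a set \<Rightarrow> ('a \<Rightarrow> 'b) \<Rightarrow> 'a gorder"
  where "pullback_order K C \<kappa> = \<lparr>carrier = C, eq = (=), le = (\<lambda>x y. \<kappa> x \<sqsubseteq>\<^bsub>K\<^esub> \<kappa> y)\<rparr>"

lemma pullback_order_simps [simp]:
  "carrier (pullback_order K C \<kappa>) = C" "eq (pullback_order K C \<kappa>) = (=)"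
  "le (pullback_order K C \<kappa>) x y \<longleftrightarrow> \<kappa> x \<sqsubseteq>\<^bsub>K\<^esub> \<kappa> y"
  by (simp_all add: pullback_order_def)

lemma pullback_lattice_hom:
  assumes "lattice K" and inj: "inj_on \<kappa> C" and C: "\<kappa> ` C \<subseteq> carrier K"
    and cl: "\<And>x y. \<lbrakk>x \<in> C; y \<in> C\<rbrakk> \<Longrightarrow> \<kappa> x \<squnion>\<^bsub>K\<^esub> \<kappa> y \<in> \<kappa> ` C"
      "\<And>x y. \<lbrakk>x \<in> C; y \<in> C\<rbrakk> \<Longrightarrow> \<kappa> x \<sqinter>\<^bsub>K\<^esub> \<kappa> y \<in> \<kappa> ` C"
  shows "\<kappa> \<in> lattice_hom (pullback_order K C \<kappa>) K"
proof -
  interpret K: lattice K by fact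
  let ?P = "pullback_order K C \<kappa>"
  have \<kappa>: "\<kappa> x \<in> carrier K" if "x \<in> C" for x using that C by auto
  interpret P: partial_order ?P
  proof
    show "x .=\<^bsub>?P\<^esub> y" if "x \<sqsubseteq>\<^bsub>?P\<^esub> y" "y \<sqsubseteq>\<^bsub>?P\<^esub> x" "x \<in> carrier ?P" "y \<in> carrier ?P" for x y
      using that K.le_antisym[of "\<kappa> x" "\<kappa> y"] \<kappa> inj by (auto dest: inj_onD)
    show "x \<sqsubseteq>\<^bsub>?P\<^esub> z" if "x \<sqsubseteq>\<^bsub>?P\<^esub> y" "y \<sqsubseteq>\<^bsub>?P\<^esub> z" "x \<in> carrier ?P" "y \<in> carrier ?P" "z \<in> carrier ?P" for x y z
      using that K.le_trans[of "\<kappa> x" "\<kappa> y" "\<kappa> z"] \<kappa> by simp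
  qed (use \<kappa> in auto)
  have J: "\<exists>s. s \<in> C \<and> \<kappa> s = \<kappa> x \<squnion>\<^bsub>K\<^esub> \<kappa> y \<and> least ?P s (Upper ?P {x, y})" if xy: "x \<in> C" "y \<in> C" for x y
  proof -
    obtain s where s: "s \<in> C" "\<kappa> s = \<kappa> x \<squnion>\<^bsub>K\<^esub> \<kappa> y" using cl(1)[OF xy] by auto
    have "least ?P s (Upper ?P {x, y})"
      using xy s \<kappa> K.join_left[of "\<kappa> x" "\<kappa> y"] K.join_right[of "\<kappa> x" "\<kappa> y"]
      by (auto simp: least_def Upper_def intro!: K.join_le)
    then show ?thesis using s by blast
  qed
  have M: "\<exists>s. s \<in> C \<and> \<kappa> s = \<kappa> x \<sqinter>\<^bsub>K\<^esub> \<kappa> y \<and> greatest ?P s (Lower ?P {x, y})" if xy: "x \<in> C" "y \<in> C" for x y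
  proof -
    obtain s where s: "s \<in> C" "\<kappa> s = \<kappa> x \<sqinter>\<^bsub>K\<^esub> \<kappa> y" using cl(2)[OF xy] by auto
    have "greatest ?P s (Lower ?P {x, y})"
      using xy s \<kappa> K.meet_left[of "\<kappa> x" "\<kappa> y"] K.meet_right[of "\<kappa> x" "\<kappa> y"]
      by (auto simp: greatest_def Lower_def intro!: K.meet_le)
    then show ?thesis using s by blast
  qed
  interpret P: lattice ?P
    by unfold_locales (use J M in \<open>simp; blast\<close>)+
  show ?thesis
  proof (rule lattice_homI[OF P.lattice_axioms assms(1)])
    fix x y assume "x \<in> carrier ?P" "y \<in> carrier ?P"
    then have xy: "x \<in> C" "y \<in> C" by simp_all
    obtain s where s: "\<kappa> s = \<kappa> x \<squnion>\<^bsub>K\<^esub> \<kappa> y" "least ?P s (Upper ?P {x, y})" using J[OF xy] by blast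
    have "x \<squnion>\<^bsub>?P\<^esub> y = s"
      unfolding Lattice.join_def Lattice.sup_def
      by (rule some_equality[where P = "\<lambda>s. least ?P s (Upper ?P {x, y})"]) (use s(2) P.least_unique in auto)
    then show "\<kappa> (x \<squnion>\<^bsub>?P\<^esub> y) = \<kappa> x \<squnion>\<^bsub>K\<^esub> \<kappa> y" using s(1) by simp
    obtain i where i: "\<kappa> i = \<kappa> x \<sqinter>\<^bsub>K\<^esub> \<kappa> y" "greatest ?P i (Lower ?P {x, y})" using M[OF xy] by blast
    have "x \<sqinter>\<^bsub>?P\<^esub> y = i"
      unfolding Lattice.meet_def Lattice.inf_def
      by (rule some_equality[where P = "\<lambda>s. greatest ?P s (Lower ?P {x, y})"]) (use i(2) P.greatest_unique in auto)
    then show "\<kappa> (x \<sqinter>\<^bsub>?P\<^esub> y) = \<kappa> x \<sqinter>\<^bsub>K\<^esub> \<kappa> y" using i(1) by simp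
  qed (use \<kappa> in auto)
qed

lemma in_variety_embedding:
  assumes h: "h \<in> lattice_hom L K" and inj: "inj_on h (carrier L)" and K: "in_variety \<Sigma> K"
  shows "in_variety \<Sigma> L"
  unfolding in_variety_def
proof (intro conjI ballI)
  note hD = lattice_homD[OF h]
  interpret L: lattice L by (rule hD)
  show "lattice L" by (rule hD)
  have eval: "lat_eval L \<nu> t \<in> carrier L \<and> h (lat_eval L \<nu> t) = lat_eval K (h \<circ> \<nu>) t"
    if "\<nu> \<in> UNIV \<rightarrow> carrier L" for \<nu> t
    using that by (induction t) (auto simp: hD(4,5))
  fix e assume e: "e \<in> \<Sigma>"
  obtain s t where st: "e = (s, t)" by fastforce
  have "lat_eval L \<nu> s = lat_eval L \<nu> t" if \<nu>: "\<nu> \<in> UNIV \<rightarrow> carrier L" for \<nu>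
  proof -
    have "h \<circ> \<nu> \<in> UNIV \<rightarrow> carrier K" using \<nu> hD(3) by (simp add: Pi_iff)
    then have "lat_eval K (h \<circ> \<nu>) s = lat_eval K (h \<circ> \<nu>) t"
      using K e st unfolding in_variety_def by blast
    then show ?thesis using eval[OF \<nu>, of s] eval[OF \<nu>, of t] by (intro inj_onD[OF inj]) simp_all
  qed
  then show "case e of (s, t) \<Rightarrow> \<forall>\<nu>\<in>UNIV \<rightarrow> carrier L. lat_eval L \<nu> s = lat_eval L \<nu> t"
    using st by simp
qed

lemma bounded_latticeI:
  assumes "lattice L" "b \<in> carrier L" "t \<in> carrier L"
    and "\<And>x. x \<in> carrier L \<Longrightarrow> b \<sqsubseteq>\<^bsub>L\<^esub> x" "\<And>x. x \<in> carrier L \<Longrightarrow> x \<sqsubseteq>\<^bsub>L\<^esub> t"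
  shows "bounded_lattice L" "\<bottom>\<^bsub>L\<^esub> = b" "\<top>\<^bsub>L\<^esub> = t"
proof -
  interpret lattice L by fact
  show *: "bounded_lattice L"
    by unfold_locales (use assms in \<open>auto simp: least_def greatest_def\<close>)
  show "\<bottom>\<^bsub>L\<^esub> = b" using bounded_lattice.bottom_eq[OF *, of b] assms by simp
  show "\<top>\<^bsub>L\<^esub> = t" using bounded_lattice.top_eq[OF *, of t] assms by simp
qed

section \<open>Complements in non-distributive lattices\<close>

context lattice
begin

text \<open>Inequalities between lattice words are settled by \<open>join_le_iff\<close>, \<open>le_meet_iff\<close> and the four
rules \<open>word_intros\<close>, which together are Whitman's procedure for free lattices.\<close>

lemma meet_lower1: "\<lbrakk>x \<sqsubseteq> z; x \<in> carrier L; y \<in> carrier L; z \<in> carrier L\<rbrakk> \<Longrightarrow> x \<sqinter> y \<sqsubseteq> z"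
  using le_trans[OF meet_left] by simp

lemma meet_lower2: "\<lbrakk>y \<sqsubseteq> z; x \<in> carrier L; y \<in> carrier L; z \<in> carrier L\<rbrakk> \<Longrightarrow> x \<sqinter> y \<sqsubseteq> z"
  using le_trans[OF meet_right] by simp

lemma join_upper1: "\<lbrakk>z \<sqsubseteq> x; x \<in> carrier L; y \<in> carrier L; z \<in> carrier L\<rbrakk> \<Longrightarrow> z \<sqsubseteq> x \<squnion> y"
  using le_trans[OF _ join_left] by simp

lemma join_upper2: "\<lbrakk>z \<sqsubseteq> y; x \<in> carrier L; y \<in> carrier L; z \<in> carrier L\<rbrakk> \<Longrightarrow> z \<sqsubseteq> x \<squnion> y"
  using le_trans[OF _ join_right] by simp

lemma join_le_iff: "\<lbrakk>x \<in> carrier L; y \<in> carrier L; z \<in> carrier L\<rbrakk> \<Longrightarrow> x \<squnion> y \<sqsubseteq> z \<longleftrightarrow> x \<sqsubseteq> z \<and> y \<sqsubseteq> z"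
  using join_le join_upper1 join_left join_right le_trans join_closed by metis

lemma le_meet_iff: "\<lbrakk>x \<in> carrier L; y \<in> carrier L; z \<in> carrier L\<rbrakk> \<Longrightarrow> z \<sqsubseteq> x \<sqinter> y \<longleftrightarrow> z \<sqsubseteq> x \<and> z \<sqsubseteq> y"
  using meet_le meet_left meet_right le_trans meet_closed by metis

lemmas word_intros = meet_lower1 meet_lower2 join_upper1 join_upper2

definition modular :: bool where
  "modular \<longleftrightarrow> (\<forall>x\<in>carrier L. \<forall>y\<in>carrier L. \<forall>z\<in>carrier L. x \<sqsubseteq> z \<longrightarrow> x \<squnion> (y \<sqinter> z) = (x \<squnion> y) \<sqinter> z)"

text \<open>The two sides of the modular law have the same meet and the same join with \<open>y\<close>: where the law
fails, they form a pentagon with \<open>y\<close>.\<close>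

lemma modular_if_complements_unique:
  assumes unique: "\<And>p q r. \<lbrakk>p \<in> carrier L; q \<in> carrier L; r \<in> carrier L;
      p \<sqinter> q = r \<sqinter> q; p \<squnion> q = r \<squnion> q\<rbrakk> \<Longrightarrow> p = r"
  shows modular
  unfolding modular_def
proof (intro ballI impI)
  fix x y z assume [simp]: "x \<in> carrier L" "y \<in> carrier L" "z \<in> carrier L" and xz [simp]: "x \<sqsubseteq> z"
  show "x \<squnion> (y \<sqinter> z) = (x \<squnion> y) \<sqinter> z"
  proof (rule unique[where q = y])
    show "(x \<squnion> (y \<sqinter> z)) \<sqinter> y = ((x \<squnion> y) \<sqinter> z) \<sqinter> y"
      by (rule le_antisym) (simp_all add: join_le_iff le_meet_iff word_intros)
    show "(x \<squnion> (y \<sqinter> z)) \<squnion> y = ((x \<squnion> y) \<sqinter> z) \<squnion> y"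
      by (rule le_antisym) (simp_all add: join_le_iff le_meet_iff word_intros)
  qed simp_all
qed

text \<open>The summands are two of the three atoms of the diamond that a modular lattice contains where it
fails to be distributive, and the right-hand side is the top of the diamond.\<close>

lemma modular_join_eq:
  assumes modular and [simp]: "x \<in> carrier L" "y \<in> carrier L" "z \<in> carrier L"
  shows "((x \<sqinter> (y \<squnion> z)) \<squnion> (y \<sqinter> z)) \<squnion> ((y \<sqinter> (z \<squnion> x)) \<squnion> (z \<sqinter> x)) = ((y \<squnion> x) \<sqinter> (y \<squnion> z)) \<sqinter> (z \<squnion> x)"
proof -
  let ?A = "x \<sqinter> (y \<squnion> z)"
  have "((x \<sqinter> (y \<squnion> z)) \<squnion> (y \<sqinter> z)) \<squnion> ((y \<sqinter> (z \<squnion> x)) \<squnion> (z \<sqinter> x)) = ?A \<squnion> (y \<sqinter> (z \<squnion> x))"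
    by (rule le_antisym) (simp_all add: join_le_iff le_meet_iff word_intros)
  also have "\<dots> = (?A \<squnion> y) \<sqinter> (z \<squnion> x)"
  proof -
    have "?A \<sqsubseteq> z \<squnion> x" by (simp_all add: join_le_iff le_meet_iff word_intros)
    then show ?thesis using assms(1) unfolding modular_def by simp
  qed
  also have "?A \<squnion> y = (y \<squnion> x) \<sqinter> (y \<squnion> z)"
  proof -
    have "y \<sqsubseteq> y \<squnion> z" by (simp_all add: join_le_iff le_meet_iff word_intros)
    then show ?thesis using assms(1) join_comm[of L ?A y] unfolding modular_def by simp
  qed
  finally show ?thesis .
qed

end

lemma (in lattice) modular_dual:
  assumes modular shows "lattice.modular (inv_gorder L)"
proof -
  interpret D: lattice "inv_gorder L" by (rule dual_lattice)
  show ?thesis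
    unfolding D.modular_def
  proof (intro ballI impI)
    fix x y z assume "x \<in> carrier (inv_gorder L)" "y \<in> carrier (inv_gorder L)" "z \<in> carrier (inv_gorder L)"
      and "x \<sqsubseteq>\<^bsub>inv_gorder L\<^esub> z"
    then have "z \<squnion> (y \<sqinter> x) = (z \<squnion> y) \<sqinter> x" using assms unfolding modular_def by simp
    then show "x \<squnion>\<^bsub>inv_gorder L\<^esub> (y \<sqinter>\<^bsub>inv_gorder L\<^esub> z) = (x \<squnion>\<^bsub>inv_gorder L\<^esub> y) \<sqinter>\<^bsub>inv_gorder L\<^esub> z"
      unfolding join_dual meet_dual
      by (metis join_comm meet_comm)
  qed
qed

text \<open>The elements \<open>f x y z\<close>, \<open>f y z x\<close>, \<open>f z x y\<close> have pairwise the same join \<open>e\<close> and, by duality, the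
same meet \<open>d\<close>. Uniqueness makes them equal, so \<open>e = d\<close>, and the distributive law follows from
\<open>x \<sqinter> (y \<squnion> z) \<le> e\<close> and the modular law.\<close>

lemma (in lattice) distributive_if_complements_unique:
  assumes unique: "\<And>p q r. \<lbrakk>p \<in> carrier L; q \<in> carrier L; r \<in> carrier L;
      p \<sqinter> q = r \<sqinter> q; p \<squnion> q = r \<squnion> q\<rbrakk> \<Longrightarrow> p = r"
  shows "distributive_lattice L"
  unfolding distributive_lattice_def
proof (intro conjI ballI lattice_axioms)
  fix x y z assume xyz [simp]: "x \<in> carrier L" "y \<in> carrier L" "z \<in> carrier L"
  interpret D: lattice "inv_gorder L" by (rule dual_lattice)
  have mod: modular by (rule modular_if_complements_unique) (fact unique)
  define f where "f x y z = (x \<sqinter> (y \<squnion> z)) \<squnion> (y \<sqinter> z)" for x y z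
  define e where "e x y z = ((y \<squnion> x) \<sqinter> (y \<squnion> z)) \<sqinter> (z \<squnion> x)" for x y z
  define d where "d x y z = ((y \<sqinter> x) \<squnion> (y \<sqinter> z)) \<squnion> (z \<sqinter> x)" for x y z
  have f: "f x y z \<in> carrier L" if "x \<in> carrier L" "y \<in> carrier L" "z \<in> carrier L" for x y z
    using that unfolding f_def by simp
  have join: "f x y z \<squnion> f y z x = e x y z" if "x \<in> carrier L" "y \<in> carrier L" "z \<in> carrier L" for x y z
    using modular_join_eq[OF mod that] unfolding f_def e_def .
  have meet: "f x y z \<sqinter> f y z x = d x y z" if [simp]: "x \<in> carrier L" "y \<in> carrier L" "z \<in> carrier L" for x y z
  proof -
    have f': "f x y z = (x \<squnion> (y \<sqinter> z)) \<sqinter> (y \<squnion> z)" 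
      if [simp]: "x \<in> carrier L" "y \<in> carrier L" "z \<in> carrier L" for x y z
    proof -
      have "y \<sqinter> z \<sqsubseteq> y \<squnion> z" by (simp_all add: join_le_iff le_meet_iff word_intros)
      then have "(y \<sqinter> z) \<squnion> (x \<sqinter> (y \<squnion> z)) = ((y \<sqinter> z) \<squnion> x) \<sqinter> (y \<squnion> z)"
        using mod unfolding modular_def by simp
      then show ?thesis unfolding f_def join_comm[of L "y \<sqinter> z"] .
    qed
    show ?thesis
      using D.modular_join_eq[OF modular_dual[OF mod], of x y z] unfolding d_def by (simp add: f')
  qed
  have rot: "e y z x = e x y z" "d y z x = d x y z" if [simp]: "x \<in> carrier L" "y \<in> carrier L" "z \<in> carrier L" for x y z
  proof -
    show "e y z x = e x y z"
      unfolding e_def by (rule le_antisym) (simp_all add: join_le_iff le_meet_iff word_intros)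
    show "d y z x = d x y z"
      unfolding d_def by (rule le_antisym) (simp_all add: join_le_iff le_meet_iff word_intros)
  qed
  let ?p = "f x y z" and ?q = "f y z x" and ?r = "f z x y"
  have "?p = ?r"
    using join[of x y z] join[of y z x] meet[of x y z] meet[of y z x] rot[of x y z] f
    by (intro unique[of ?p ?q ?r]) (simp_all add: join_comm[of L ?r] meet_comm[of L ?r])
  moreover have "?q = ?p"
    using join[of y z x] join[of z x y] meet[of y z x] meet[of z x y] rot[of y z x] f
    by (intro unique[of ?q ?r ?p]) (simp_all add: join_comm[of L ?p] meet_comm[of L ?p])
  ultimately have "e x y z = ?p" "d x y z = ?p"
    using join[of x y z] meet[of x y z] f le_iff_meet[of ?p ?p] le_iff_join[of ?p ?p] by simp_all
  then have ed: "e x y z = d x y z" by simp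
  let ?b = "(x \<sqinter> y) \<squnion> (x \<sqinter> z)"
  show "x \<sqinter> (y \<squnion> z) = ?b"
  proof (rule le_antisym)
    have "x \<sqinter> (y \<squnion> z) \<sqsubseteq> e x y z" unfolding e_def by (simp_all add: join_le_iff le_meet_iff word_intros)
    moreover have "d x y z \<sqsubseteq> ?b \<squnion> (y \<sqinter> z)" unfolding d_def by (simp_all add: join_le_iff le_meet_iff word_intros)
    moreover have "e x y z \<in> carrier L" unfolding e_def by simp
    ultimately have "x \<sqinter> (y \<squnion> z) \<sqsubseteq> (?b \<squnion> (y \<sqinter> z)) \<sqinter> x"
      using ed le_trans[of "x \<sqinter> (y \<squnion> z)" "e x y z" "?b \<squnion> (y \<sqinter> z)"] by (simp_all add: join_le_iff le_meet_iff word_intros)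
    also have "(?b \<squnion> (y \<sqinter> z)) \<sqinter> x = ?b \<squnion> ((y \<sqinter> z) \<sqinter> x)"
    proof -
      have "?b \<sqsubseteq> x" by (simp_all add: join_le_iff le_meet_iff word_intros)
      then show ?thesis using mod unfolding modular_def by simp
    qed
    also have "\<dots> \<sqsubseteq> ?b" by (simp_all add: join_le_iff le_meet_iff word_intros)
    finally show "x \<sqinter> (y \<squnion> z) \<sqsubseteq> ?b" by simp
    show "?b \<sqsubseteq> x \<sqinter> (y \<squnion> z)" by (simp_all add: join_le_iff le_meet_iff word_intros)
  qed simp_all
qed

text \<open>The members of a variety are not confined to one type, whereas the universal property of a free
lattice speaks of lattices over its own type only. The three elements \<open>p\<close>, \<open>q\<close>, \<open>r\<close> that witness
non-distributivity generate a countable sublattice, which has a copy over each infinite type.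
It is bounded by \<open>p \<sqinter> q\<close> and \<open>p \<squnion> q\<close>.\<close>

lemma nondistributive_variety_witness:
  fixes K :: "'k gorder"
  assumes var: "in_variety \<Sigma> K" and "\<not> distributive_lattice K" and inf: "infinite (UNIV :: 'f set)"
  obtains L :: "'f gorder" and p q r where "in_variety \<Sigma> L" "bounded_lattice L"
    "p \<in> carrier L" "q \<in> carrier L" "r \<in> carrier L"
    "p \<sqinter>\<^bsub>L\<^esub> q = \<bottom>\<^bsub>L\<^esub>" "p \<squnion>\<^bsub>L\<^esub> q = \<top>\<^bsub>L\<^esub>" "r \<sqinter>\<^bsub>L\<^esub> q = \<bottom>\<^bsub>L\<^esub>" "r \<squnion>\<^bsub>L\<^esub> q = \<top>\<^bsub>L\<^esub>"
    "\<not> r \<sqsubseteq>\<^bsub>L\<^esub> p"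
proof -
  interpret K: lattice K using var by (simp add: in_variety_def)
  obtain p q r where pqr: "p \<in> carrier K" "q \<in> carrier K" "r \<in> carrier K"
    and eq: "p \<sqinter>\<^bsub>K\<^esub> q = r \<sqinter>\<^bsub>K\<^esub> q" "p \<squnion>\<^bsub>K\<^esub> q = r \<squnion>\<^bsub>K\<^esub> q" and nle: "\<not> r \<sqsubseteq>\<^bsub>K\<^esub> p"
  proof -
    obtain p q r where pqr: "p \<in> carrier K" "q \<in> carrier K" "r \<in> carrier K"
      and eq: "p \<sqinter>\<^bsub>K\<^esub> q = r \<sqinter>\<^bsub>K\<^esub> q" "p \<squnion>\<^bsub>K\<^esub> q = r \<squnion>\<^bsub>K\<^esub> q" and "p \<noteq> r"
      using K.distributive_if_complements_unique assms(2) by blast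
    \<comment> \<open>Distinct elements are not comparable in both directions, and \<open>p\<close> and \<open>r\<close> play symmetric roles.\<close>
    show thesis
    proof (cases "r \<sqsubseteq>\<^bsub>K\<^esub> p")
      case True
      then have "\<not> p \<sqsubseteq>\<^bsub>K\<^esub> r" using K.le_antisym pqr \<open>p \<noteq> r\<close> by blast
      then show thesis using that[of r q p] pqr eq by simp
    next
      case False
      then show thesis using that[of p q r] pqr eq by simp
    qed
  qed
  define G where "G = lat_gen K {p, q, r}"
  have G: "G \<subseteq> carrier K" unfolding G_def using pqr by (intro lat_gen_subset_carrier K.lattice_axioms) simp
  have "countable G" unfolding G_def by (intro countable_lat_gen) simp
  moreover obtain g :: "nat \<Rightarrow> 'f" where g: "inj g" using infinite_countable_subset[OF inf] by blast
  ultimately have inj: "inj_on (g \<circ> to_nat_on G) G"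
    by (intro comp_inj_on inj_on_to_nat_on) (auto intro: inj_on_subset)
  define \<iota> where "\<iota> = g \<circ> to_nat_on G"
  define C where "C = \<iota> ` G"
  define \<kappa> where "\<kappa> = inv_into G \<iota>"
  have \<kappa>\<iota>: "\<kappa> (\<iota> x) = x" if "x \<in> G" for x
    unfolding \<kappa>_def \<iota>_def by (rule inv_into_f_f[OF inj that])
  have \<kappa>C: "\<kappa> ` C = G" unfolding C_def using \<kappa>\<iota> by (force simp: image_image)
  have inj\<kappa>: "inj_on \<kappa> C" unfolding C_def using \<kappa>\<iota> by (auto intro!: inj_onI)
  define L where "L = pullback_order K C \<kappa>"
  have hom: "\<kappa> \<in> lattice_hom L K"
    unfolding L_def
  proof (rule pullback_lattice_hom[OF K.lattice_axioms inj\<kappa>])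
    show "\<kappa> ` C \<subseteq> carrier K" using \<kappa>C G by simp
    show "\<kappa> x \<squnion>\<^bsub>K\<^esub> \<kappa> y \<in> \<kappa> ` C" "\<kappa> x \<sqinter>\<^bsub>K\<^esub> \<kappa> y \<in> \<kappa> ` C" if "x \<in> C" "y \<in> C" for x y
      using that \<kappa>C unfolding G_def by (auto intro: lat_gen.join lat_gen.meet)
  qed
  have L: "in_variety \<Sigma> L"
    by (rule in_variety_embedding[OF hom _ var]) (simp add: L_def inj\<kappa>)
  interpret L: lattice L using L by (simp add: in_variety_def)
  have bounds: "p \<sqinter>\<^bsub>K\<^esub> q \<sqsubseteq>\<^bsub>K\<^esub> x \<and> x \<sqsubseteq>\<^bsub>K\<^esub> p \<squnion>\<^bsub>K\<^esub> q" if "x \<in> G" for x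
    using that unfolding G_def
  proof induction
    case (base x)
    then show ?case
      using pqr eq K.meet_left[of p q] K.meet_right[of p q] K.join_left[of p q] K.join_right[of p q]
        K.meet_left[of r q] K.join_left[of r q] by auto
  next
    case (join x y)
    then have "x \<in> carrier K" "y \<in> carrier K" using G unfolding G_def by auto
    then show ?case using join pqr by (auto intro: K.join_upper1 K.join_le)
  next
    case (meet x y)
    then have "x \<in> carrier K" "y \<in> carrier K" using G unfolding G_def by auto
    then show ?case using meet pqr by (auto intro: K.meet_lower1 K.meet_le)
  qed
  have pqrG: "p \<in> G" "q \<in> G" "r \<in> G" "p \<sqinter>\<^bsub>K\<^esub> q \<in> G" "p \<squnion>\<^bsub>K\<^esub> q \<in> G"
    unfolding G_def by (auto intro: lat_gen.intros)
  have \<iota>_join: "\<iota> x \<squnion>\<^bsub>L\<^esub> \<iota> y = \<iota> (x \<squnion>\<^bsub>K\<^esub> y)" and \<iota>_meet: "\<iota> x \<sqinter>\<^bsub>L\<^esub> \<iota> y = \<iota> (x \<sqinter>\<^bsub>K\<^esub> y)"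
    if "x \<in> G" "y \<in> G" for x y
  proof -
    have xy: "\<iota> x \<in> carrier L" "\<iota> y \<in> carrier L" using that by (simp_all add: L_def C_def)
    have cl: "x \<squnion>\<^bsub>K\<^esub> y \<in> G" "x \<sqinter>\<^bsub>K\<^esub> y \<in> G" using that unfolding G_def by (auto intro: lat_gen.intros)
    have "\<kappa> (\<iota> x \<squnion>\<^bsub>L\<^esub> \<iota> y) = \<kappa> (\<iota> (x \<squnion>\<^bsub>K\<^esub> y))" "\<kappa> (\<iota> x \<sqinter>\<^bsub>L\<^esub> \<iota> y) = \<kappa> (\<iota> (x \<sqinter>\<^bsub>K\<^esub> y))"
      using lattice_homD(4,5)[OF hom xy] \<kappa>\<iota> that cl by simp_all
    moreover have "\<iota> x \<squnion>\<^bsub>L\<^esub> \<iota> y \<in> C" "\<iota> x \<sqinter>\<^bsub>L\<^esub> \<iota> y \<in> C" using L.join_closed[OF xy] L.meet_closed[OF xy] by (simp_all add: L_def)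
    moreover have "\<iota> (x \<squnion>\<^bsub>K\<^esub> y) \<in> C" "\<iota> (x \<sqinter>\<^bsub>K\<^esub> y) \<in> C" using cl unfolding C_def by auto
    ultimately show "\<iota> x \<squnion>\<^bsub>L\<^esub> \<iota> y = \<iota> (x \<squnion>\<^bsub>K\<^esub> y)" "\<iota> x \<sqinter>\<^bsub>L\<^esub> \<iota> y = \<iota> (x \<sqinter>\<^bsub>K\<^esub> y)"
      using inj\<kappa> by (auto dest: inj_onD)
  qed
  have le: "\<iota> x \<sqsubseteq>\<^bsub>L\<^esub> \<iota> y \<longleftrightarrow> x \<sqsubseteq>\<^bsub>K\<^esub> y" if "x \<in> G" "y \<in> G" for x y
    using that \<kappa>\<iota> by (simp add: L_def)
  have carrier: "carrier L = \<iota> ` G" by (simp add: L_def C_def)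
  have bL: "bounded_lattice L" "\<bottom>\<^bsub>L\<^esub> = \<iota> (p \<sqinter>\<^bsub>K\<^esub> q)" "\<top>\<^bsub>L\<^esub> = \<iota> (p \<squnion>\<^bsub>K\<^esub> q)"
    by (rule bounded_latticeI[of L "\<iota> (p \<sqinter>\<^bsub>K\<^esub> q)" "\<iota> (p \<squnion>\<^bsub>K\<^esub> q)"];
        use L.lattice_axioms carrier pqrG le bounds in auto)+
  show thesis
  proof (rule that[OF L bL(1), of "\<iota> p" "\<iota> q" "\<iota> r"])
    show "\<iota> p \<in> carrier L" "\<iota> q \<in> carrier L" "\<iota> r \<in> carrier L" using carrier pqrG by auto
    show "\<iota> p \<sqinter>\<^bsub>L\<^esub> \<iota> q = \<bottom>\<^bsub>L\<^esub>" "\<iota> p \<squnion>\<^bsub>L\<^esub> \<iota> q = \<top>\<^bsub>L\<^esub>" "\<iota> r \<sqinter>\<^bsub>L\<^esub> \<iota> q = \<bottom>\<^bsub>L\<^esub>" "\<iota> r \<squnion>\<^bsub>L\<^esub> \<iota> q = \<top>\<^bsub>L\<^esub>"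
      using bL pqrG eq by (simp_all add: \<iota>_join \<iota>_meet)
    show "\<not> \<iota> r \<sqsubseteq>\<^bsub>L\<^esub> \<iota> p" using le pqrG nle by simp
  qed
qed

section \<open>Free lattices\<close>

text \<open>A common form of the two universal properties. In a free bounded lattice \<open>u\<close> and \<open>v\<close> are the
bounds. In a free lattice they are two of the generators, set aside so that a homomorphism to a
bounded lattice can send them to the bounds.\<close>

locale lattice_free_over =
  fixes \<Sigma> :: "(lat_term \<times> lat_term) set" and F :: "'f gorder" and u v :: 'f and S :: "'f set"
  assumes lattice: "lattice F"
    and S: "S \<subseteq> carrier F" and u: "u \<in> carrier F" and v: "v \<in> carrier F"
    and generated: "carrier F \<subseteq> lat_gen F (S \<union> {u, v})"
    and extend: "\<And>(L :: 'f gorder) g. \<lbrakk>in_variety \<Sigma> L; bounded_lattice L; g \<in> S \<rightarrow> carrier L\<rbrakk>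
      \<Longrightarrow> \<exists>h \<in> lattice_hom F L. h u = \<bottom>\<^bsub>L\<^esub> \<and> h v = \<top>\<^bsub>L\<^esub> \<and> (\<forall>x\<in>S. h x = g x)"

lemma free_lattice_inD:
  fixes F L :: "'f gorder"
  assumes "free_lattice_in \<Sigma> F S" "in_variety \<Sigma> L" "g \<in> S \<rightarrow> carrier L"
  shows "\<exists>!h. h \<in> carrier F \<rightarrow>\<^sub>E carrier L \<and> h \<in> lattice_hom F L \<and> (\<forall>x\<in>S. h x = g x)"
  using assms unfolding free_lattice_in_def by (elim conjE allE[of _ L] impE bspec)

lemma free_bounded_lattice_inD:
  fixes F L :: "'f gorder"
  assumes "free_bounded_lattice_in \<Sigma> F S" "in_variety \<Sigma> L" "bounded_lattice L" "g \<in> S \<rightarrow> carrier L"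
  shows "\<exists>!h. h \<in> carrier F \<rightarrow>\<^sub>E carrier L \<and> h \<in> bounded_lattice_hom F L \<and> (\<forall>x\<in>S. h x = g x)"
  using assms unfolding free_bounded_lattice_in_def by (elim conjE allE[of _ L] impE bspec conjI)

lemma lattice_hom_restrict:
  assumes "h \<in> lattice_hom L K"
  shows "restrict h (carrier L) \<in> lattice_hom L K"
proof -
  interpret L: lattice L by (rule lattice_homD[OF assms])
  show ?thesis by (rule lattice_homI) (simp_all add: lattice_homD[OF assms])
qed

lemma sublattice_inclusion:
  assumes L: "lattice L" and G: "G \<subseteq> carrier L"
    and cl: "\<And>x y. \<lbrakk>x \<in> G; y \<in> G\<rbrakk> \<Longrightarrow> x \<squnion>\<^bsub>L\<^esub> y \<in> G" "\<And>x y. \<lbrakk>x \<in> G; y \<in> G\<rbrakk> \<Longrightarrow> x \<sqinter>\<^bsub>L\<^esub> y \<in> G"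
    and h: "h \<in> lattice_hom M (pullback_order L G (\<lambda>x. x))"
  shows "(\<lambda>x. x) \<in> lattice_hom (pullback_order L G (\<lambda>x. x)) L" "h \<in> lattice_hom M L"
proof -
  show *: "(\<lambda>x. x) \<in> lattice_hom (pullback_order L G (\<lambda>x. x)) L"
    by (rule pullback_lattice_hom[OF L]) (use G cl in auto)
  show "h \<in> lattice_hom M L"
  proof (rule lattice_homI[OF lattice_homD(1)[OF h] L])
    fix x y assume xy: "x \<in> carrier M" "y \<in> carrier M"
    show "h x \<in> carrier L" using lattice_homD(3)[OF h xy(1)] G by auto
    show "h (x \<squnion>\<^bsub>M\<^esub> y) = h x \<squnion>\<^bsub>L\<^esub> h y"
      using lattice_homD(4)[OF h xy] lattice_homD(4)[OF *, of "h x" "h y"] lattice_homD(3)[OF h] xy by simp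
    show "h (x \<sqinter>\<^bsub>M\<^esub> y) = h x \<sqinter>\<^bsub>L\<^esub> h y"
      using lattice_homD(5)[OF h xy] lattice_homD(5)[OF *, of "h x" "h y"] lattice_homD(3)[OF h] xy by simp
  qed
qed

lemma lattice_hom_id: "lattice L \<Longrightarrow> (\<lambda>x. x) \<in> lattice_hom L L"
  by (rule lattice_homI) auto

text \<open>The sublattice \<open>P\<close> generated by \<open>S\<close> belongs to the variety. A homomorphism to \<open>P\<close> that fixes
\<open>S\<close> is also an endomorphism of \<open>F\<close>, and therefore the identity by uniqueness.\<close>

lemma free_lattice_generated:
  fixes F :: "'f gorder"
  assumes free: "free_lattice_in \<Sigma> F S"
  shows "carrier F \<subseteq> lat_gen F S"
proof
  have var: "in_variety \<Sigma> F" and S: "S \<subseteq> carrier F" using free by (simp_all add: free_lattice_in_def)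
  have F: "lattice F" using var by (simp add: in_variety_def)
  define P where "P = pullback_order F (lat_gen F S) (\<lambda>x. x)"
  note cl = lat_gen_subset_carrier[OF F S] lat_gen.join[of _ F S] lat_gen.meet[of _ F S]
  have incl: "(\<lambda>x. x) \<in> lattice_hom P F"
    unfolding P_def by (rule pullback_lattice_hom[OF F]) (use cl in auto)
  have "in_variety \<Sigma> P" by (rule in_variety_embedding[OF incl _ var]) simp
  moreover have "(\<lambda>x. x) \<in> S \<rightarrow> carrier P" by (simp add: P_def lat_gen.base)
  ultimately obtain h where h: "h \<in> carrier F \<rightarrow>\<^sub>E carrier P" "h \<in> lattice_hom F P" "\<forall>x\<in>S. h x = x"
    using ex1_implies_ex[OF free_lattice_inD[OF free]] by blast
  have hF: "h \<in> lattice_hom F F"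
    using sublattice_inclusion(2)[OF F cl] h(2) unfolding P_def by blast
  have hE: "h \<in> carrier F \<rightarrow>\<^sub>E carrier F" using h(1) cl(1) by (auto simp: P_def PiE_def)
  have "(\<lambda>x. x) \<in> S \<rightarrow> carrier F" using S by auto
  then have uniq: "\<exists>!h. h \<in> carrier F \<rightarrow>\<^sub>E carrier F \<and> h \<in> lattice_hom F F \<and> (\<forall>x\<in>S. h x = x)"
    by (rule free_lattice_inD[OF free var])
  have "restrict (\<lambda>x. x) (carrier F) \<in> carrier F \<rightarrow>\<^sub>E carrier F \<and>
      restrict (\<lambda>x. x) (carrier F) \<in> lattice_hom F F \<and> (\<forall>x\<in>S. restrict (\<lambda>x. x) (carrier F) x = x)"
    using lattice_hom_restrict[OF lattice_hom_id[OF F]] S by auto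
  then have h_id: "h = restrict (\<lambda>x. x) (carrier F)"
    using Uniq_D[OF conjunct2[OF iffD1[OF ex1_iff_ex_Uniq uniq]]] hE hF h(3) by simp
  fix w assume w: "w \<in> carrier F"
  then have "h w \<in> lat_gen F S" using h(1) by (auto simp: P_def)
  then show "w \<in> lat_gen F S" using h_id w by simp
qed

lemma free_bounded_lattice_generated:
  fixes F :: "'f gorder"
  assumes free: "free_bounded_lattice_in \<Sigma> F S"
  shows "carrier F \<subseteq> lat_gen F (S \<union> {\<bottom>\<^bsub>F\<^esub>, \<top>\<^bsub>F\<^esub>})"
proof
  have var: "in_variety \<Sigma> F" and bF: "bounded_lattice F" and "S \<subseteq> carrier F"
    using free by (simp_all add: free_bounded_lattice_in_def)
  interpret F: bounded_lattice F by fact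
  note F = F.lattice_axioms
  define T where "T = S \<union> {\<bottom>\<^bsub>F\<^esub>, \<top>\<^bsub>F\<^esub>}"
  have T: "T \<subseteq> carrier F" using \<open>S \<subseteq> carrier F\<close> by (simp add: T_def)
  define P where "P = pullback_order F (lat_gen F T) (\<lambda>x. x)"
  note cl = lat_gen_subset_carrier[OF F T] lat_gen.join[of _ F T] lat_gen.meet[of _ F T]
  have incl: "(\<lambda>x. x) \<in> lattice_hom P F"
    unfolding P_def by (rule pullback_lattice_hom[OF F]) (use cl in auto)
  have "in_variety \<Sigma> P" by (rule in_variety_embedding[OF incl _ var]) simp
  moreover have bT: "\<bottom>\<^bsub>F\<^esub> \<in> lat_gen F T" "\<top>\<^bsub>F\<^esub> \<in> lat_gen F T" by (auto simp: T_def intro: lat_gen.base)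
  have P: "bounded_lattice P" "\<bottom>\<^bsub>P\<^esub> = \<bottom>\<^bsub>F\<^esub>" "\<top>\<^bsub>P\<^esub> = \<top>\<^bsub>F\<^esub>"
    by (rule bounded_latticeI[OF lattice_homD(1)[OF incl], of "\<bottom>\<^bsub>F\<^esub>" "\<top>\<^bsub>F\<^esub>"];
        use bT cl(1) F.bottom_lower F.top_higher in \<open>auto simp: P_def\<close>)+
  moreover have "(\<lambda>x. x) \<in> S \<rightarrow> carrier P" by (simp add: P_def T_def lat_gen.base)
  ultimately obtain h where h: "h \<in> carrier F \<rightarrow>\<^sub>E carrier P" "h \<in> bounded_lattice_hom F P" "\<forall>x\<in>S. h x = x"
    using ex1_implies_ex[OF free_bounded_lattice_inD[OF free _ P(1)]] by blast
  have hl: "h \<in> lattice_hom F P" and hb: "h \<bottom>\<^bsub>F\<^esub> = \<bottom>\<^bsub>F\<^esub>" "h \<top>\<^bsub>F\<^esub> = \<top>\<^bsub>F\<^esub>"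
    using h(2) P(2,3) by (simp_all add: bounded_lattice_hom_def)
  have "h \<in> lattice_hom F F"
    using sublattice_inclusion(2)[OF F cl] hl unfolding P_def by blast
  then have hF: "h \<in> bounded_lattice_hom F F" using hb by (simp add: bounded_lattice_hom_def)
  have hE: "h \<in> carrier F \<rightarrow>\<^sub>E carrier F" using h(1) cl(1) by (auto simp: P_def PiE_def)
  have "(\<lambda>x. x) \<in> S \<rightarrow> carrier F" using \<open>S \<subseteq> carrier F\<close> by auto
  then have uniq: "\<exists>!h. h \<in> carrier F \<rightarrow>\<^sub>E carrier F \<and> h \<in> bounded_lattice_hom F F \<and> (\<forall>x\<in>S. h x = x)"
    by (rule free_bounded_lattice_inD[OF free var bF])
  have "restrict (\<lambda>x. x) (carrier F) \<in> carrier F \<rightarrow>\<^sub>E carrier F \<and>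
      restrict (\<lambda>x. x) (carrier F) \<in> bounded_lattice_hom F F \<and> (\<forall>x\<in>S. restrict (\<lambda>x. x) (carrier F) x = x)"
    using lattice_hom_restrict[OF lattice_hom_id[OF F]] \<open>S \<subseteq> carrier F\<close> by (auto simp: bounded_lattice_hom_def)
  then have h_id: "h = restrict (\<lambda>x. x) (carrier F)"
    using Uniq_D[OF conjunct2[OF iffD1[OF ex1_iff_ex_Uniq uniq]]] hE hF h(3) by simp
  fix w assume w: "w \<in> carrier F"
  then have "h w \<in> lat_gen F T" using h(1) by (auto simp: P_def)
  then show "w \<in> lat_gen F (S \<union> {\<bottom>\<^bsub>F\<^esub>, \<top>\<^bsub>F\<^esub>})" using h_id w by (simp add: T_def)
qed

lemma infinite_if_at_least_aleph2: "at_least_aleph2 S \<Longrightarrow> infinite S"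
proof
  assume "at_least_aleph2 S" "finite S"
  have co: "Card_order (cardSuc natLeq)" by (rule cardSuc_Card_order[OF natLeq_Card_order])
  have "(card_of (Field (cardSuc (cardSuc natLeq))), card_of S) \<in> ordLeq"
    using \<open>at_least_aleph2 S\<close> ordIso_ordLeq_trans[OF card_of_Field_ordIso[OF cardSuc_Card_order[OF co]]]
    unfolding at_least_aleph2_def by blast
  then have "finite (Field (cardSuc (cardSuc natLeq)))"
    using card_of_ordLeq_finite \<open>finite S\<close> by blast
  then show False using cardSuc_finite[OF co] cardSuc_finite[OF natLeq_Card_order] Field_natLeq by simp
qed

lemma at_least_aleph2_Diff_finite:
  assumes S: "at_least_aleph2 S" and X: "finite X"
  shows "at_least_aleph2 (S - X)"
proof -
  have inf: "infinite (S - X)" using infinite_if_at_least_aleph2[OF S] X by (metis finite_Diff2)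
  have "(card_of ((S - X) \<union> X), card_of (S - X)) \<in> ordLeq"
  proof (rule card_of_Un_ordLeq_infinite_Field)
    show "(card_of X, card_of (S - X)) \<in> ordLeq"
      using X inf by (intro ordLess_imp_ordLeq finite_ordLess_infinite)
        (auto simp: Field_card_of card_of_well_order_on)
  qed (simp_all add: Field_card_of inf card_of_mono1 card_of_card_order_on)
  moreover have "(card_of S, card_of ((S - X) \<union> X)) \<in> ordLeq" by (rule card_of_mono1) auto
  ultimately show ?thesis
    using S ordLeq_transitive unfolding at_least_aleph2_def by blast
qed

lemma free_lattice_free_over:
  fixes F :: "'f gorder"
  assumes free: "free_lattice_in \<Sigma> F S" and S: "at_least_aleph2 S"
  obtains u v S' where "lattice_free_over \<Sigma> F u v S'" "at_least_aleph2 S'"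
proof -
  have var: "in_variety \<Sigma> F" and SF: "S \<subseteq> carrier F" using free by (simp_all add: free_lattice_in_def)
  obtain u where u: "u \<in> S" using infinite_if_at_least_aleph2[OF S] by (metis finite.emptyI equals0I)
  have "infinite (S - {u})" using infinite_if_at_least_aleph2[OF S] by simp
  then obtain v where v: "v \<in> S - {u}" by (metis finite.emptyI equals0I)
  define S' where "S' = S - {u, v}"
  have SS': "S' \<union> {u, v} = S" using u v by (auto simp: S'_def)
  have "lattice_free_over \<Sigma> F u v S'"
  proof (rule lattice_free_over.intro)
    show "lattice F" using var by (simp add: in_variety_def)
    show "S' \<subseteq> carrier F" "u \<in> carrier F" "v \<in> carrier F" using SF u v by (auto simp: S'_def)
    show "carrier F \<subseteq> lat_gen F (S' \<union> {u, v})" using free_lattice_generated[OF free] SS' by simp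
    fix L :: "'f gorder" and g
    assume L: "in_variety \<Sigma> L" "bounded_lattice L" and g: "g \<in> S' \<rightarrow> carrier L"
    interpret bounded_lattice L by fact
    define g' where "g' = g(u := \<bottom>\<^bsub>L\<^esub>, v := \<top>\<^bsub>L\<^esub>)"
    have "g' \<in> S \<rightarrow> carrier L" using g unfolding g'_def S'_def by (auto simp: Pi_iff)
    then obtain h where "h \<in> lattice_hom F L" "\<forall>x\<in>S. h x = g' x"
      using ex1_implies_ex[OF free_lattice_inD[OF free L(1)]] by blast
    then show "\<exists>h \<in> lattice_hom F L. h u = \<bottom>\<^bsub>L\<^esub> \<and> h v = \<top>\<^bsub>L\<^esub> \<and> (\<forall>x\<in>S'. h x = g x)"
      using u v by (intro bexI[of _ h]) (auto simp: g'_def S'_def)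
  qed
  moreover have "at_least_aleph2 S'" unfolding S'_def by (rule at_least_aleph2_Diff_finite[OF S]) simp
  ultimately show thesis by (rule that)
qed

lemma free_bounded_lattice_free_over:
  fixes F :: "'f gorder"
  assumes free: "free_bounded_lattice_in \<Sigma> F S"
  shows "lattice_free_over \<Sigma> F \<bottom>\<^bsub>F\<^esub> \<top>\<^bsub>F\<^esub> S"
proof (rule lattice_free_over.intro)
  have bF: "bounded_lattice F" using free by (simp add: free_bounded_lattice_in_def)
  interpret F: bounded_lattice F by fact
  show "lattice F" by (rule F.lattice_axioms)
  show "S \<subseteq> carrier F" using free by (simp add: free_bounded_lattice_in_def)
  show "\<bottom>\<^bsub>F\<^esub> \<in> carrier F" "\<top>\<^bsub>F\<^esub> \<in> carrier F" by simp_all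
  show "carrier F \<subseteq> lat_gen F (S \<union> {\<bottom>\<^bsub>F\<^esub>, \<top>\<^bsub>F\<^esub>})" by (rule free_bounded_lattice_generated[OF free])
  fix L :: "'f gorder" and g
  assume "in_variety \<Sigma> L" "bounded_lattice L" "g \<in> S \<rightarrow> carrier L"
  then obtain h where "h \<in> bounded_lattice_hom F L" "\<forall>x\<in>S. h x = g x"
    using ex1_implies_ex[OF free_bounded_lattice_inD[OF free]] by blast
  then show "\<exists>h \<in> lattice_hom F L. h \<bottom>\<^bsub>F\<^esub> = \<bottom>\<^bsub>L\<^esub> \<and> h \<top>\<^bsub>F\<^esub> = \<top>\<^bsub>L\<^esub> \<and> (\<forall>x\<in>S. h x = g x)"
    by (intro bexI[of _ h]) (auto simp: bounded_lattice_hom_def)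
qed

section \<open>Congruences of free lattices\<close>

text \<open>In \<open>L\<close> the element \<open>q\<close> has the two complements \<open>p\<close> and \<open>r\<close>.\<close>

locale free_lattice_with_complements = lattice_free_over \<Sigma> F u v S + L: bounded_lattice L
  for \<Sigma> and F :: "'f gorder" and u v S and L :: "'f gorder" +
  fixes p q r
  assumes variety: "in_variety \<Sigma> L"
    and pqr [simp]: "p \<in> carrier L" "q \<in> carrier L" "r \<in> carrier L"
    and pq [simp]: "p \<sqinter>\<^bsub>L\<^esub> q = \<bottom>\<^bsub>L\<^esub>" "p \<squnion>\<^bsub>L\<^esub> q = \<top>\<^bsub>L\<^esub>"
    and rq [simp]: "r \<sqinter>\<^bsub>L\<^esub> q = \<bottom>\<^bsub>L\<^esub>" "r \<squnion>\<^bsub>L\<^esub> q = \<top>\<^bsub>L\<^esub>"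
    and not_le: "\<not> r \<sqsubseteq>\<^bsub>L\<^esub> p"
begin

sublocale Con: algebraic_closure_system "{\<theta>. lattice_congruence F \<theta>}" "carrier F \<times> carrier F"
  by (rule closure_system_Con[OF lattice])

lemma bounds_distinct: "\<bottom>\<^bsub>L\<^esub> \<noteq> \<top>\<^bsub>L\<^esub>"
proof
  assume "\<bottom>\<^bsub>L\<^esub> = \<top>\<^bsub>L\<^esub>"
  then have "r \<sqsubseteq>\<^bsub>L\<^esub> \<bottom>\<^bsub>L\<^esub>" using L.top_higher[OF pqr(3)] by simp
  then show False using not_le L.le_trans[OF _ L.bottom_lower[OF pqr(1)]] by simp
qed

definition ext :: "('f \<Rightarrow> 'f) \<Rightarrow> 'f \<Rightarrow> 'f"
  where "ext g = (SOME h. h \<in> lattice_hom F L \<and> h u = \<bottom>\<^bsub>L\<^esub> \<and> h v = \<top>\<^bsub>L\<^esub> \<and> (\<forall>x\<in>S. h x = g x))"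

lemma ext:
  assumes "\<And>x. g x \<in> carrier L"
  shows "ext g \<in> lattice_hom F L" "ext g u = \<bottom>\<^bsub>L\<^esub>" "ext g v = \<top>\<^bsub>L\<^esub>" "x \<in> S \<Longrightarrow> ext g x = g x"
proof -
  have "\<exists>h. h \<in> lattice_hom F L \<and> h u = \<bottom>\<^bsub>L\<^esub> \<and> h v = \<top>\<^bsub>L\<^esub> \<and> (\<forall>x\<in>S. h x = g x)"
    using extend[OF variety L.bounded_lattice_axioms, of g] assms by auto
  from someI_ex[OF this]
  show "ext g \<in> lattice_hom F L" "ext g u = \<bottom>\<^bsub>L\<^esub>" "ext g v = \<top>\<^bsub>L\<^esub>" "x \<in> S \<Longrightarrow> ext g x = g x"
    unfolding ext_def by auto
qed

text \<open>Locality: the value at \<open>w\<close> depends only on the images of the generators that occur in \<open>w\<close>.\<close>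

lemma ext_local:
  assumes g: "\<And>x. g x \<in> carrier L" and g': "\<And>x. g' x \<in> carrier L" and X: "X \<subseteq> S"
    and eq: "\<And>x. x \<in> X \<Longrightarrow> g x = g' x" and w: "w \<in> lat_gen F (X \<union> {u, v})"
  shows "ext g w = ext g' w"
proof (rule lattice_hom_eq_on_lat_gen[OF ext(1)[of g, OF g] ext(1)[of g', OF g'] _ _ w])
  show "X \<union> {u, v} \<subseteq> carrier F" using X S u v by auto
  show "ext g x = ext g' x" if "x \<in> X \<union> {u, v}" for x
    using that X eq[of x] ext(2-4)[of g, OF g] ext(2-4)[of g', OF g'] by auto
qed

lemma carrier_induct [consumes 1, case_names u v gen join meet]:
  assumes "w \<in> carrier F" "P u" "P v" "\<And>x. x \<in> S \<Longrightarrow> P x"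
    and "\<And>x y. \<lbrakk>x \<in> carrier F; y \<in> carrier F; P x; P y\<rbrakk> \<Longrightarrow> P (x \<squnion>\<^bsub>F\<^esub> y)"
    and "\<And>x y. \<lbrakk>x \<in> carrier F; y \<in> carrier F; P x; P y\<rbrakk> \<Longrightarrow> P (x \<sqinter>\<^bsub>F\<^esub> y)"
  shows "P w"
proof -
  have sub: "lat_gen F (S \<union> {u, v}) \<subseteq> carrier F"
    using S u v by (intro lat_gen_subset_carrier lattice) auto
  have "w \<in> lat_gen F (S \<union> {u, v})" using assms(1) generated by blast
  then show ?thesis
  proof induction
    case (base x) then show ?case using assms(2-4) by auto
  next
    case (join x y) then show ?case using sub by (intro assms(5)) auto
  next
    case (meet x y) then show ?case using sub by (intro assms(6)) auto
  qed
qed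

abbreviation ker :: "('f \<Rightarrow> 'f) \<Rightarrow> ('f \<times> 'f) set"
  where "ker h \<equiv> {(x, y) \<in> carrier F \<times> carrier F. h x = h y}"

lemma ker: "(\<And>x. g x \<in> carrier L) \<Longrightarrow> lattice_congruence F (ker (ext g))"
  using lattice_congruence_kernel[OF ext(1)] by blast

text \<open>The principal congruence \<open>\<Theta>(x, y)\<close>.\<close>

definition cg :: "'f \<Rightarrow> 'f \<Rightarrow> ('f \<times> 'f) set"
  where "cg x y = Con.cl {(x, y)}"

lemma cg:
  assumes "x \<in> carrier F" "y \<in> carrier F"
  shows "lattice_congruence F (cg x y)" "cg x y \<in> compact_elements Con.L" "(x, y) \<in> cg x y"
    "\<lbrakk>lattice_congruence F \<theta>; (x, y) \<in> \<theta>\<rbrakk> \<Longrightarrow> cg x y \<subseteq> \<theta>"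
proof -
  have sub: "{(x, y)} \<subseteq> carrier F \<times> carrier F" using assms by simp
  show "lattice_congruence F (cg x y)" using Con.cl_mem[OF sub] by (simp add: cg_def)
  show "cg x y \<in> compact_elements Con.L" unfolding cg_def by (rule Con.compact_cl[OF _ sub]) simp
  show "(x, y) \<in> cg x y" unfolding cg_def by (rule hull_inc) simp
  show "\<lbrakk>lattice_congruence F \<theta>; (x, y) \<in> \<theta>\<rbrakk> \<Longrightarrow> cg x y \<subseteq> \<theta>"
    unfolding cg_def by (rule hull_minimal) simp_all
qed

lemma join_Con:
  assumes "lattice_congruence F \<alpha>" "lattice_congruence F \<beta>"
  shows "lattice_congruence F (\<alpha> \<squnion>\<^bsub>Con.L\<^esub> \<beta>)" "\<alpha> \<subseteq> \<alpha> \<squnion>\<^bsub>Con.L\<^esub> \<beta>" "\<beta> \<subseteq> \<alpha> \<squnion>\<^bsub>Con.L\<^esub> \<beta>"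
    "\<lbrakk>lattice_congruence F \<theta>; \<alpha> \<subseteq> \<theta>; \<beta> \<subseteq> \<theta>\<rbrakk> \<Longrightarrow> \<alpha> \<squnion>\<^bsub>Con.L\<^esub> \<beta> \<subseteq> \<theta>"
proof -
  have eq: "\<alpha> \<squnion>\<^bsub>Con.L\<^esub> \<beta> = Con.cl (\<alpha> \<union> \<beta>)" using assms by (simp add: Con.join_eq)
  show "lattice_congruence F (\<alpha> \<squnion>\<^bsub>Con.L\<^esub> \<beta>)"
    unfolding eq using Con.cl_mem[of "\<alpha> \<union> \<beta>"] assms lattice_congruenceD(1) by auto
  show "\<alpha> \<subseteq> \<alpha> \<squnion>\<^bsub>Con.L\<^esub> \<beta>" "\<beta> \<subseteq> \<alpha> \<squnion>\<^bsub>Con.L\<^esub> \<beta>"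
    unfolding eq using hull_subset[of "\<alpha> \<union> \<beta>" "\<lambda>N. N \<in> {\<theta>. lattice_congruence F \<theta>}"] by auto
  show "\<lbrakk>lattice_congruence F \<theta>; \<alpha> \<subseteq> \<theta>; \<beta> \<subseteq> \<theta>\<rbrakk> \<Longrightarrow> \<alpha> \<squnion>\<^bsub>Con.L\<^esub> \<beta> \<subseteq> \<theta>"
    unfolding eq by (rule hull_minimal) simp_all
qed

text \<open>If \<open>x\<close> goes to \<open>\<bottom>\<close> and \<open>y\<close> to \<open>\<top>\<close>, then the first of \<open>\<Theta>(u, x)\<close> and \<open>\<Theta>(u, y)\<close> is collapsed, but not the
second.\<close>

lemma inj_on_cg: "inj_on (cg u) S"
proof (rule inj_onI, rule ccontr)
  fix x y assume xy: "x \<in> S" "y \<in> S" "cg u x = cg u y" "x \<noteq> y"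
  then have F: "x \<in> carrier F" "y \<in> carrier F" using S by auto
  define g where "g w = (if w = y then \<top>\<^bsub>L\<^esub> else \<bottom>\<^bsub>L\<^esub>)" for w
  have g: "g w \<in> carrier L" for w by (simp add: g_def)
  note ext_g = ext[of g, OF g]
  have "(u, x) \<in> ker (ext g)" using ext_g(2) ext_g(4)[OF xy(1)] xy(4) u F by (simp add: g_def)
  then have "cg u x \<subseteq> ker (ext g)" using cg(4)[OF u F(1) ker[of g, OF g]] by blast
  then have "(u, y) \<in> ker (ext g)" using cg(3)[OF u F(2)] xy(3) by auto
  then show False using ext_g(2) ext_g(4)[OF xy(2)] bounds_distinct by (simp add: g_def)
qed

lemma card_compact_elements:
  assumes "at_least_aleph2 S"
  shows "at_least_aleph2 (compact_elements (Con F))"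
proof -
  have "(card_of S, card_of (compact_elements (Con F))) \<in> ordLeq"
  proof (rule card_of_ordLeqI[OF inj_on_cg])
    show "cg u x \<in> compact_elements (Con F)" if "x \<in> S" for x
      using cg(2)[OF u, of x] that S unfolding Con_def by blast
  qed
  then show ?thesis using assms ordLeq_transitive unfolding at_least_aleph2_def by blast
qed

definition two_values :: "'f \<Rightarrow> 'f \<Rightarrow> 'f \<Rightarrow> 'f \<Rightarrow> 'f \<Rightarrow> 'f"
  where "two_values x a y b w = (if w = x then a else if w = y then b else \<bottom>\<^bsub>L\<^esub>)"

lemma two_values_closed: "\<lbrakk>a \<in> carrier L; b \<in> carrier L\<rbrakk> \<Longrightarrow> two_values x a y b w \<in> carrier L"
  by (simp add: two_values_def)

lemma bound_simps [simp]:
  assumes "a \<in> carrier L"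
  shows "\<bottom>\<^bsub>L\<^esub> \<squnion>\<^bsub>L\<^esub> a = a" "a \<squnion>\<^bsub>L\<^esub> \<bottom>\<^bsub>L\<^esub> = a" "\<top>\<^bsub>L\<^esub> \<squnion>\<^bsub>L\<^esub> a = \<top>\<^bsub>L\<^esub>" "a \<squnion>\<^bsub>L\<^esub> \<top>\<^bsub>L\<^esub> = \<top>\<^bsub>L\<^esub>"
    "\<bottom>\<^bsub>L\<^esub> \<sqinter>\<^bsub>L\<^esub> a = \<bottom>\<^bsub>L\<^esub>" "a \<sqinter>\<^bsub>L\<^esub> \<bottom>\<^bsub>L\<^esub> = \<bottom>\<^bsub>L\<^esub>" "\<top>\<^bsub>L\<^esub> \<sqinter>\<^bsub>L\<^esub> a = a" "a \<sqinter>\<^bsub>L\<^esub> \<top>\<^bsub>L\<^esub> = a"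
    "a \<squnion>\<^bsub>L\<^esub> a = a" "a \<sqinter>\<^bsub>L\<^esub> a = a"
proof -
  show 1: "\<bottom>\<^bsub>L\<^esub> \<squnion>\<^bsub>L\<^esub> a = a" "\<top>\<^bsub>L\<^esub> \<squnion>\<^bsub>L\<^esub> a = \<top>\<^bsub>L\<^esub>" "\<bottom>\<^bsub>L\<^esub> \<sqinter>\<^bsub>L\<^esub> a = \<bottom>\<^bsub>L\<^esub>" "\<top>\<^bsub>L\<^esub> \<sqinter>\<^bsub>L\<^esub> a = a"
    using L.bottom_join[OF assms] L.top_join[OF assms] L.bottom_meet[OF assms] L.top_meet[OF assms]
    by (simp_all add: L.eq_is_equal)
  then show "a \<squnion>\<^bsub>L\<^esub> \<bottom>\<^bsub>L\<^esub> = a" "a \<squnion>\<^bsub>L\<^esub> \<top>\<^bsub>L\<^esub> = \<top>\<^bsub>L\<^esub>" "a \<sqinter>\<^bsub>L\<^esub> \<bottom>\<^bsub>L\<^esub> = \<bottom>\<^bsub>L\<^esub>" "a \<sqinter>\<^bsub>L\<^esub> \<top>\<^bsub>L\<^esub> = a"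
    by (simp_all add: join_comm[of L a] meet_comm[of L a])
  show "a \<squnion>\<^bsub>L\<^esub> a = a" "a \<sqinter>\<^bsub>L\<^esub> a = a"
    using L.le_iff_meet[of a a] L.le_iff_join[of a a] assms by simp_all
qed

text \<open>Complementary elements \<open>a\<close>, \<open>b\<close> generate the sublattice \<open>{\<bottom>, a, b, \<top>}\<close>, a quotient of the square
of the two-element chain. Hence the map \<open>x \<mapsto> a\<close>, \<open>y \<mapsto> b\<close> is determined by the maps \<open>g2\<close>:
\<open>x \<mapsto> \<bottom>\<close>, \<open>y \<mapsto> \<top>\<close> and \<open>g1\<close>: \<open>x \<mapsto> \<top>\<close>, \<open>y \<mapsto> \<bottom>\<close>. The first map collapses one of the two given upper
bounds of \<open>\<theta>\<close>, the second map collapses the other.\<close>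

lemma collapsed_by_complements:
  assumes x: "x \<in> S" and y: "y \<in> S" and xy: "x \<noteq> y"
    and a: "a \<in> carrier L" and b: "b \<in> carrier L"
    and ab: "a \<sqinter>\<^bsub>L\<^esub> b = \<bottom>\<^bsub>L\<^esub>" "a \<squnion>\<^bsub>L\<^esub> b = \<top>\<^bsub>L\<^esub>"
    and \<theta>: "\<theta> \<subseteq> cg u x \<squnion>\<^bsub>Con.L\<^esub> cg y v" "\<theta> \<subseteq> cg x v \<squnion>\<^bsub>Con.L\<^esub> cg u y"
  shows "\<theta> \<subseteq> ker (ext (two_values x a y b))"
proof -
  have F: "x \<in> carrier F" "y \<in> carrier F" using x y S by auto
  have ba: "b \<sqinter>\<^bsub>L\<^esub> a = \<bottom>\<^bsub>L\<^esub>" "b \<squnion>\<^bsub>L\<^esub> a = \<top>\<^bsub>L\<^esub>"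
    using ab by (simp_all add: join_comm[of L b] meet_comm[of L b])
  define g where "g = two_values x a y b"
  define g1 where "g1 = two_values x \<top>\<^bsub>L\<^esub> y \<bottom>\<^bsub>L\<^esub>"
  define g2 where "g2 = two_values x \<bottom>\<^bsub>L\<^esub> y \<top>\<^bsub>L\<^esub>"
  have cl: "g w \<in> carrier L" "g1 w \<in> carrier L" "g2 w \<in> carrier L" for w
    using a b by (simp_all add: g_def g1_def g2_def two_values_closed)
  note E = ext[of g, OF cl(1)] and E1 = ext[of g1, OF cl(2)] and E2 = ext[of g2, OF cl(3)]
  have vals: "g x = a" "g y = b" "g1 x = \<top>\<^bsub>L\<^esub>" "g1 y = \<bottom>\<^bsub>L\<^esub>" "g2 x = \<bottom>\<^bsub>L\<^esub>" "g2 y = \<top>\<^bsub>L\<^esub>"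
    "\<And>w. \<lbrakk>w \<noteq> x; w \<noteq> y\<rbrakk> \<Longrightarrow> g w = \<bottom>\<^bsub>L\<^esub> \<and> g1 w = \<bottom>\<^bsub>L\<^esub> \<and> g2 w = \<bottom>\<^bsub>L\<^esub>"
    using xy by (simp_all add: g_def g1_def g2_def two_values_def)
  have "cg u x \<squnion>\<^bsub>Con.L\<^esub> cg y v \<subseteq> ker (ext g2)"
  proof (rule join_Con(4))
    show "cg u x \<subseteq> ker (ext g2)"
      by (rule cg(4)[OF u F(1) ker[of g2, OF cl(3)]]) (simp add: u F E2(2) E2(4)[OF x] vals)
    show "cg y v \<subseteq> ker (ext g2)"
      by (rule cg(4)[OF F(2) v ker[of g2, OF cl(3)]]) (simp add: v F E2(3) E2(4)[OF y] vals)
  qed (use cg(1) u v F ker[of g2, OF cl(3)] in auto)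
  then have k2: "\<theta> \<subseteq> ker (ext g2)" using \<theta>(1) by (rule subset_trans[rotated])
  have "cg x v \<squnion>\<^bsub>Con.L\<^esub> cg u y \<subseteq> ker (ext g1)"
  proof (rule join_Con(4))
    show "cg x v \<subseteq> ker (ext g1)"
      by (rule cg(4)[OF F(1) v ker[of g1, OF cl(2)]]) (simp add: v F E1(3) E1(4)[OF x] vals)
    show "cg u y \<subseteq> ker (ext g1)"
      by (rule cg(4)[OF u F(2) ker[of g1, OF cl(2)]]) (simp add: u F E1(2) E1(4)[OF y] vals)
  qed (use cg(1) u v F ker[of g1, OF cl(2)] in auto)
  then have k1: "\<theta> \<subseteq> ker (ext g1)" using \<theta>(2) by (rule subset_trans[rotated])
  \<comment> \<open>The four triples are the graph of the homomorphism from the square of \<open>{\<bottom>, \<top>}\<close> onto \<open>{\<bottom>, a, b, \<top>}\<close>.\<close>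
  have inv: "(ext g1 w, ext g2 w, ext g w) \<in> {(\<bottom>\<^bsub>L\<^esub>, \<bottom>\<^bsub>L\<^esub>, \<bottom>\<^bsub>L\<^esub>), (\<top>\<^bsub>L\<^esub>, \<bottom>\<^bsub>L\<^esub>, a), (\<bottom>\<^bsub>L\<^esub>, \<top>\<^bsub>L\<^esub>, b), (\<top>\<^bsub>L\<^esub>, \<top>\<^bsub>L\<^esub>, \<top>\<^bsub>L\<^esub>)}"
    if "w \<in> carrier F" for w
    using that
  proof (induction rule: carrier_induct)
    case u show ?case by (simp add: E(2) E1(2) E2(2))
  next
    case v show ?case by (simp add: E(3) E1(3) E2(3))
  next
    case (gen w) then show ?case
      using vals by (cases "w = x"; cases "w = y") (auto simp: E(4) E1(4) E2(4))
  next
    case (join s t)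
    have "ext g (s \<squnion>\<^bsub>F\<^esub> t) = ext g s \<squnion>\<^bsub>L\<^esub> ext g t" "ext g1 (s \<squnion>\<^bsub>F\<^esub> t) = ext g1 s \<squnion>\<^bsub>L\<^esub> ext g1 t"
      "ext g2 (s \<squnion>\<^bsub>F\<^esub> t) = ext g2 s \<squnion>\<^bsub>L\<^esub> ext g2 t"
      by (rule lattice_homD(4)[OF E(1) join(1,2)] lattice_homD(4)[OF E1(1) join(1,2)]
          lattice_homD(4)[OF E2(1) join(1,2)])+
    then show ?case
      using join(3,4) by (elim insertE emptyE) (simp_all add: a b ab ba)
  next
    case (meet s t)
    have "ext g (s \<sqinter>\<^bsub>F\<^esub> t) = ext g s \<sqinter>\<^bsub>L\<^esub> ext g t" "ext g1 (s \<sqinter>\<^bsub>F\<^esub> t) = ext g1 s \<sqinter>\<^bsub>L\<^esub> ext g1 t"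
      "ext g2 (s \<sqinter>\<^bsub>F\<^esub> t) = ext g2 s \<sqinter>\<^bsub>L\<^esub> ext g2 t"
      by (rule lattice_homD(5)[OF E(1) meet(1,2)] lattice_homD(5)[OF E1(1) meet(1,2)]
          lattice_homD(5)[OF E2(1) meet(1,2)])+
    then show ?case
      using meet(3,4) by (elim insertE emptyE) (simp_all add: a b ab ba)
  qed
  show ?thesis
  proof
    fix w assume w: "w \<in> \<theta>"
    obtain s t where st: "w = (s, t)" by fastforce
    have "s \<in> carrier F" "t \<in> carrier F" "ext g1 s = ext g1 t" "ext g2 s = ext g2 t"
      using k1 k2 w st by auto
    then have "ext g s = ext g t" using inv[of s] inv[of t] bounds_distinct by auto
    then show "w \<in> ker (ext (two_values x a y b))"
      using \<open>s \<in> carrier F\<close> \<open>t \<in> carrier F\<close> by (simp add: st g_def)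
  qed
qed

text \<open>As \<open>r\<close> is not below \<open>p\<close>, the sublattice generated by \<open>p\<close> and \<open>r\<close> maps onto the two-element
chain with \<open>p \<mapsto> \<bottom>\<close> and \<open>r \<mapsto> \<top>\<close>. The composite \<open>F \<rightarrow> {\<bottom>, \<top>}\<close> collapses \<open>\<theta>\<close> together with \<open>\<Theta>(u, x)\<close>
and \<open>\<Theta>(z, v)\<close>, but not \<open>\<Theta>(u, v)\<close>.\<close>

lemma not_collapsed_by_non_comparable:
  assumes x: "x \<in> S" and z: "z \<in> S" and xz: "x \<noteq> z"
    and \<theta>: "lattice_congruence F \<theta>" "\<theta> \<subseteq> ker (ext (two_values x p z r))"
  shows "\<not> cg u v \<subseteq> cg u x \<squnion>\<^bsub>Con.L\<^esub> (cg z v \<squnion>\<^bsub>Con.L\<^esub> \<theta>)"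
proof
  assume sub: "cg u v \<subseteq> cg u x \<squnion>\<^bsub>Con.L\<^esub> (cg z v \<squnion>\<^bsub>Con.L\<^esub> \<theta>)"
  have F: "x \<in> carrier F" "z \<in> carrier F" using x z S by auto
  define g where "g = two_values x p z r"
  define g' where "g' = two_values x \<bottom>\<^bsub>L\<^esub> z \<top>\<^bsub>L\<^esub>"
  have cl: "g w \<in> carrier L" "g' w \<in> carrier L" for w
    by (simp_all add: g_def g'_def two_values_closed)
  note E = ext[of g, OF cl(1)] and E' = ext[of g', OF cl(2)]
  have vals: "g x = p" "g z = r" "g' x = \<bottom>\<^bsub>L\<^esub>" "g' z = \<top>\<^bsub>L\<^esub>"
    "\<And>w. \<lbrakk>w \<noteq> x; w \<noteq> z\<rbrakk> \<Longrightarrow> g w = \<bottom>\<^bsub>L\<^esub> \<and> g' w = \<bottom>\<^bsub>L\<^esub>"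
    using xz by (simp_all add: g_def g'_def two_values_def)
  \<comment> \<open>The composite map is \<open>\<top>\<close> only above \<open>r\<close> and \<open>\<bottom>\<close> only below \<open>p\<close>.\<close>
  have inv: "(ext g' w = \<top>\<^bsub>L\<^esub> \<and> r \<sqsubseteq>\<^bsub>L\<^esub> ext g w) \<or> (ext g' w = \<bottom>\<^bsub>L\<^esub> \<and> ext g w \<sqsubseteq>\<^bsub>L\<^esub> p)"
    if "w \<in> carrier F" for w
    using that
  proof (induction rule: carrier_induct)
    case u show ?case by (simp add: E(2) E'(2) L.bottom_lower)
  next
    case v show ?case by (simp add: E(3) E'(3) L.top_higher)
  next
    case (gen w) then show ?case
      using vals by (cases "w = x"; cases "w = z") (auto simp: E(4) E'(4) L.bottom_lower)
  next
    case (join s t)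
    have eq: "ext g (s \<squnion>\<^bsub>F\<^esub> t) = ext g s \<squnion>\<^bsub>L\<^esub> ext g t" "ext g' (s \<squnion>\<^bsub>F\<^esub> t) = ext g' s \<squnion>\<^bsub>L\<^esub> ext g' t"
      by (rule lattice_homD(4)[OF E(1) join(1,2)] lattice_homD(4)[OF E'(1) join(1,2)])+
    have "ext g s \<in> carrier L" "ext g t \<in> carrier L" using lattice_homD(3)[OF E(1)] join(1,2) by auto
    then show ?case unfolding eq using join(3,4)
      by (auto intro: L.join_upper1 L.join_upper2 L.join_le)
  next
    case (meet s t)
    have eq: "ext g (s \<sqinter>\<^bsub>F\<^esub> t) = ext g s \<sqinter>\<^bsub>L\<^esub> ext g t" "ext g' (s \<sqinter>\<^bsub>F\<^esub> t) = ext g' s \<sqinter>\<^bsub>L\<^esub> ext g' t"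
      by (rule lattice_homD(5)[OF E(1) meet(1,2)] lattice_homD(5)[OF E'(1) meet(1,2)])+
    have "ext g s \<in> carrier L" "ext g t \<in> carrier L" using lattice_homD(3)[OF E(1)] meet(1,2) by auto
    then show ?case unfolding eq using meet(3,4)
      by (auto intro: L.meet_lower1 L.meet_lower2 L.meet_le)
  qed
  have "\<theta> \<subseteq> ker (ext g')"
  proof
    fix w assume w: "w \<in> \<theta>"
    obtain s t where st: "w = (s, t)" by fastforce
    have stF: "s \<in> carrier F" "t \<in> carrier F" and eq: "ext g s = ext g t"
      using \<theta>(2) w st by (auto simp: g_def)
    have "ext g s \<in> carrier L" using lattice_homD(3)[OF E(1)] stF by simp
    then have "\<not> (r \<sqsubseteq>\<^bsub>L\<^esub> ext g s \<and> ext g s \<sqsubseteq>\<^bsub>L\<^esub> p)" using not_le L.le_trans[of r "ext g s" p] by auto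
    then have "ext g' s = ext g' t" using inv[OF stF(1)] inv[OF stF(2)] eq by auto
    then show "w \<in> ker (ext g')" using stF by (simp add: st)
  qed
  moreover have "cg u x \<subseteq> ker (ext g')"
    by (rule cg(4)[OF u F(1) ker[of g', OF cl(2)]]) (simp add: u F E'(2) E'(4)[OF x] vals)
  moreover have "cg z v \<subseteq> ker (ext g')"
    by (rule cg(4)[OF F(2) v ker[of g', OF cl(2)]]) (simp add: v F E'(3) E'(4)[OF z] vals)
  ultimately have "cg u x \<squnion>\<^bsub>Con.L\<^esub> (cg z v \<squnion>\<^bsub>Con.L\<^esub> \<theta>) \<subseteq> ker (ext g')"
    using cg(1) u v F \<theta>(1) join_Con(1) ker[of g', OF cl(2)] by (intro join_Con(4)) auto
  then have "(u, v) \<in> ker (ext g')" using sub cg(3)[OF u v] by blast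
  then show False using E'(2,3) bounds_distinct by simp
qed

lemma compact_support:
  assumes "\<theta> \<in> compact_elements Con.L"
  shows "\<exists>X W. finite X \<and> X \<subseteq> S \<and> \<theta> = Con.cl W \<and> W \<subseteq> lat_gen F (X \<union> {u, v}) \<times> lat_gen F (X \<union> {u, v})"
proof -
  obtain W where W: "finite W" "W \<subseteq> carrier F \<times> carrier F" "\<theta> = Con.cl W"
    using assms Con.compact_elements_eq by auto
  have "\<exists>X\<subseteq>S. finite X \<and> w \<in> lat_gen F (X \<union> {u, v})" if w: "w \<in> carrier F" for w
  proof -
    have "w \<in> lat_gen F (S \<union> {u, v})" using w generated by blast
    then show ?thesis by (rule lat_gen_finite_support) blast
  qed
  then obtain s where s: "\<And>w. w \<in> carrier F \<Longrightarrow> s w \<subseteq> S \<and> finite (s w) \<and> w \<in> lat_gen F (s w \<union> {u, v})"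
    by metis
  define X where "X = (\<Union>w\<in>W. s (fst w) \<union> s (snd w))"
  have WF: "fst w \<in> carrier F" "snd w \<in> carrier F" if "w \<in> W" for w using W(2) that by auto
  have "finite X" "X \<subseteq> S" unfolding X_def using W(1) s[OF WF(1)] s[OF WF(2)] by blast+
  moreover have "w \<in> lat_gen F (X \<union> {u, v}) \<times> lat_gen F (X \<union> {u, v})" if w: "w \<in> W" for w
  proof -
    have "fst w \<in> lat_gen F (X \<union> {u, v})"
      using s[OF WF(1)[OF w]] lat_gen_mono[of "s (fst w) \<union> {u, v}" "X \<union> {u, v}" F] w by (auto simp: X_def)
    moreover have "snd w \<in> lat_gen F (X \<union> {u, v})"
      using s[OF WF(2)[OF w]] lat_gen_mono[of "s (snd w) \<union> {u, v}" "X \<union> {u, v}" F] w by (auto simp: X_def)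
    ultimately show ?thesis by (cases w) simp
  qed
  ultimately show ?thesis using W(3) by blast
qed

text \<open>Each generator \<open>x\<close> gives two covers of \<open>\<Theta>(u, v)\<close>, namely \<open>P x = (\<Theta>(u, x), \<Theta>(x, v))\<close> and its
mirror image \<open>N x\<close>. The free set theorem yields generators \<open>x\<close>, \<open>y\<close>, \<open>z\<close> such that each of the
distances \<open>c (P x) (N y)\<close>, \<open>c (N y) (P z)\<close> and \<open>c (P x) (P z)\<close> is generated without the third
generator. Only the middle cover is mirrored: \<open>c (P x) (N y)\<close> is then below both
\<open>\<Theta>(u, x) \<or> \<Theta>(y, v)\<close> and \<open>\<Theta>(x, v) \<or> \<Theta>(u, y)\<close>, the bounds that complementary values of \<open>x\<close> and \<open>y\<close> collapse. Under \<open>x \<mapsto> p\<close>, \<open>y \<mapsto> q\<close>, \<open>z \<mapsto> r\<close> the first two distances see only one complemented pair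
each and are collapsed. By the triangle inequality the third is collapsed too, which is impossible
because \<open>r\<close> is not below \<open>p\<close>.\<close>

lemma no_weak_uniform_refinement:
  assumes card: "at_least_aleph2 S"
  shows "\<not> weak_uniform_refinement (Con F)"
proof
  assume "weak_uniform_refinement (Con F)"
  then have wur: "weak_uniform_refinement Con.L" by (simp add: Con_def)
  define e where "e = cg u v"
  have "e \<in> compact_elements Con.L" unfolding e_def by (rule cg(2)[OF u v])
  then obtain c where c: "\<And>i j k. \<lbrakk>i \<in> covers Con.L e; j \<in> covers Con.L e\<rbrakk> \<Longrightarrow> c i j \<in> compact_elements Con.L
      \<and> c i j \<subseteq> fst i \<squnion>\<^bsub>Con.L\<^esub> fst j \<and> c i j \<subseteq> snd i \<squnion>\<^bsub>Con.L\<^esub> snd j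
      \<and> e \<subseteq> fst i \<squnion>\<^bsub>Con.L\<^esub> (snd j \<squnion>\<^bsub>Con.L\<^esub> c i j)
      \<and> (\<forall>k \<in> covers Con.L e. c i k \<subseteq> c i j \<squnion>\<^bsub>Con.L\<^esub> c j k)"
    using wur unfolding weak_uniform_refinement_def le_inclusion_order by metis
  obtain supp gens where supp: "\<And>\<theta>. \<theta> \<in> compact_elements Con.L \<Longrightarrow> finite (supp \<theta>)"
      "\<And>\<theta>. \<theta> \<in> compact_elements Con.L \<Longrightarrow> supp \<theta> \<subseteq> S"
    and gens: "\<And>\<theta>. \<theta> \<in> compact_elements Con.L \<Longrightarrow> Con.cl (gens \<theta>) = \<theta>"
      "\<And>\<theta>. \<theta> \<in> compact_elements Con.L
        \<Longrightarrow> gens \<theta> \<subseteq> lat_gen F (supp \<theta> \<union> {u, v}) \<times> lat_gen F (supp \<theta> \<union> {u, v})"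
    using compact_support by metis
  define P where "P x = (cg u x, cg x v)" for x
  define N where "N x = (cg x v, cg u x)" for x
  have PN: "P x \<in> covers Con.L e" "N x \<in> covers Con.L e" if "x \<in> S" for x
  proof -
    have x: "x \<in> carrier F" using that S by auto
    note con = cg(1)[OF u x] cg(1)[OF x v]
    note J = join_Con[OF con]
    have "(u, x) \<in> cg u x \<squnion>\<^bsub>Con.L\<^esub> cg x v" "(x, v) \<in> cg u x \<squnion>\<^bsub>Con.L\<^esub> cg x v"
      using J(2,3) cg(3)[OF u x] cg(3)[OF x v] by auto
    then have "(u, v) \<in> cg u x \<squnion>\<^bsub>Con.L\<^esub> cg x v" by (rule lattice_congruenceD(4)[OF J(1)])
    then have "e \<subseteq> cg u x \<squnion>\<^bsub>Con.L\<^esub> cg x v" unfolding e_def by (rule cg(4)[OF u v J(1)])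
    then show "P x \<in> covers Con.L e" "N x \<in> covers Con.L e"
      using con join_comm[of Con.L "cg u x"] by (simp_all add: P_def N_def covers_def)
  qed
  \<comment> \<open>The generators that occur in the distances between the covers given by \<open>x\<close> and \<open>y\<close>.\<close>
  define \<Phi> where "\<Phi> x y = supp (c (P x) (N y)) \<union> supp (c (N x) (P y)) \<union> supp (c (P x) (P y))" for x y
  have "finite (\<Phi> x y)" if "x \<in> S" "y \<in> S" for x y
    unfolding \<Phi>_def using supp(1) c PN that by simp
  then obtain x y z where xyz: "x \<in> S" "y \<in> S" "z \<in> S" "x \<noteq> y" "x \<noteq> z" "y \<noteq> z"
    and free: "z \<notin> \<Phi> x y" "y \<notin> \<Phi> x z" "x \<notin> \<Phi> y z"
    using three_element_free_set[OF card] by metis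
  define g where "g w = (if w = x then p else if w = y then q else if w = z then r else \<bottom>\<^bsub>L\<^esub>)" for w
  have g: "g w \<in> carrier L" for w by (simp add: g_def)
  \<comment> \<open>The generators outside the support of \<open>\<theta>\<close> can be sent anywhere.\<close>
  have transfer: "\<theta> \<subseteq> ker (ext g1) \<longleftrightarrow> \<theta> \<subseteq> ker (ext g2)"
    if \<theta>: "\<theta> \<in> compact_elements Con.L" and g1: "\<And>w. g1 w \<in> carrier L" and g2: "\<And>w. g2 w \<in> carrier L"
      and eq: "\<And>w. w \<in> supp \<theta> \<Longrightarrow> g1 w = g2 w" for \<theta> g1 g2
  proof -
    have sub: "\<theta> \<subseteq> ker (ext h) \<longleftrightarrow> gens \<theta> \<subseteq> ker (ext h)" if "\<And>w. h w \<in> carrier L" for h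
      using subset_hull[of "\<lambda>N. N \<in> {\<theta>. lattice_congruence F \<theta>}" "ker (ext h)" "gens \<theta>"]
        gens(1)[OF \<theta>] ker[of h, OF that] by simp
    have ext_eq: "ext g1 w = ext g2 w" if "w \<in> lat_gen F (supp \<theta> \<union> {u, v})" for w
      by (rule ext_local[of g1 g2, OF g1 g2 supp(2)[OF \<theta>] eq that])
    have "w \<in> ker (ext g1) \<longleftrightarrow> w \<in> ker (ext g2)" if "w \<in> gens \<theta>" for w
      using subsetD[OF gens(2)[OF \<theta>] that] by (cases w) (simp add: ext_eq)
    then have "gens \<theta> \<subseteq> ker (ext g1) \<longleftrightarrow> gens \<theta> \<subseteq> ker (ext g2)" by blast
    then show ?thesis using sub[of g1, OF g1] sub[of g2, OF g2] by simp
  qed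
  note PNx = PN[OF xyz(1)] and PNy = PN[OF xyz(2)] and PNz = PN[OF xyz(3)]
  have c1: "c (P x) (N y) \<subseteq> ker (ext g)"
  proof -
    note c_xy = c[OF PNx(1) PNy(2)]
    have "c (P x) (N y) \<subseteq> ker (ext (two_values x p y q))"
      using c_xy by (intro collapsed_by_complements xyz) (simp_all add: P_def N_def)
    moreover have "z \<notin> supp (c (P x) (N y))" using free(1) by (simp add: \<Phi>_def)
    then have "two_values x p y q w = g w" if "w \<in> supp (c (P x) (N y))" for w
      using that by (auto simp: two_values_def g_def)
    ultimately show ?thesis
      using transfer[of "c (P x) (N y)" "two_values x p y q" g] c_xy g two_values_closed[OF pqr(1,2)] by blast
  qed
  have c2: "c (N y) (P z) \<subseteq> ker (ext g)"
  proof -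
    note c_yz = c[OF PNy(2) PNz(1)]
    have "c (N y) (P z) \<subseteq> ker (ext (two_values z r y q))"
      using c_yz xyz(6) join_comm[of Con.L "cg u z"] join_comm[of Con.L "cg z v"]
      by (intro collapsed_by_complements xyz) (simp_all add: P_def N_def)
    moreover have "x \<notin> supp (c (N y) (P z))" using free(3) by (simp add: \<Phi>_def)
    then have "two_values z r y q w = g w" if "w \<in> supp (c (N y) (P z))" for w
      using that xyz by (auto simp: two_values_def g_def)
    ultimately show ?thesis
      using transfer[of "c (N y) (P z)" "two_values z r y q" g] c_yz g two_values_closed[OF pqr(3,2)] by blast
  qed
  note c_xz = c[OF PNx(1) PNz(1)]
  have con: "lattice_congruence F (c i j)" if "i \<in> covers Con.L e" "j \<in> covers Con.L e" for i j
    using c[OF that] by (simp add: compact_elements_def)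
  have "c (P x) (P z) \<subseteq> c (P x) (N y) \<squnion>\<^bsub>Con.L\<^esub> c (N y) (P z)"
    using c[OF PNx(1) PNy(2)] PNz(1) by blast
  also have "\<dots> \<subseteq> ker (ext g)"
    by (rule join_Con(4)[OF con[OF PNx(1) PNy(2)] con[OF PNy(2) PNz(1)] ker[of g, OF g] c1 c2])
  finally have c3: "c (P x) (P z) \<subseteq> ker (ext g)" .
  have "y \<notin> supp (c (P x) (P z))" using free(2) by (simp add: \<Phi>_def)
  then have "g w = two_values x p z r w" if "w \<in> supp (c (P x) (P z))" for w
    using that by (auto simp: two_values_def g_def)
  then have "c (P x) (P z) \<subseteq> ker (ext (two_values x p z r))"
    using transfer[of "c (P x) (P z)" g "two_values x p z r"] c3 c_xz g two_values_closed[OF pqr(1,3)] by blast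
  then have "\<not> e \<subseteq> cg u x \<squnion>\<^bsub>Con.L\<^esub> (cg z v \<squnion>\<^bsub>Con.L\<^esub> c (P x) (P z))"
    unfolding e_def by (intro not_collapsed_by_non_comparable xyz con[OF PNx(1) PNz(1)])
  then show False using c_xz by (simp add: P_def)
qed

end

theorem corollary3p9:
  fixes \<Sigma> :: "(lat_term \<times> lat_term) set"
    and K :: "'k gorder"
    and F :: "'f gorder"
    and S :: "'f set"
  assumes nondistributive: "in_variety \<Sigma> K" "\<not> distributive_lattice K"
    and free: "free_lattice_in \<Sigma> F S \<or> free_bounded_lattice_in \<Sigma> F S"
    and card_generators: "at_least_aleph2 S"
  shows "distributive_lattice (Con F) \<and> algebraic_lattice (Con F)
      \<and> at_least_aleph2 (compact_elements (Con F))
      \<and> (\<nexists>(R :: 'r ring) (M :: ('r, 'm) module). left_module R M \<and> Sub R M \<cong>\<^sub>l Con F)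
      \<and> (\<nexists>G :: 'g monoid. group G \<and> NSub G \<cong>\<^sub>l Con F)
      \<and> (\<nexists>G :: 'h l_group. lattice_ordered_group G \<and> l_Id G \<cong>\<^sub>l Con F)"
proof -
  obtain u v S' where free_over: "lattice_free_over \<Sigma> F u v S'" and S': "at_least_aleph2 S'"
    using free
  proof
    assume "free_lattice_in \<Sigma> F S"
    then show thesis using free_lattice_free_over[OF _ card_generators] that by blast
  next
    assume "free_bounded_lattice_in \<Sigma> F S"
    then show thesis using free_bounded_lattice_free_over card_generators that by blast
  qed
  have "infinite (UNIV :: 'f set)"
    using infinite_if_at_least_aleph2[OF S'] finite_subset[OF subset_UNIV] by blast
  then obtain L :: "'f gorder" and p q r where L: "in_variety \<Sigma> L" "bounded_lattice L"
    "p \<in> carrier L" "q \<in> carrier L" "r \<in> carrier L"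
    "p \<sqinter>\<^bsub>L\<^esub> q = \<bottom>\<^bsub>L\<^esub>" "p \<squnion>\<^bsub>L\<^esub> q = \<top>\<^bsub>L\<^esub>" "r \<sqinter>\<^bsub>L\<^esub> q = \<bottom>\<^bsub>L\<^esub>" "r \<squnion>\<^bsub>L\<^esub> q = \<top>\<^bsub>L\<^esub>"
    "\<not> r \<sqsubseteq>\<^bsub>L\<^esub> p"
    by (rule nondistributive_variety_witness[OF nondistributive])
  interpret free_lattice_with_complements \<Sigma> F u v S' L p q r
    by (intro free_lattice_with_complements.intro free_lattice_with_complements_axioms.intro
        free_over L)
  have alg: "algebraic_lattice (Con F)" using Con.algebraic by (simp add: Con_def)
  have complete: "complete_lattice (Con F)" using Con.complete by (simp add: Con_def)
  have "\<not> Sub R M \<cong>\<^sub>l Con F" if "left_module R M" for R :: "'r ring" and M :: "('r, 'm) module"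
    using weak_uniform_refinement_lattice_iso[OF _ complete_lattice_Sub[OF that] complete
        weak_uniform_refinement_Sub[OF that]] no_weak_uniform_refinement[OF S'] by blast
  moreover have "\<not> NSub G \<cong>\<^sub>l Con F" if "group G" for G :: "'g monoid"
    using weak_uniform_refinement_lattice_iso[OF _ complete_lattice_NSub[OF that] complete
        weak_uniform_refinement_NSub[OF that]] no_weak_uniform_refinement[OF S'] by blast
  moreover have "\<not> l_Id G \<cong>\<^sub>l Con F" if "lattice_ordered_group G" for G :: "'h l_group"
    using weak_uniform_refinement_lattice_iso[OF _ complete_lattice_l_Id[OF that] complete
        weak_uniform_refinement_l_Id[OF that]] no_weak_uniform_refinement[OF S'] by blast
  ultimately show ?thesis
    using distributive_lattice_Con[OF lattice] alg card_compact_elements[OF S'] by blast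
qed

end
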